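(* Let $S$ be a complex curve and let $\mathcal F$ be a variation of mixed Hodge structure of biextension type over $S$, written in a coordinate disk with coordinate $s$ centred at a point of $S$ in local normal form $F(s)=e^{\Gamma(s)}\cdot F$, with $F=F(0)$ and $\Gamma$ holomorphic with values in $\mathfrak q=\mathfrak q_F$, $\Gamma(0)=0$. Let $\gamma^{-1,0}$ be the Hodge component of type $(-1,0)$ of $\Gamma'(0)$. Then, at $s=0$, the Chern form of the biextension metric $h_{\rm biext}(s)=e^{-2\pi\delta(s)}$ is the $(1,1)$-form $$\frac1{2\pi\mathrm i}\partial\bar\partial\log\big(h_{\rm biext}(s)\big)=\mathrm i\,\frac{\partial^2\delta(s)}{\partial s\,\partial\bar s}\,ds\wedge\overline{ds}=\tfrac12\,[\gamma^{-1,0},\bar\gamma^{-1,0}]\,ds\wedge\overline{ds}.$$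
   Context: Biextension type: mixed Hodge structures with weight graded quotients $\operatorname{gr}^W_0=\mathbb Z(0)$, $\operatorname{gr}^W_{-1}=$ a polarized pure Hodge structure of weight $-1$, $\operatorname{gr}^W_{-2}=\mathbb Z(1)$, so $h^{0,0}=h^{-1,-1}=1$ and all other $h^{p,q}=0$ unless $p+q=-1$. A variation of biextension type is a graded-polarized variation of mixed Hodge structure with such fibres $(F_s,W)$. Let $V_{\mathbb C}=\bigoplus I^{p,q}$ be the Deligne bigrading of $(F,W)$: the unique functorial bigrading with $F^p=\bigoplus_{a\ge p}I^{a,b}$, $W_k=\bigoplus_{a+b\le k}I^{a,b}$, $\overline{I^{p,q}}\equiv I^{q,p}$ mod $\bigoplus_{a<q,b<p}I^{a,b}$. $\mathfrak g_{\mathbb C}$ (real form $\mathfrak g_{\mathbb R}$, conjugation denoted by bar) is the Lie algebra of the group of complex automorphisms of $V_{\mathbb C}$ preserving $W$ and the graded polarizations; $\mathfrak g^{r,s}$ consists of the elements mapping each $I^{p,q}$ to $I^{p+r,q+s}$; $\mathfrak q_F=\bigoplus_{r<0}\mathfrak g^{r,s}$; $\Lambda_{F,W}=\bigoplus_{r,s<0}\mathfrak g^{r,s}$, which here is $\mathfrak g^{-1,-1}=\operatorname{Hom}(\operatorname{gr}^W_0,\operatorname{gr}^W_{-2})_{\mathbb C}$, one-dimensional. A variation is horizontal: the tangent of the period map lies in $\bigoplus_s\mathfrak g^{-1,s}$. Deligne splitting: $\delta_{F,W}\in\Lambda_{F,W}\cap\mathfrak g_{\mathbb R}$ is the unique element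 such that $(e^{-\mathrm i\delta_{F,W}}F,W)$ is split over $\mathbb R$; explicitly $\delta_{F,W}=\frac1{4\mathrm i}(Y_{F,W}-\overline{Y_{F,W}})$, where $Y_{F,W}$ acts on $I^{p,q}$ as multiplication by $p+q$. Fixing bases of $\operatorname{gr}^W_0$ and $\operatorname{gr}^W_{-2}$, $\delta_{F,W}$ is viewed as a real number. There is a nonzero real constant $\lambda$, depending only on $W$, such that $e^{-2\pi\delta_{F,W}/\lambda}$ depends only on the equivalence class of the biextension. One sets $\delta(s)=\delta_{F_s,W}/\lambda$ and $h_{\rm biext}(s)=e^{-2\pi\delta(s)}$. The element $[\gamma^{-1,0},\bar\gamma^{-1,0}]\in\mathfrak g^{-1,-1}$ is read as a complex number by the $\mathbb C$-linear extension of the same normalized identification (divided by $\lambda$). *)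

theory Defs
  imports "HOL-Analysis.Analysis"
begin

section \<open>Lattice, real structure, matrices\<close>

text \<open>The complex vector space underlying all Hodge structures is \<open>complex ^ 'n\<close>, with integral
  lattice the vectors with integer entries; complex conjugation is then entrywise.\<close>

definition lattice :: "(complex ^ 'n) set" where
  "lattice = {v. \<forall>i. v $ i \<in> \<int>}"

definition conjv :: "complex ^ 'n \<Rightarrow> complex ^ 'n" where
  "conjv v = (\<chi> i. cnj (v $ i))"

text \<open>The matrix of \<open>conjv \<circ> A \<circ> conjv\<close>.\<close>

definition conjm :: "complex ^ 'n ^ 'n \<Rightarrow> complex ^ 'n ^ 'n" where
  "conjm A = (\<chi> i j. cnj (A $ i $ j))"

definition commutator :: "complex ^ 'n ^ 'n \<Rightarrow> complex ^ 'n ^ 'n \<Rightarrow> complex ^ 'n ^ 'n" where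
  "commutator A B = A ** B - B ** A"

definition matrix_exp :: "complex ^ 'n ^ 'n \<Rightarrow> complex ^ 'n ^ 'n" where
  "matrix_exp A = (\<Sum>k. (1 / fact k) *\<^sub>R (((**) A) ^^ k) (mat 1))"

definition holomorphic_vec_on :: "(complex \<Rightarrow> complex ^ 'n) \<Rightarrow> complex set \<Rightarrow> bool" where
  "holomorphic_vec_on v U \<longleftrightarrow> (\<forall>i. (\<lambda>z. v z $ i) holomorphic_on U)"

definition deriv_vec :: "(complex \<Rightarrow> complex ^ 'n) \<Rightarrow> complex \<Rightarrow> complex ^ 'n" where
  "deriv_vec v z = (\<chi> i. deriv (\<lambda>w. v w $ i) z)"

definition holomorphic_mat_on :: "(complex \<Rightarrow> complex ^ 'n ^ 'n) \<Rightarrow> complex set \<Rightarrow> bool" where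
  "holomorphic_mat_on A U \<longleftrightarrow> (\<forall>i j. (\<lambda>z. A z $ i $ j) holomorphic_on U)"

definition deriv_mat :: "(complex \<Rightarrow> complex ^ 'n ^ 'n) \<Rightarrow> complex \<Rightarrow> complex ^ 'n ^ 'n" where
  "deriv_mat A z = (\<chi> i j. deriv (\<lambda>w. A w $ i $ j) z)"


section \<open>Graded-polarized mixed Hodge structures\<close>

type_synonym 'n filtration = "int \<Rightarrow> (complex ^ 'n) set"

text \<open>Subspaces of the graded quotient \<open>W k / W (k - 1)\<close> are represented by their preimages
  in \<open>W k\<close>. The next set is the preimage of the filtration step induced by \<open>F p\<close>.\<close>

definition gr_F :: "'n::finite filtration \<Rightarrow> 'n filtration \<Rightarrow> int \<Rightarrow> int \<Rightarrow> (complex ^ 'n) set" where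
  "gr_F W F k p = (F p \<inter> W k) + W (k - 1)"

definition mixed_hodge_structure :: "'n::finite filtration \<Rightarrow> 'n filtration \<Rightarrow> bool" where
  "mixed_hodge_structure W F \<longleftrightarrow>
     (\<forall>k. W k = vec.span (W k \<inter> lattice)) \<and> mono W \<and> (\<exists>k. W k = {0}) \<and> (\<exists>k. W k = UNIV) \<and>
     (\<forall>p. vec.subspace (F p)) \<and> antimono F \<and> (\<exists>p. F p = UNIV) \<and> (\<exists>p. F p = {0}) \<and>
     (\<forall>k p. gr_F W F k p + conjv ` gr_F W F k (k + 1 - p) = W k \<and>
            gr_F W F k p \<inter> conjv ` gr_F W F k (k + 1 - p) = W (k - 1))"

text \<open>Preimage in \<open>W (p + q)\<close> of the Hodge component of type \<open>(p, q)\<close>.\<close>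

definition hodge_piece :: "'n::finite filtration \<Rightarrow> 'n filtration \<Rightarrow> int \<Rightarrow> int \<Rightarrow> (complex ^ 'n) set" where
  "hodge_piece W F p q = gr_F W F (p + q) p \<inter> conjv ` gr_F W F (p + q) q"

definition hodge_number :: "'n::finite filtration \<Rightarrow> 'n filtration \<Rightarrow> int \<Rightarrow> int \<Rightarrow> nat" where
  "hodge_number W F p q = vec.dim (hodge_piece W F p q) - vec.dim (W (p + q - 1))"

text \<open>\<open>Q k\<close> is a bilinear form on \<open>W k\<close> that descends to the graded quotient of weight \<open>k\<close>;
  its values off \<open>W k\<close> are irrelevant. The last two clauses are the Riemann bilinear relations,
  with Weil operator \<open>\<i> powi (p - q)\<close> on type \<open>(p, q)\<close>.\<close>

definition graded_polarization ::
  "'n::finite filtration \<Rightarrow> 'n filtration \<Rightarrow> (int \<Rightarrow> complex ^ 'n \<Rightarrow> complex ^ 'n \<Rightarrow> complex) \<Rightarrow> bool" where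
  "graded_polarization W F Q \<longleftrightarrow>
     (\<forall>k. \<forall>x\<in>W k. \<forall>y\<in>W k. \<forall>z\<in>W k. \<forall>c.
        Q k (x + y) z = Q k x z + Q k y z \<and> Q k (c *s x) y = c * Q k x y \<and>
        Q k x y = (-1) powi k * Q k y x) \<and>
     (\<forall>k. \<forall>x\<in>W (k - 1). \<forall>y\<in>W k. Q k x y = 0) \<and>
     (\<forall>k. \<forall>x\<in>W k \<inter> lattice. \<forall>y\<in>W k \<inter> lattice. Q k x y \<in> \<rat>) \<and>
     (\<forall>k p. \<forall>x\<in>gr_F W F k p. \<forall>y\<in>gr_F W F k (k + 1 - p). Q k x y = 0) \<and>
     (\<forall>p q. \<forall>x\<in>hodge_piece W F p q - W (p + q - 1).
        \<exists>c>0. \<i> powi (p - q) * Q (p + q) x (conjv x) = complex_of_real c)"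

text \<open>The conditions on Hodge numbers force weights \<open>0, -1, -2\<close>. The extreme graded quotients are
  then torsion-free of rank one and types \<open>(0, 0)\<close>, \<open>(-1, -1)\<close>, i.e. they are \<open>\<int>(0)\<close> and \<open>\<int>(1)\<close>.\<close>

definition biextension_type ::
  "'n::finite filtration \<Rightarrow> 'n filtration \<Rightarrow> (int \<Rightarrow> complex ^ 'n \<Rightarrow> complex ^ 'n \<Rightarrow> complex) \<Rightarrow> bool" where
  "biextension_type W F Q \<longleftrightarrow>
     mixed_hodge_structure W F \<and> graded_polarization W F Q \<and>
     hodge_number W F 0 0 = 1 \<and> hodge_number W F (-1) (-1) = 1 \<and>
     (\<forall>p q. (p, q) \<noteq> (0, 0) \<and> (p, q) \<noteq> (-1, -1) \<and> p + q \<noteq> -1 \<longrightarrow> hodge_number W F p q = 0)"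


section \<open>Deligne bigrading and the Lie algebra\<close>

definition direct_sum_decomposition :: "(int \<Rightarrow> int \<Rightarrow> (complex ^ 'n) set) \<Rightarrow> bool" where
  "direct_sum_decomposition I \<longleftrightarrow>
     (\<forall>p q. vec.subspace (I p q)) \<and>
     vec.span (\<Union>p q. I p q) = UNIV \<and>
     (\<forall>A v. finite A \<and> (\<forall>(p, q)\<in>A. v p q \<in> I p q) \<and> (\<Sum>(p, q)\<in>A. v p q) = 0
        \<longrightarrow> (\<forall>(p, q)\<in>A. v p q = 0))"

definition is_deligne_bigrading ::
  "'n::finite filtration \<Rightarrow> 'n filtration \<Rightarrow> (int \<Rightarrow> int \<Rightarrow> (complex ^ 'n) set) \<Rightarrow> bool" where
  "is_deligne_bigrading W F I \<longleftrightarrow>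
     direct_sum_decomposition I \<and>
     (\<forall>p. F p = vec.span (\<Union>{I a b | a b. a \<ge> p})) \<and>
     (\<forall>k. W k = vec.span (\<Union>{I a b | a b. a + b \<le> k})) \<and>
     (\<forall>p q. let U = vec.span (\<Union>{I a b | a b. a < q \<and> b < p})
            in conjv ` I p q + U = I q p + U)"

definition deligne_bigrading ::
  "'n::finite filtration \<Rightarrow> 'n filtration \<Rightarrow> int \<Rightarrow> int \<Rightarrow> (complex ^ 'n) set" where
  "deligne_bigrading W F = (THE I. is_deligne_bigrading W F I)"

definition aut_group ::
  "'n::finite filtration \<Rightarrow> (int \<Rightarrow> complex ^ 'n \<Rightarrow> complex ^ 'n \<Rightarrow> complex) \<Rightarrow> (complex ^ 'n ^ 'n) set" where
  "aut_group W Q = {g. invertible g \<and> (\<forall>k. ((*v) g) ` W k = W k) \<and>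
     (\<forall>k. \<forall>x\<in>W k. \<forall>y\<in>W k. Q k (g *v x) (g *v y) = Q k x y)}"

definition lie_alg ::
  "'n::finite filtration \<Rightarrow> (int \<Rightarrow> complex ^ 'n \<Rightarrow> complex ^ 'n \<Rightarrow> complex) \<Rightarrow> (complex ^ 'n ^ 'n) set" where
  "lie_alg W Q = {X. \<forall>t::real. matrix_exp (t *\<^sub>R X) \<in> aut_group W Q}"

definition lie_piece ::
  "'n::finite filtration \<Rightarrow> (int \<Rightarrow> complex ^ 'n \<Rightarrow> complex ^ 'n \<Rightarrow> complex) \<Rightarrow> 'n filtration
     \<Rightarrow> int \<Rightarrow> int \<Rightarrow> (complex ^ 'n ^ 'n) set" where
  "lie_piece W Q F r s = {X \<in> lie_alg W Q.
     \<forall>p q. ((*v) X) ` deligne_bigrading W F p q \<subseteq> deligne_bigrading W F (p + r) (q + s)}"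

text \<open>Here and below, \<open>span\<close> is the real span; since every \<open>lie_piece\<close> is a complex subspace,
  the real span of a union of these is its complex span.\<close>

definition q_alg ::
  "'n::finite filtration \<Rightarrow> (int \<Rightarrow> complex ^ 'n \<Rightarrow> complex ^ 'n \<Rightarrow> complex) \<Rightarrow> 'n filtration
     \<Rightarrow> (complex ^ 'n ^ 'n) set" where
  "q_alg W Q F = span (\<Union>{lie_piece W Q F r s | r s. r < 0})"

definition horizontal_part ::
  "'n::finite filtration \<Rightarrow> (int \<Rightarrow> complex ^ 'n \<Rightarrow> complex ^ 'n \<Rightarrow> complex) \<Rightarrow> 'n filtration
     \<Rightarrow> (complex ^ 'n ^ 'n) set" where
  "horizontal_part W Q F = span (\<Union>s. lie_piece W Q F (-1) s)"

definition hodge_component ::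
  "'n::finite filtration \<Rightarrow> (int \<Rightarrow> complex ^ 'n \<Rightarrow> complex ^ 'n \<Rightarrow> complex) \<Rightarrow> 'n filtration
     \<Rightarrow> int \<Rightarrow> int \<Rightarrow> complex ^ 'n ^ 'n \<Rightarrow> complex ^ 'n ^ 'n" where
  "hodge_component W Q F r s X = (THE Z. Z \<in> lie_piece W Q F r s \<and>
     X - Z \<in> span (\<Union>{lie_piece W Q F a b | a b. (a, b) \<noteq> (r, s)}))"


section \<open>Variations of biextension type over an open subset of the complex plane\<close>

text \<open>A holomorphically varying filtration: every \<open>F z p\<close> is the fibre of a holomorphic subbundle.\<close>

definition holomorphic_filtration :: "complex set \<Rightarrow> (complex \<Rightarrow> 'n::finite filtration) \<Rightarrow> bool" where
  "holomorphic_filtration D F \<longleftrightarrow>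
     (\<forall>p. \<forall>z\<in>D. \<forall>w\<in>D. vec.dim (F z p) = vec.dim (F w p)) \<and>
     (\<forall>p. \<forall>z\<in>D. \<forall>x\<in>F z p. \<exists>U v. open U \<and> z \<in> U \<and> U \<subseteq> D \<and> holomorphic_vec_on v U \<and>
        (\<forall>w\<in>U. v w \<in> F w p) \<and> v z = x)"

text \<open>\<open>\<xi>\<close> represents the tangent at \<open>z\<close> of the period map: the tangent space of the flag variety at
  \<open>F z\<close> consists of families of maps from \<open>F z p\<close> to the quotient by \<open>F z p\<close>, and the tangent of
  the period map sends the value of a local section of \<open>F p\<close> to the class of its derivative.\<close>

definition represents_period_tangent ::
  "complex set \<Rightarrow> (complex \<Rightarrow> 'n::finite filtration) \<Rightarrow> complex \<Rightarrow> complex ^ 'n ^ 'n \<Rightarrow> bool" where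
  "represents_period_tangent D F z \<xi> \<longleftrightarrow>
     (\<forall>p U v. open U \<and> z \<in> U \<and> U \<subseteq> D \<and> holomorphic_vec_on v U \<and> (\<forall>w\<in>U. v w \<in> F w p)
        \<longrightarrow> deriv_vec v z - \<xi> *v v z \<in> F z p)"

text \<open>The underlying local system is trivialised, so that \<open>W\<close>, \<open>Q\<close> and the lattice are constant.\<close>

definition biextension_variation ::
  "complex set \<Rightarrow> 'n::finite filtration \<Rightarrow> (int \<Rightarrow> complex ^ 'n \<Rightarrow> complex ^ 'n \<Rightarrow> complex)
     \<Rightarrow> (complex \<Rightarrow> 'n filtration) \<Rightarrow> bool" where
  "biextension_variation D W Q F \<longleftrightarrow>
     (\<forall>z\<in>D. biextension_type W (F z) Q) \<and>
     holomorphic_filtration D F \<and>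
     (\<forall>z\<in>D. \<exists>\<xi>\<in>horizontal_part W Q (F z). represents_period_tangent D F z \<xi>)"

definition local_normal_form ::
  "complex set \<Rightarrow> 'n::finite filtration \<Rightarrow> (int \<Rightarrow> complex ^ 'n \<Rightarrow> complex ^ 'n \<Rightarrow> complex)
     \<Rightarrow> (complex \<Rightarrow> 'n filtration) \<Rightarrow> (complex \<Rightarrow> complex ^ 'n ^ 'n) \<Rightarrow> bool" where
  "local_normal_form D W Q F \<Gamma> \<longleftrightarrow>
     holomorphic_mat_on \<Gamma> D \<and> (\<forall>z\<in>D. \<Gamma> z \<in> q_alg W Q (F 0)) \<and> \<Gamma> 0 = 0 \<and>
     (\<forall>z\<in>D. \<forall>p. F z p = ((*v) (matrix_exp (\<Gamma> z))) ` F 0 p)"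


section \<open>Deligne splitting and the biextension metric\<close>

definition deligne_Y :: "'n::finite filtration \<Rightarrow> 'n filtration \<Rightarrow> complex ^ 'n ^ 'n" where
  "deligne_Y W F = (THE Y. \<forall>p q. \<forall>v\<in>deligne_bigrading W F p q. Y *v v = of_int (p + q) *s v)"

definition deligne_delta :: "'n::finite filtration \<Rightarrow> 'n filtration \<Rightarrow> complex ^ 'n ^ 'n" where
  "deligne_delta W F =
     (\<chi> i j. (deligne_Y W F $ i $ j - conjm (deligne_Y W F) $ i $ j) / (4 * \<i>))"

text \<open>\<open>e\<close> is a real lift of a basis of the quotient of weight \<open>0\<close>, \<open>f\<close> a real basis of \<open>W (-2)\<close>.\<close>

definition extreme_gr_bases :: "'n::finite filtration \<Rightarrow> complex ^ 'n \<Rightarrow> complex ^ 'n \<Rightarrow> bool" where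
  "extreme_gr_bases W e f \<longleftrightarrow>
     conjv e = e \<and> e \<in> W 0 \<and> e \<notin> W (-1) \<and> conjv f = f \<and> f \<in> W (-2) \<and> f \<noteq> 0"

text \<open>Coordinate, in these bases, of a homomorphism from weight \<open>0\<close> to weight \<open>-2\<close>,
  divided by the normalizing constant \<open>l\<close>.\<close>

definition hom_coord :: "real \<Rightarrow> complex ^ 'n \<Rightarrow> complex ^ 'n \<Rightarrow> complex ^ 'n ^ 'n \<Rightarrow> complex" where
  "hom_coord l e f X = (THE c. X *v e = c *s f) / complex_of_real l"

text \<open>As \<open>deligne_delta\<close>, \<open>e\<close> and \<open>f\<close> are real, the coordinate is real and \<open>Re\<close> loses nothing.\<close>

definition biext_delta ::
  "'n::finite filtration \<Rightarrow> real \<Rightarrow> complex ^ 'n \<Rightarrow> complex ^ 'n \<Rightarrow> 'n filtration \<Rightarrow> real" where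
  "biext_delta W l e f F = Re (hom_coord l e f (deligne_delta W F))"

definition h_biext ::
  "'n::finite filtration \<Rightarrow> real \<Rightarrow> complex ^ 'n \<Rightarrow> complex ^ 'n \<Rightarrow> 'n filtration \<Rightarrow> real" where
  "h_biext W l e f F = exp (- 2 * pi * biext_delta W l e f F)"


section \<open>Differential forms in one complex variable\<close>

text \<open>A \<open>1\<close>-form sends a point and a tangent vector to a complex number, a \<open>2\<close>-form sends a point
  and two tangent vectors to a complex number.\<close>

definition wirtinger :: "(complex \<Rightarrow> complex) \<Rightarrow> complex \<Rightarrow> complex" where
  "wirtinger g z = (frechet_derivative g (at z) 1 - \<i> * frechet_derivative g (at z) \<i>) / 2"

definition wirtinger_bar :: "(complex \<Rightarrow> complex) \<Rightarrow> complex \<Rightarrow> complex" where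
  "wirtinger_bar g z = (frechet_derivative g (at z) 1 + \<i> * frechet_derivative g (at z) \<i>) / 2"

definition ds_dsbar :: "complex \<Rightarrow> complex \<Rightarrow> complex" where
  "ds_dsbar u v = u * cnj v - v * cnj u"

definition delbar :: "(complex \<Rightarrow> complex) \<Rightarrow> complex \<Rightarrow> complex \<Rightarrow> complex" where
  "delbar g z u = wirtinger_bar g z * cnj u"

text \<open>On \<open>1\<close>-forms, \<open>\<partial> (a ds + b ds\<^bsup>-\<^esup>) = (\<partial>b/\<partial>s) ds \<and> ds\<^bsup>-\<^esup>\<close>; the coefficient \<open>b\<close> is recovered from the
  values of the form on the tangent vectors \<open>1\<close> and \<open>\<i>\<close>.\<close>

definition del_form ::
  "(complex \<Rightarrow> complex \<Rightarrow> complex) \<Rightarrow> complex \<Rightarrow> complex \<Rightarrow> complex \<Rightarrow> complex" where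
  "del_form \<omega> z u v = wirtinger (\<lambda>w. (\<omega> w 1 + \<i> * \<omega> w \<i>) / 2) z * ds_dsbar u v"

definition chern_form :: "(complex \<Rightarrow> real) \<Rightarrow> complex \<Rightarrow> complex \<Rightarrow> complex \<Rightarrow> complex" where
  "chern_form h z u v =
     1 / (2 * complex_of_real pi * \<i>) * del_form (delbar (\<lambda>w. complex_of_real (ln (h w)))) z u v"

definition twice_differentiable_at :: "(complex \<Rightarrow> real) \<Rightarrow> complex \<Rightarrow> bool" where
  "twice_differentiable_at g z \<longleftrightarrow>
     (\<forall>\<^sub>F w in nhds z. g differentiable (at w)) \<and>
     (\<forall>v. (\<lambda>w. frechet_derivative g (at w) v) differentiable (at z))"

end

(* Let v span I^{0,0} at s = 0 with v lifting e, let E(s) = exp (Gamma(s)), and let K = F^0 \<inter> W_{-1}, so that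
   W_{-1} = K + conj K + C f. The generator of I^{0,0} at s is E(s) v - E(s) k(s), where k(s) in K makes it real
   modulo f; its imaginary part along f is delta(s). The equation for k is a linear system
   M(s) x(s) = E(s) v - conj (E(s) v), M = E pr_K + conj E pr_{conj K} + pr_v + pr_f, whose coefficients are sums of
   holomorphic and antiholomorphic functions, with M(0) = 1. Hence x is smooth, and the mixed derivative of x at 0
   only involves first derivatives: with g = Gamma'(0) it is g pr_K conj g conj v - conj g pr_{conj K} g v.
   By horizontality g maps v to I^{-1,0} modulo f, so the f-component of this vector is the commutator of
   the (-1,0)-component of g with its conjugate. *)

theory Submission
  imports Defs "HOL-Complex_Analysis.Cauchy_Integral_Formula"
begin

section \<open>Conjugation and direct sum decompositions\<close>

text \<open>\<open>I^{0,0}\<close> at \<open>s\<close> is cut out by \<open>F s\<close> together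
  with its conjugate, so its generator is neither holomorphic nor antiholomorphic in
  \<open>s\<close>, and the condition on \<open>k\<close> is only real-linear. Treating
  \<open>k\<close> and \<open>- conjv k\<close> as independent unknowns makes it complex-linear; the
  solution has the required form by uniqueness, because the right-hand side is the negative of its
  conjugate. The blocks \<open>pr_v\<close> and \<open>pr_f\<close> complete the system to a square
  one. The constant: with \<open>c f\<close> the defect of the generator from being real,
  \<open>delta\<close> is \<open>- (\<i> / 2) * c\<close> divided by the normalizing constant, and
  \<open>\<i> * (- \<i> / 2) = 1 / 2\<close>. Horizontality concerns the period map, whereas the
  normal form only places \<open>Gamma\<close> in \<open>q\<close>; it reaches
  \<open>Gamma'(0)\<close> because an endomorphism that strictly lowers the first Hodge index and
  preserves \<open>F\<close> is zero. The bigrading, \<open>Y\<close> and the Hodge components are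
  definite descriptions, so existence and uniqueness have to be proved for each; for biextension
  type the bigrading has a closed formula.\<close>

lemma conjv_conjv [simp]: "conjv (conjv x) = x"
  by (simp add: conjv_def vec_eq_iff)

lemma conjv_0 [simp]: "conjv 0 = 0"
  by (simp add: conjv_def vec_eq_iff)

lemma conjv_add: "conjv (x + y) = conjv x + conjv y"
  by (simp add: conjv_def vec_eq_iff)

lemma conjv_diff: "conjv (x - y) = conjv x - conjv y"
  by (simp add: conjv_def vec_eq_iff)

lemma conjv_minus: "conjv (- x) = - conjv x"
  by (simp add: conjv_def vec_eq_iff)

lemma conjv_scale: "conjv (c *s x) = cnj c *s conjv x"
  by (simp add: conjv_def vec_eq_iff)

lemma conjm_mult_vec: "conjm A *v x = conjv (A *v conjv x)"
  by (simp add: conjm_def conjv_def matrix_vector_mult_def vec_eq_iff)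

lemma in_conjv_image: "x \<in> conjv ` S \<longleftrightarrow> conjv x \<in> S"
  by (metis conjv_conjv image_iff)

lemma subspace_conjv_image:
  fixes S :: "(complex ^ 'n) set"
  assumes "vec.subspace S" shows "vec.subspace (conjv ` S)"
  unfolding vec.subspace_def
  using assms by (auto simp: in_conjv_image conjv_add conjv_scale vec.subspace_def)

text \<open>Collecting the vectors of a linear combination by index leaves one vector per subspace,
  the form in which \<open>direct_sum_decomposition\<close> states independence.\<close>

lemma span_Union_obtain:
  fixes I :: "'i \<Rightarrow> (complex ^ 'n) set"
  assumes "x \<in> vec.span (\<Union>i\<in>T. I i)" and sub: "\<And>i. vec.subspace (I i)"
  shows "\<exists>A v. finite A \<and> A \<subseteq> T \<and> (\<forall>i. v i \<in> I i) \<and> x = (\<Sum>i\<in>A. v i)"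
  using assms(1)
proof (induction rule: vec.span_induct_alt)
  case base
  have "finite {} \<and> {} \<subseteq> T \<and> (\<forall>i. 0 \<in> I i) \<and> 0 = (\<Sum>i\<in>{}. 0)"
    using sub by (auto simp: vec.subspace_0)
  then show ?case by (intro exI[of _ "{}"] exI[of _ "\<lambda>_. 0"]) auto
next
  case (step c x y)
  then obtain A v where A: "finite A" "A \<subseteq> T" "\<forall>i. v i \<in> I i" "y = sum v A" by blast
  from step obtain j where j: "j \<in> T" "x \<in> I j" by blast
  \<comment> \<open>The new summand is merged into the entry at \<open>j\<close>. For a new index
    the old value \<open>v j\<close> was not part of the sum and is dropped.\<close>
  define v' where "v' i = (if i = j then c *s x + (if j \<in> A then v j else 0) else v i)" for i
  have "\<forall>i. v' i \<in> I i"
    using A(3) j sub by (auto simp: v'_def vec.subspace_add vec.subspace_scale vec.subspace_0)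
  moreover have "c *s x + y = sum v' (insert j A)"
  proof (cases "j \<in> A")
    case True
    then have "sum v' (insert j A) = v' j + sum v' (A - {j})"
      using A(1) by (simp add: insert_absorb sum.remove)
    also have "sum v' (A - {j}) = sum v (A - {j})" by (rule sum.cong) (auto simp: v'_def)
    also have "v' j + sum v (A - {j}) = c *s x + sum v A"
      using True A(1) by (simp add: v'_def sum.remove)
    finally show ?thesis using A by simp
  next
    case False
    then have "sum v' (insert j A) = v' j + sum v' A" using A(1) by simp
    also have "sum v' A = sum v A" by (rule sum.cong) (use False in \<open>auto simp: v'_def\<close>)
    finally show ?thesis using A False by (simp add: v'_def)
  qed
  ultimately show ?case using A j by (intro exI[of _ "insert j A"] exI[of _ v']) auto
qed

text \<open>The \<open>A\<close>-component of a vector is unique because \<open>A\<close> and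
  \<open>B\<close> meet only in zero, hence it depends linearly on the vector, and
  \<open>matrix\<close> encodes it.\<close>

lemma projection_exists:
  fixes A B :: "(complex ^ 'n::finite) set"
  assumes "vec.subspace A" "vec.subspace B" and AB: "\<And>x. x \<in> A \<Longrightarrow> x \<in> B \<Longrightarrow> x = 0"
    and sum: "\<And>x. \<exists>a\<in>A. \<exists>b\<in>B. x = a + b"
  obtains P :: "complex ^ 'n ^ 'n" where "\<And>x. x \<in> A \<Longrightarrow> P *v x = x" "\<And>x. x \<in> B \<Longrightarrow> P *v x = 0"
    "\<And>x. P *v x \<in> A"
proof -
  define p where "p x = (THE a. a \<in> A \<and> x - a \<in> B)" for x
  have p: "p x = a" if "a \<in> A" "x - a \<in> B" for x a
    unfolding p_def
  proof (rule the_equality)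
    fix a' assume "a' \<in> A \<and> x - a' \<in> B"
    then have "a' - a \<in> A" "a' - a \<in> B"
      using that assms(1,2) vec.subspace_diff[of A a' a] vec.subspace_diff[of B "x - a" "x - a'"] by auto
    then show "a' = a" using AB by force
  qed (use that in auto)
  have px: "p x \<in> A \<and> x - p x \<in> B" for x
  proof -
    obtain a b where "a \<in> A" "b \<in> B" "x = a + b" using sum by blast
    then show ?thesis using p[of a x] by simp
  qed
  have lin: "Vector_Spaces.linear (*s) (*s) p"
  proof (unfold_locales; (rule p)?)
    fix x y c
    show "p x + p y \<in> A" using px assms(1) vec.subspace_add by blast
    have "(x - p x) + (y - p y) \<in> B" using px assms(2) vec.subspace_add by blast
    then show "x + y - (p x + p y) \<in> B" by (simp add: algebra_simps)
    show "c *s p x \<in> A" using px assms(1) vec.subspace_scale by blast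
    have "c *s (x - p x) \<in> B" using px assms(2) vec.subspace_scale by blast
    then show "c *s x - c *s p x \<in> B" by (simp add: vec.scale_right_diff_distrib)
  qed
  have "matrix p *v x = p x" for x by (rule matrix_works[OF lin])
  moreover have "p x = x" if "x \<in> A" for x by (rule p) (use that assms(2) in \<open>auto simp: vec.subspace_0\<close>)
  moreover have "p x = 0" if "x \<in> B" for x by (rule p) (use that assms(1) in \<open>auto simp: vec.subspace_0\<close>)
  ultimately show ?thesis using px that by metis
qed

text \<open>The filtration steps and the blocks of the linear system are sums of pieces over sets of
  types. Indexing by such sets turns statements about subspaces into inclusion or disjointness of
  index sets.\<close>

definition piece_span :: "(int \<Rightarrow> int \<Rightarrow> (complex ^ 'n) set) \<Rightarrow> (int \<times> int) set \<Rightarrow> (complex ^ 'n) set" where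
  "piece_span I T = vec.span (\<Union>(a, b)\<in>T. I a b)"

lemma subspace_piece_span: "vec.subspace (piece_span I T)"
  by (simp add: piece_span_def)

lemma piece_in_piece_span: "x \<in> I a b \<Longrightarrow> (a, b) \<in> T \<Longrightarrow> x \<in> piece_span I T"
  unfolding piece_span_def by (rule vec.span_base) blast

lemma piece_span_minimal:
  assumes "vec.subspace S" "\<And>a b. (a, b) \<in> T \<Longrightarrow> I a b \<subseteq> S"
  shows "piece_span I T \<subseteq> S"
  unfolding piece_span_def by (rule vec.span_minimal) (use assms in auto)

lemma piece_span_mono: "T \<subseteq> T' \<Longrightarrow> piece_span I T \<subseteq> piece_span I T'"
  by (rule piece_span_minimal[OF subspace_piece_span]) (auto intro: piece_in_piece_span)

lemma piece_span_Collect: "vec.span (\<Union>{I a b | a b. P a b}) = piece_span I {(a, b). P a b}"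
  unfolding piece_span_def by (rule arg_cong[of _ _ vec.span]) auto

lemma piece_span_UNIV: "vec.span (\<Union>p q. I p q) = piece_span I UNIV"
  unfolding piece_span_def by (rule arg_cong[of _ _ vec.span]) auto

text \<open>Expand \<open>x\<close> over \<open>S\<close> and over \<open>T\<close>: the difference
  is a vanishing sum over distinct types, so each of its terms is zero.\<close>

lemma piece_span_disjoint:
  assumes "direct_sum_decomposition I" "S \<inter> T = {}" "x \<in> piece_span I S" "x \<in> piece_span I T"
  shows "x = 0"
proof -
  let ?I = "\<lambda>(a, b). I a b"
  have sub: "\<And>i. vec.subspace (?I i)" using assms(1) by (auto simp: direct_sum_decomposition_def)
  obtain A v where A: "finite A" "A \<subseteq> S" "\<forall>i. v i \<in> ?I i" "x = sum v A"
    using span_Union_obtain[of x ?I S, OF assms(3)[unfolded piece_span_def] sub] by blast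
  obtain B w where B: "finite B" "B \<subseteq> T" "\<forall>i. w i \<in> ?I i" "x = sum w B"
    using span_Union_obtain[of x ?I T, OF assms(4)[unfolded piece_span_def] sub] by blast
  define u where "u i = (if i \<in> A then v i else - w i)" for i
  have dj: "A \<inter> B = {}" using A B assms(2) by auto
  have "sum u (A \<union> B) = sum u A + sum u B" using A B dj by (intro sum.union_disjoint) auto
  also have "sum u A = x" unfolding A(4) by (rule sum.cong) (auto simp: u_def)
  also have "sum u B = - x" unfolding B(4) sum_negf[symmetric] by (rule sum.cong) (use dj in \<open>auto simp: u_def\<close>)
  finally have "(\<Sum>(p, q)\<in>A \<union> B. u (p, q)) = 0" by (simp add: split_def)
  moreover have "\<forall>(p, q)\<in>A \<union> B. u (p, q) \<in> I p q"
  proof (clarify)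
    fix p q
    have "- w (p, q) \<in> I p q" "v (p, q) \<in> I p q"
      using A(3) B(3) sub[of "(p, q)"] by (auto intro: vec.subspace_neg)
    then show "u (p, q) \<in> I p q" by (simp add: u_def)
  qed
  ultimately have U: "\<forall>(p, q)\<in>A \<union> B. u (p, q) = 0"
    using assms(1) A(1) B(1) unfolding direct_sum_decomposition_def
    by (meson finite_Un)
  have "v i = 0" if "i \<in> A" for i using bspec[OF U, of i] that by (simp add: u_def split_def)
  then have "sum v A = 0" by (intro sum.neutral) blast
  then show ?thesis using A by simp
qed

lemma piece_span_split:
  assumes "direct_sum_decomposition I"
  shows "\<exists>a\<in>piece_span I T. \<exists>b\<in>piece_span I (- T). x = a + b"
proof -
  let ?S = "{a + b | a b. a \<in> piece_span I T \<and> b \<in> piece_span I (- T)}"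
  have "vec.subspace ?S" by (rule vec.subspace_sums) (rule subspace_piece_span)+
  moreover have "I a b \<subseteq> ?S" for a b
  proof
    fix x assume x: "x \<in> I a b"
    show "x \<in> ?S"
    proof (cases "(a, b) \<in> T")
      case True
      then have "x \<in> piece_span I T" using x piece_in_piece_span by metis
      moreover have "0 \<in> piece_span I (- T)" using subspace_piece_span vec.subspace_0 by blast
      ultimately show ?thesis by force
    next
      case False
      then have "x \<in> piece_span I (- T)" using x piece_in_piece_span by (metis ComplI)
      moreover have "0 \<in> piece_span I T" using subspace_piece_span vec.subspace_0 by blast
      ultimately show ?thesis by force
    qed
  qed
  ultimately have "piece_span I UNIV \<subseteq> ?S" by (intro piece_span_minimal) auto
  moreover have "piece_span I UNIV = UNIV"
    using assms by (simp add: direct_sum_decomposition_def flip: piece_span_UNIV)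
  ultimately show ?thesis by blast
qed

text \<open>A choice suffices: the three properties determine the projection onto the pieces in
  \<open>T\<close> along the others.\<close>

definition piece_proj :: "(int \<Rightarrow> int \<Rightarrow> (complex ^ 'n::finite) set) \<Rightarrow> (int \<times> int) set \<Rightarrow> complex ^ 'n ^ 'n" where
  "piece_proj I T = (SOME P. (\<forall>x\<in>piece_span I T. P *v x = x) \<and> (\<forall>x\<in>piece_span I (- T). P *v x = 0)
     \<and> (\<forall>x. P *v x \<in> piece_span I T))"

lemma piece_proj:
  assumes "direct_sum_decomposition I"
  shows "(\<forall>x\<in>piece_span I T. piece_proj I T *v x = x) \<and> (\<forall>x\<in>piece_span I (- T). piece_proj I T *v x = 0)
     \<and> (\<forall>x. piece_proj I T *v x \<in> piece_span I T)"
  unfolding piece_proj_def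
proof (rule someI_ex)
  show "\<exists>P. (\<forall>x\<in>piece_span I T. P *v x = x) \<and> (\<forall>x\<in>piece_span I (- T). P *v x = 0)
     \<and> (\<forall>x. P *v x \<in> piece_span I T)"
    by (rule projection_exists[of "piece_span I T" "piece_span I (- T)"])
       (use piece_span_disjoint[OF assms, of T "- T"] piece_span_split[OF assms] in \<open>auto simp: subspace_piece_span\<close>)
qed

lemma piece_proj_id: "direct_sum_decomposition I \<Longrightarrow> x \<in> piece_span I T \<Longrightarrow> piece_proj I T *v x = x"
  using piece_proj by blast

lemma piece_proj_0:
  assumes "direct_sum_decomposition I" "x \<in> piece_span I S" "S \<inter> T = {}"
  shows "piece_proj I T *v x = 0"
proof -
  have "x \<in> piece_span I (- T)" using assms piece_span_mono[of S "- T"] by blast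
  then show ?thesis using piece_proj assms(1) by blast
qed

lemma piece_proj_in: "direct_sum_decomposition I \<Longrightarrow> piece_proj I T *v x \<in> piece_span I T"
  using piece_proj by blast

lemma matrix_eq_on_pieces:
  fixes X Y :: "complex ^ 'n::finite ^ 'n"
  assumes "direct_sum_decomposition I" "\<And>p q v. v \<in> I p q \<Longrightarrow> X *v v = Y *v v"
  shows "X = Y"
proof -
  let ?S = "{x. X *v x = Y *v x}"
  have "vec.subspace ?S"
    by (auto simp: vec.subspace_def matrix_vector_right_distrib vector_scalar_commute)
  then have "piece_span I UNIV \<subseteq> ?S" by (rule piece_span_minimal) (use assms(2) in auto)
  moreover have "piece_span I UNIV = UNIV"
    using assms by (simp add: direct_sum_decomposition_def flip: piece_span_UNIV)
  ultimately show ?thesis by (auto simp: matrix_eq)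
qed

text \<open>The part of a vector of \<open>J p q\<close> outside \<open>I p q\<close> lies both in
  \<open>J p q\<close> and in the sum of the other pieces of \<open>J\<close>, so it vanishes.
  Uniqueness of a bigrading is thereby reduced to one inclusion per type.\<close>

lemma direct_sum_decomposition_unique:
  assumes "direct_sum_decomposition I" "direct_sum_decomposition J" "\<And>p q. I p q \<subseteq> J p q"
  shows "I = J"
proof (intro ext equalityI assms(3) subsetI)
  fix p q x assume x: "x \<in> J p q"
  obtain a b where ab: "a \<in> piece_span I {(p, q)}" "b \<in> piece_span I (- {(p, q)})" "x = a + b"
    using piece_span_split[OF assms(1)] by blast
  have I: "piece_span I {(p, q)} \<subseteq> I p q"
    by (rule piece_span_minimal) (use assms(1) in \<open>auto simp: direct_sum_decomposition_def\<close>)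
  have "piece_span I T \<subseteq> piece_span J T" for T
    by (rule piece_span_minimal[OF subspace_piece_span]) (use assms(3) in \<open>blast intro: piece_in_piece_span\<close>)
  then have b: "b \<in> piece_span J (- {(p, q)})" using ab by blast
  have "x - a \<in> J p q"
    using x ab(1) I assms(2,3) by (auto simp: direct_sum_decomposition_def intro!: vec.subspace_diff)
  then have "b \<in> piece_span J {(p, q)}" using ab(3) by (intro piece_in_piece_span[of _ J p q]) auto
  with b have "b = 0" using piece_span_disjoint[OF assms(2)] by (metis Compl_disjoint)
  then show "x \<in> I p q" using ab I by auto
qed

section \<open>Mixed Hodge structures of biextension type\<close>

lemma subspace_set_plus:
  fixes A B :: "(complex ^ 'n) set"
  assumes "vec.subspace A" "vec.subspace B" shows "vec.subspace (A + B)"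
proof -
  have "A + B = {x + y | x y. x \<in> A \<and> y \<in> B}" by (auto simp: set_plus_def)
  then show ?thesis using vec.subspace_sums[OF assms] by simp
qed

text \<open>Lattice vectors have integer entries and are fixed by conjugation, so subspaces spanned
  by them, such as the weight steps, are stable.\<close>

lemma conjv_span_lattice:
  fixes S :: "(complex ^ 'n) set"
  assumes "x \<in> vec.span (S \<inter> lattice)" shows "conjv x \<in> vec.span (S \<inter> lattice)"
  using assms
proof (induction rule: vec.span_induct_alt)
  case (step c x y)
  then have "conjv x = x" by (auto simp: lattice_def conjv_def vec_eq_iff) (metis Ints_cases complex_cnj_of_int)
  then show ?case using step
    by (simp add: conjv_add conjv_scale vec.span_add vec.span_scale vec.span_base)
qed (simp add: vec.span_zero)

section \<open>Consequences of gaps in the Hodge numbers\<close>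

locale hodge_filtrations =
  fixes W F :: "'n::finite filtration"
  assumes mhs: "mixed_hodge_structure W F"
begin

lemma span_W: "vec.span (W k \<inter> lattice) = W k"
  by (rule sym) (rule mhs[unfolded mixed_hodge_structure_def, THEN conjunct1, rule_format])

lemma mhs_filtrations: "mono W" "\<exists>k. W k = {0}" "\<exists>k. W k = UNIV"
  "\<forall>p. vec.subspace (F p)" "antimono F" "\<exists>p. F p = UNIV" "\<exists>p. F p = {0}"
  "\<forall>k p. gr_F W F k p + conjv ` gr_F W F k (k + 1 - p) = W k \<and>
     gr_F W F k p \<inter> conjv ` gr_F W F k (k + 1 - p) = W (k - 1)"
  using mhs[unfolded mixed_hodge_structure_def] by - (elim conjE, assumption)+

lemma subspace_W: "vec.subspace (W k)"
  using vec.subspace_span[of "W k \<inter> lattice"] span_W by simp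

lemma conjv_W: "conjv x \<in> W k \<longleftrightarrow> x \<in> W k"
  using conjv_span_lattice[of _ "W k"] conjv_conjv[of x] unfolding span_W by metis

lemma conjv_image_W: "conjv ` W k = W k"
  by (auto simp: in_conjv_image conjv_W)

lemma W_mono: "j \<le> k \<Longrightarrow> W j \<subseteq> W k"
  by (rule monoD[OF mhs_filtrations(1)])

lemma subspace_F: "vec.subspace (F p)"
  using mhs_filtrations(4) by blast

lemma F_antimono: "p \<le> q \<Longrightarrow> F q \<subseteq> F p"
  by (rule antimonoD[OF mhs_filtrations(5)])

lemma F_bounds: obtains p0 p1 where "\<And>p. p \<le> p0 \<Longrightarrow> F p = UNIV" "\<And>p. p \<ge> p1 \<Longrightarrow> F p = {0}"
proof -
  obtain p0 p1 where "F p0 = UNIV" "F p1 = {0}" using mhs_filtrations(6,7) by blast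
  then have "\<And>p. p \<le> p0 \<Longrightarrow> F p = UNIV" "\<And>p. p \<ge> p1 \<Longrightarrow> F p = {0}"
    using F_antimono vec.subspace_0[OF subspace_F] by fastforce+
  then show ?thesis using that by blast
qed

lemma subspace_gr_F: "vec.subspace (gr_F W F k p)"
  unfolding gr_F_def by (intro subspace_set_plus vec.subspace_inter subspace_W subspace_F)

lemma gr_F_bounds: "W (k - 1) \<subseteq> gr_F W F k p" "gr_F W F k p \<subseteq> W k"
proof -
  show "W (k - 1) \<subseteq> gr_F W F k p"
    using vec.subspace_0[OF vec.subspace_inter[OF subspace_F[of p] subspace_W[of k]]]
    by (force simp: gr_F_def set_plus_def)
  show "gr_F W F k p \<subseteq> W k"
    using W_mono[of "k - 1" k] vec.subspace_add[OF subspace_W[of k]] by (auto simp: gr_F_def set_plus_def)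
qed

lemma opposed: "gr_F W F k p + conjv ` gr_F W F k (k + 1 - p) = W k"
    "gr_F W F k p \<inter> conjv ` gr_F W F k (k + 1 - p) = W (k - 1)"
  using mhs_filtrations(8) by (metis+)

lemma W_bounds: obtains k0 k1 where "\<And>k. k \<le> k0 \<Longrightarrow> W k = {0}" "\<And>k. k \<ge> k1 \<Longrightarrow> W k = UNIV"
proof -
  obtain k0 k1 where "W k1 = UNIV" "W k0 = {0}" using mhs_filtrations(2,3) by blast
  then have "\<And>k. k \<le> k0 \<Longrightarrow> W k = {0}" "\<And>k. k \<ge> k1 \<Longrightarrow> W k = UNIV"
    using W_mono vec.subspace_0[OF subspace_W] by fastforce+
  then show ?thesis using that by blast
qed

text \<open>The difference of dimensions is truncated, so its vanishing only says that the piece is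
  not larger than \<open>W (p + q - 1)\<close>; as the piece contains this step, both agree.\<close>

lemma hodge_number_0:
  assumes "hodge_number W F p q = 0" shows "hodge_piece W F p q = W (p + q - 1)"
proof -
  have *: "W (p + q - 1) \<subseteq> hodge_piece W F p q"
    unfolding hodge_piece_def in_conjv_image[symmetric] using gr_F_bounds(1)[of "p + q"] conjv_image_W by blast
  have "vec.subspace (hodge_piece W F p q)"
    unfolding hodge_piece_def by (intro vec.subspace_inter subspace_conjv_image subspace_gr_F)
  then show ?thesis
    using vec.subspace_dim_equal[OF subspace_W _ *] assms by (simp add: hodge_number_def)
qed

text \<open>If the step at \<open>p + 1\<close> were smaller, then \<open>F\<^sup>p\<close> would contain the conjugate step opposed to it.\<close>

lemma gr_F_step:
  assumes "gr_F W F k p = W k" "hodge_number W F p (k - p) = 0"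
  shows "gr_F W F k (p + 1) = W k"
proof -
  have "hodge_piece W F p (k - p) = conjv ` gr_F W F k (k - p)"
    using assms(1) gr_F_bounds(2)[of k "k - p"] by (auto simp: hodge_piece_def in_conjv_image conjv_W)
  then have "conjv ` gr_F W F k (k + 1 - (p + 1)) = W (k - 1)" using hodge_number_0[OF assms(2)] by simp
  then have "W k = gr_F W F k (p + 1) + W (k - 1)" using opposed(1)[of k "p + 1"] by simp
  also have "\<dots> \<subseteq> gr_F W F k (p + 1)"
    using gr_F_bounds(1)[of k "p + 1"] vec.subspace_add[OF subspace_gr_F] by (auto simp: set_plus_def)
  finally show ?thesis using gr_F_bounds(2)[of k "p + 1"] by blast
qed

text \<open>Very low steps of \<open>F\<close> are the whole space. Going up, the induced filtration
  stays full as long as the Hodge numbers passed on the way vanish.\<close>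

lemma gr_F_full:
  assumes "\<And>p. p < p' \<Longrightarrow> hodge_number W F p (k - p) = 0"
  shows "gr_F W F k p' = W k"
proof -
  obtain p0 where p0: "\<And>p. p \<le> p0 \<Longrightarrow> F p = UNIV" by (rule F_bounds) blast
  have full: "gr_F W F k p = W k" if "p \<le> p0" for p
    using p0[OF that] vec.subspace_0[OF subspace_W[of "k - 1"]] gr_F_bounds(2)[of k p]
    by (force simp: gr_F_def set_plus_def)
  show ?thesis
  proof (cases "p' \<le> p0")
    case False
    then have "p0 \<le> p'" by simp
    then show ?thesis using assms
    proof (induction p' rule: int_ge_induct)
      case (step i)
      show ?case by (rule gr_F_step) (use step in auto)
    qed (simp add: full)
  qed (use full in auto)
qed

text \<open>With no Hodge number to interrupt it, the induced filtration is still full where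
  \<open>F\<close> has become zero.\<close>

lemma gr_trivial:
  assumes "\<And>p. hodge_number W F p (k - p) = 0"
  shows "W k = W (k - 1)"
proof -
  obtain p1 where "F p1 = {0}" by (rule F_bounds) blast
  then have "gr_F W F k p1 \<subseteq> W (k - 1)" by (auto simp: gr_F_def set_plus_def)
  moreover have "gr_F W F k p1 = W k" using assms by (rule gr_F_full)
  ultimately show ?thesis using W_mono[of "k - 1" k] by auto
qed

text \<open>Opposedness at \<open>p + 1\<close> pairs this step with the conjugate of step
  \<open>2 * p + 1 - (p + 1) = p\<close>, which is everything; hence the step at
  \<open>p + 1\<close> is zero in the quotient.\<close>

lemma gr_type_pp:
  assumes "\<And>q. q \<noteq> p \<Longrightarrow> hodge_number W F q (2 * p - q) = 0"
  shows "gr_F W F (2 * p) p = W (2 * p)" "gr_F W F (2 * p) (p + 1) = W (2 * p - 1)"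
    "hodge_piece W F p p = W (2 * p)"
proof -
  show *: "gr_F W F (2 * p) p = W (2 * p)" using assms by (intro gr_F_full) auto
  then show "gr_F W F (2 * p) (p + 1) = W (2 * p - 1)"
    using opposed(2)[of "2 * p" "p + 1"] gr_F_bounds(2)[of "2 * p" "p + 1"] by (auto simp: conjv_image_W)
  show "hodge_piece W F p p = W (2 * p)" using * by (simp add: hodge_piece_def conjv_image_W flip: mult_2)
qed

end

section \<open>The three weights of a biextension\<close>

locale biext = hodge_filtrations W F for W F :: "'n::finite filtration" +
  fixes Q :: "int \<Rightarrow> complex ^ 'n \<Rightarrow> complex ^ 'n \<Rightarrow> complex" and e f :: "complex ^ 'n"
  assumes type: "biextension_type W F Q" and bases: "extreme_gr_bases W e f"
begin

lemma hodge_numbers: "hodge_number W F 0 0 = 1" "hodge_number W F (-1) (-1) = 1"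
  "(p, q) \<noteq> (0, 0) \<Longrightarrow> (p, q) \<noteq> (-1, -1) \<Longrightarrow> p + q \<noteq> -1 \<Longrightarrow> hodge_number W F p q = 0"
  using type unfolding biextension_type_def by blast+

lemma conjv_e: "conjv e = e" and conjv_f: "conjv f = f" and f_nz: "f \<noteq> 0"
  and e_notin: "e \<notin> W (-1)" and f_in: "f \<in> W (-2)"
  using bases by (auto simp: extreme_gr_bases_def)

lemma W_ge: "k \<ge> 0 \<Longrightarrow> W k = UNIV"
proof -
  assume k: "k \<ge> 0"
  obtain k1 where k1: "\<And>k. k \<ge> k1 \<Longrightarrow> W k = UNIV" by (rule W_bounds) blast
  have step: "W (j + 1) = W j" if "j \<ge> 0" for j
    using gr_trivial[of "j + 1"] hodge_numbers(3) that by auto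
  have *: "W j = W 0" if "j \<ge> 0" for j
    using that by (induction j rule: int_ge_induct) (auto simp: step)
  have "W (max k1 0) = UNIV" using k1 by simp
  then show ?thesis using *[of "max k1 0"] *[OF k] by simp
qed

lemma W_le: "k \<le> -3 \<Longrightarrow> W k = {0}"
proof -
  assume k: "k \<le> -3"
  obtain k0 where k0: "\<And>k. k \<le> k0 \<Longrightarrow> W k = {0}" by (rule W_bounds) blast
  have step: "W (j - 1) = W j" if "j \<le> -3" for j
    using gr_trivial[of j] hodge_numbers(3) that by auto
  have *: "W j = W (-3)" if "j \<le> -3" for j
    using that by (induction j rule: int_le_induct) (auto simp: step)
  have "W (min k0 (-3)) = {0}" using k0 by simp
  then show ?thesis using *[of "min k0 (-3)"] *[OF k] by simp
qed

lemma weight_0: "gr_F W F 0 0 = UNIV" "gr_F W F 0 1 = W (-1)" "vec.dim (W 0) = vec.dim (W (-1)) + 1"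
proof -
  have *: "\<And>q. q \<noteq> 0 \<Longrightarrow> hodge_number W F q (2 * 0 - q) = 0" by (rule hodge_numbers(3)) auto
  show "gr_F W F 0 0 = UNIV" "gr_F W F 0 1 = W (-1)" using gr_type_pp[OF *] by (simp_all add: W_ge)
  show "vec.dim (W 0) = vec.dim (W (-1)) + 1"
    using gr_type_pp(3)[OF *] hodge_numbers(1) by (simp add: hodge_number_def)
qed

lemma weight_m2: "gr_F W F (-2) (-1) = W (-2)" "gr_F W F (-2) 0 = {0}" "vec.dim (W (-2)) = 1"
proof -
  have *: "\<And>q. q \<noteq> -1 \<Longrightarrow> hodge_number W F q (2 * (-1) - q) = 0" by (rule hodge_numbers(3)) auto
  show "gr_F W F (-2) (-1) = W (-2)" "gr_F W F (-2) 0 = {0}" using gr_type_pp[OF *] by (simp_all add: W_le)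
  show "vec.dim (W (-2)) = 1"
    using gr_type_pp(3)[OF *] hodge_numbers(2) by (simp add: hodge_number_def W_le)
qed

lemma W_m2: "W (-2) = {c *s f | c. True}"
proof -
  have "vec.span {f} = W (-2)"
    by (rule vec.subspace_dim_equal) (use f_in f_nz subspace_W weight_m2(3) in
        \<open>auto simp: vec.span_minimal\<close>)
  then show ?thesis by (auto simp: vec.span_singleton)
qed

text \<open>Since \<open>h^{0,0} = 1\<close>, the subspace \<open>W (-1)\<close> is a hyperplane,
  complemented by the line of \<open>e\<close>.\<close>

lemma decompose_e: obtains c b where "b \<in> W (-1)" "x = c *s e + b"
proof -
  have s: "vec.span (W (-1)) = W (-1)" using subspace_W[of "-1"] by simp
  have "vec.dim (vec.span (insert e (W (-1)))) = vec.dim (W (-1)) + 1"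
    using e_notin unfolding vec.dim_span vec.dim_insert s by simp
  then have "vec.span (insert e (W (-1))) = UNIV"
    using weight_0(3) W_ge[of 0] vec.subspace_dim_equal[of "vec.span (insert e (W (-1)))" UNIV] by auto
  then have "x \<in> vec.span (insert e (W (-1)))" by simp
  then obtain c where "x - c *s e \<in> W (-1)"
    using s by (auto simp: vec.span_insert)
  then show ?thesis using that[of "x - c *s e" c] by simp
qed

lemma F0_complement: obtains a b where "a \<in> F 0" "b \<in> W (-1)" "x = a + b"
proof -
  have "x \<in> gr_F W F 0 0" using weight_0(1) by simp
  then show ?thesis using that unfolding gr_F_def set_plus_def by auto
qed

lemma F1_sub: "p \<ge> 1 \<Longrightarrow> F p \<subseteq> W (-1)"
proof -
  assume p: "p \<ge> 1"
  have "F 1 \<subseteq> gr_F W F 0 1"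
    using vec.subspace_0[OF subspace_W[of "-1"]] by (force simp: gr_F_def set_plus_def W_ge)
  then show ?thesis using weight_0(2) F_antimono[OF p] by auto
qed

text \<open>The quotient of weight \<open>-2\<close> has type \<open>(-1, -1)\<close>, so
  \<open>F 0\<close> induces zero on it; as \<open>W (-3)\<close> is zero, this already concerns
  vectors.\<close>

lemma F0_W_m2: assumes "p \<ge> 0" "x \<in> F p" "x \<in> W (-2)" shows "x = 0"
proof -
  have "x \<in> F 0" using F_antimono[OF assms(1)] assms(2) by auto
  then have "x \<in> gr_F W F (-2) 0" using assms(3) vec.subspace_0[OF subspace_W[of "-3"]]
    by (force simp: gr_F_def set_plus_def)
  then show ?thesis using weight_m2(2) by simp
qed

lemma F_m1_W_m2: assumes "p \<le> -1" shows "W (-2) \<subseteq> F p"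
proof -
  have "W (-2) \<subseteq> F (-1)" using weight_m2(1) W_le[of "-3"] by (auto simp: gr_F_def set_plus_def)
  then show ?thesis using F_antimono[OF assms] by auto
qed

text \<open>Opposedness in weight \<open>-1\<close> pairs \<open>p\<close> with
  \<open>-1 + 1 - p = - p\<close>. It holds in the quotient by \<open>W (-2)\<close>, whence the
  third summand.\<close>

lemma gr_m1_sum:
  assumes "x \<in> W (-1)"
  obtains y z w where "y \<in> F p" "y \<in> W (-1)" "conjv z \<in> F (- p)" "z \<in> W (-1)" "w \<in> W (-2)" "x = y + z + w"
proof -
  have "x \<in> gr_F W F (-1) p + conjv ` gr_F W F (-1) (- p)" using opposed(1)[of "-1" p] assms by simp
  then obtain y w z w' where *: "y \<in> F p" "y \<in> W (-1)" "w \<in> W (-2)" "z \<in> F (- p)" "z \<in> W (-1)" "w' \<in> W (-2)"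
    "x = y + w + conjv (z + w')" by (auto simp: gr_F_def set_plus_def)
  show ?thesis
    by (rule that[of y "conjv z" "w + conjv w'"])
       (use * vec.subspace_add[OF subspace_W] in \<open>auto simp: conjv_W conjv_add\<close>)
qed

text \<open>The uniqueness half of opposedness in weight \<open>-1\<close>: \<open>a\<close> and
  \<open>b\<close> have the same class modulo \<open>W (-2)\<close>, and this class lies in two
  opposed steps.\<close>

lemma gr_m1_inter:
  assumes "a \<in> F p" "a \<in> W (-1)" "conjv b \<in> F (- p)" "b \<in> W (-1)" "a - b \<in> W (-2)"
  shows "a \<in> W (-2)" "b \<in> W (-2)"
proof -
  have "0 \<in> W (-2)" by (rule vec.subspace_0[OF subspace_W])
  then have "a + 0 \<in> gr_F W F (-1) p" unfolding gr_F_def using assms by (intro set_plus_intro) auto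
  moreover have "conjv b + conjv (a - b) \<in> gr_F W F (-1) (- p)"
    unfolding gr_F_def by (rule set_plus_intro) (use assms in \<open>auto simp: conjv_W\<close>)
  ultimately show a: "a \<in> W (-2)"
    using opposed(2)[of "-1" p] by (auto simp: in_conjv_image simp flip: conjv_add)
  show "b \<in> W (-2)" using vec.subspace_diff[OF subspace_W a assms(5)] by simp
qed

end

section \<open>The Deligne bigrading\<close>

lemma piece_span_weaken:
  "(\<And>a b. P a b \<Longrightarrow> R a b) \<Longrightarrow> x \<in> piece_span I {(a, b). P a b} \<Longrightarrow> x \<in> piece_span I {(a, b). R a b}"
  using piece_span_mono[of "{(a, b). P a b}" "{(a, b). R a b}" I] by blast

context biext
begin

text \<open>A closed formula for the Deligne bigrading.\<close>

definition J :: "int \<Rightarrow> int \<Rightarrow> (complex ^ 'n) set" where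
  "J p q = (if p + q = -1 then F p \<inter> conjv ` F q \<inter> W (-1)
     else if p = 0 \<and> q = 0 then F 0 \<inter> (conjv ` F 0 + W (-2))
     else if p = -1 \<and> q = -1 then W (-2) else {0})"

lemma J_line: "p + q = -1 \<Longrightarrow> x \<in> J p q \<longleftrightarrow> x \<in> F p \<and> conjv x \<in> F q \<and> x \<in> W (-1)"
  by (auto simp: J_def in_conjv_image)

lemma J_00: "x \<in> J 0 0 \<longleftrightarrow> x \<in> F 0 \<and> (\<exists>w\<in>W (-2). conjv (x - w) \<in> F 0)"
proof -
  have "x \<in> conjv ` F 0 + W (-2) \<longleftrightarrow> (\<exists>w\<in>W (-2). conjv (x - w) \<in> F 0)"
  proof
    assume "x \<in> conjv ` F 0 + W (-2)"
    then obtain a w where "a \<in> F 0" "w \<in> W (-2)" "x = conjv a + w" by (auto simp: set_plus_def)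
    then show "\<exists>w\<in>W (-2). conjv (x - w) \<in> F 0" by (intro bexI[of _ w]) auto
  next
    assume "\<exists>w\<in>W (-2). conjv (x - w) \<in> F 0"
    then obtain w where "w \<in> W (-2)" "conjv (x - w) \<in> F 0" by blast
    then have "(x - w) + w \<in> conjv ` F 0 + W (-2)" by (intro set_plus_intro) (auto simp: in_conjv_image)
    then show "x \<in> conjv ` F 0 + W (-2)" by simp
  qed
  then show ?thesis by (simp add: J_def)
qed

lemma J_m1m1: "J (-1) (-1) = W (-2)"
  by (simp add: J_def)

lemma J_trivial: "p + q \<noteq> -1 \<Longrightarrow> (p, q) \<noteq> (0, 0) \<Longrightarrow> (p, q) \<noteq> (-1, -1) \<Longrightarrow> J p q = {0}"
  by (auto simp: J_def)

lemma subspace_J: "vec.subspace (J p q)"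
  unfolding J_def using subspace_F subspace_W
  by (auto intro!: vec.subspace_inter subspace_set_plus subspace_conjv_image)

lemma J_sub_F: "J p q \<subseteq> F p"
proof (cases "p + q = -1 \<or> (p, q) = (0, 0) \<or> (p, q) = (-1, -1)")
  case True
  then show ?thesis using J_line J_00 J_m1m1 F_m1_W_m2[of "-1"] by auto
next
  case False
  then show ?thesis using J_trivial[of p q] vec.subspace_0[OF subspace_F] by auto
qed

lemma J_sub_W: "J p q \<subseteq> W (p + q)"
proof (cases "p + q = -1 \<or> (p, q) = (0, 0) \<or> (p, q) = (-1, -1)")
  case True
  then show ?thesis using J_line J_m1m1 W_ge[of 0] by auto
next
  case False
  then show ?thesis using J_trivial[of p q] vec.subspace_0[OF subspace_W] by auto
qed

lemma J_sub_W_m1: "(p, q) \<noteq> (0, 0) \<Longrightarrow> J p q \<subseteq> W (-1)"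
proof (cases "p + q \<le> -1")
  case True
  then show ?thesis using J_sub_W[of p q] W_mono[OF True] by auto
next
  case False
  assume "(p, q) \<noteq> (0, 0)"
  with False have "J p q = {0}" by (intro J_trivial) auto
  then show ?thesis using vec.subspace_0[OF subspace_W] by auto
qed

text \<open>One of \<open>p\<close> and \<open>q\<close> is nonnegative, so \<open>x\<close> or its
  conjugate lies in \<open>F 0 \<inter> W (-2)\<close>, which is zero.\<close>

lemma J_line_W_m2:
  assumes "p + q = -1" "x \<in> J p q" "x \<in> W (-2)" shows "x = 0"
proof (cases "p \<ge> 0")
  case True
  then show ?thesis using F0_W_m2 J_sub_F assms by blast
next
  case False
  then have "conjv x = 0" using F0_W_m2[of q "conjv x"] assms by (auto simp: J_line conjv_W)
  then show ?thesis by (metis conjv_0 conjv_conjv)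
qed

text \<open>Inside \<open>W (-1)\<close> the vectors \<open>x\<close> and \<open>x - w\<close> agree
  modulo \<open>W (-2)\<close> and lie in \<open>F 0\<close> and its conjugate. These are opposed in
  weight \<open>-1\<close>, so \<open>x\<close> lies in \<open>F 0 \<inter> W (-2)\<close>.\<close>

lemma J_00_W_m1:
  assumes "x \<in> J 0 0" "x \<in> W (-1)" shows "x = 0"
proof -
  obtain w where w: "w \<in> W (-2)" "conjv (x - w) \<in> F 0" using assms(1) J_00 by blast
  then have "w \<in> W (-1)" using W_mono[of "-2" "-1"] by auto
  then have "x - w \<in> W (-1)" using vec.subspace_diff[OF subspace_W assms(2)] by blast
  then have "x \<in> W (-2)" using gr_m1_inter(1)[of x 0 "x - w"] w assms J_00 by auto
  then show ?thesis using F0_W_m2[of 0] assms J_00 by auto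
qed

lemma conjv_J_line: "p + q = -1 \<Longrightarrow> conjv x \<in> J q p \<longleftrightarrow> x \<in> J p q"
  by (auto simp: J_line conjv_W)

text \<open>Descending induction on \<open>p\<close>, starting where \<open>F p\<close> is zero.
  Opposedness at \<open>p + 1\<close> splits off a part in \<open>F (p + 1)\<close>; what remains
  lies in \<open>F p\<close> and, modulo \<open>W (-2)\<close>, in the conjugate of
  \<open>F (- p - 1)\<close>, so it has type \<open>(p, - p - 1)\<close> up to a multiple of
  \<open>f\<close>.\<close>

lemma F_W_m1_sub: "x \<in> F p \<Longrightarrow> x \<in> W (-1) \<Longrightarrow> x \<in> piece_span J {(a, b). a \<ge> p \<and> a + b \<le> -1}"
proof -
  let ?S = "\<lambda>p. piece_span J {(a, b). a \<ge> p \<and> a + b \<le> -1}"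
  obtain p1 where p1: "\<And>p. p \<ge> p1 \<Longrightarrow> F p = {0}" by (rule F_bounds) blast
  have ind: "x \<in> ?S p" if IH: "\<And>x. x \<in> F (p + 1) \<Longrightarrow> x \<in> W (-1) \<Longrightarrow> x \<in> ?S (p + 1)"
    and x: "x \<in> F p" "x \<in> W (-1)" for p x
  proof -
    obtain y z w where yzw: "y \<in> F (p + 1)" "y \<in> W (-1)" "conjv z \<in> F (- (p + 1))" "z \<in> W (-1)" "w \<in> W (-2)"
      "x = y + z + w" by (rule gr_m1_sum[OF x(2), of "p + 1"])
    have w1: "w \<in> W (-1)" using yzw W_mono[of "-2" "-1"] by auto
    have yS: "y \<in> ?S p" by (rule piece_span_weaken[OF _ IH[OF yzw(1,2)]]) auto
    have "y \<in> F p" using yzw(1) F_antimono[of p "p + 1"] by auto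
    then have zw: "z + w \<in> F p" using vec.subspace_diff[OF subspace_F x(1)] yzw(6) by force
    have "z + w \<in> ?S p"
    \<comment> \<open>The error term \<open>w\<close> is absorbed by whichever filtration contains
      \<open>W (-2)\<close>: for \<open>p \<ge> 0\<close> it is the conjugate of
      \<open>F (- p - 1)\<close>, otherwise \<open>F p\<close>, and then \<open>w\<close> counts as
      a vector of type \<open>(-1, -1)\<close>.\<close>
    proof (cases "p \<ge> 0")
      case True
      then have "conjv w \<in> F (- (p + 1))" using F_m1_W_m2[of "- (p + 1)"] yzw(5) by (auto simp: conjv_W)
      then have "conjv (z + w) \<in> F (- (p + 1))" using yzw(3) by (simp add: conjv_add vec.subspace_add[OF subspace_F])
      then have "z + w \<in> J p (- (p + 1))"
        using zw vec.subspace_add[OF subspace_W yzw(4) w1] by (simp add: J_line)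
      then show ?thesis by (rule piece_in_piece_span) auto
    next
      case False
      then have "w \<in> F p" using F_m1_W_m2[of p] yzw(5) by auto
      then have "z \<in> F p" using vec.subspace_diff[OF subspace_F zw] by force
      then have "z \<in> J p (- (p + 1))" using yzw by (simp add: J_line)
      then have "z \<in> ?S p" by (rule piece_in_piece_span) auto
      moreover have "w \<in> ?S p" using yzw(5) False by (intro piece_in_piece_span[of w J "-1" "-1"]) (auto simp: J_m1m1)
      ultimately show ?thesis using vec.subspace_add[OF subspace_piece_span] by blast
    qed
    then have "y + (z + w) \<in> ?S p" using yS vec.subspace_add[OF subspace_piece_span] by blast
    then show "x \<in> ?S p" using yzw(6) by (simp add: add.assoc)
  qed
  have base: "x \<in> ?S p" if "x \<in> F p" "p \<ge> p1" for x p
    using p1[OF that(2)] that(1) vec.subspace_0[OF subspace_piece_span[of J]] by auto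
  show "x \<in> ?S p" if "x \<in> F p" "x \<in> W (-1)"
  proof (cases "p \<ge> p1")
    case False
    then have "p \<le> p1" by simp
    then show ?thesis using that
    proof (induction p arbitrary: x rule: int_le_induct)
      case (step i)
      show ?case by (rule ind[of "i - 1"]) (use step in auto)
    qed (use base in auto)
  qed (use base that in auto)
qed

lemma W_m1_eq: "W (-1) = piece_span J {(a, b). a + b \<le> -1}"
proof
  obtain p0 where p0: "\<And>p. p \<le> p0 \<Longrightarrow> F p = UNIV" by (rule F_bounds) blast
  show "W (-1) \<subseteq> piece_span J {(a, b). a + b \<le> -1}"
  proof
    fix x assume "x \<in> W (-1)"
    then have "x \<in> piece_span J {(a, b). a \<ge> p0 \<and> a + b \<le> -1}" using F_W_m1_sub[of x p0] p0[of p0] by auto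
    then show "x \<in> piece_span J {(a, b). a + b \<le> -1}" by (rule piece_span_weaken[rotated]) auto
  qed
  show "piece_span J {(a, b). a + b \<le> -1} \<subseteq> W (-1)"
    by (rule piece_span_minimal[OF subspace_W]) (use J_sub_W_m1 in auto)
qed

text \<open>A lift of \<open>e\<close> to \<open>F 0\<close> differs from its conjugate by an
  element of \<open>W (-1)\<close>. Removing the \<open>F 0\<close>-part of this difference makes
  the lift real modulo \<open>W (-2)\<close>.\<close>

lemma generator_exists: obtains v where "v \<in> J 0 0" "v - e \<in> W (-1)"
proof -
  obtain a b where ab: "a \<in> F 0" "b \<in> W (-1)" "e = a + b" by (rule F0_complement[of e])
  have cb: "conjv b \<in> W (-1)" using ab by (simp add: conjv_W)
  have "conjv a = e - conjv b" using ab(3) conjv_e by (metis add_diff_cancel_right' conjv_add)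
  then have aa: "a - conjv a = conjv b - b" using ab(3) by simp
  obtain y z w where yzw: "y \<in> F 0" "y \<in> W (-1)" "conjv z \<in> F (- 0)" "z \<in> W (-1)" "w \<in> W (-2)" "conjv b - b = y + z + w"
    by (rule gr_m1_sum[of "conjv b - b" 0]) (use ab cb vec.subspace_diff[OF subspace_W] in auto)
  \<comment> \<open>Written this way, the conjugate \<open>a + conjv z\<close> visibly lies in
    \<open>F 0\<close>.\<close>
  have "a - y - w = conjv a + z" using aa yzw(6) by (simp add: algebra_simps)
  then have "conjv (a - y - w) = a + conjv z" by (simp add: conjv_add)
  then have "conjv (a - y - w) \<in> F 0" using ab yzw by (simp add: vec.subspace_add[OF subspace_F])
  moreover have "a - y \<in> F 0" using ab yzw by (simp add: vec.subspace_diff[OF subspace_F])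
  ultimately have "a - y \<in> J 0 0" using yzw(5) by (auto simp: J_00)
  moreover have "a - y - e = - (b + y)" using ab(3) by simp
  moreover have "- (b + y) \<in> W (-1)" using ab yzw by (intro vec.subspace_neg[OF subspace_W] vec.subspace_add[OF subspace_W])
  ultimately show ?thesis using that by metis
qed

lemma decompose_generator:
  assumes "v \<in> J 0 0" "v - e \<in> W (-1)"
  obtains c b where "b \<in> W (-1)" "x = c *s v + b"
proof -
  obtain c b where "b \<in> W (-1)" "x = c *s e + b" by (rule decompose_e)
  then have "x = c *s v + (b - c *s (v - e))" by (simp add: vec.scale_right_diff_distrib)
  moreover have "b - c *s (v - e) \<in> W (-1)"
    using \<open>b \<in> W (-1)\<close> vec.subspace_scale[OF subspace_W assms(2)] by (intro vec.subspace_diff[OF subspace_W])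
  ultimately show ?thesis using that by blast
qed

text \<open>Beyond the part inside \<open>W (-1)\<close> only the generator of type
  \<open>(0, 0)\<close> is left to place: it lies in \<open>F p\<close> for
  \<open>p \<le> 0\<close>, while for \<open>p \<ge> 1\<close> all of \<open>F p\<close> is inside
  \<open>W (-1)\<close>.\<close>

lemma F_eq: "F p = piece_span J {(a, b). a \<ge> p}"
proof
  show "piece_span J {(a, b). a \<ge> p} \<subseteq> F p"
    by (rule piece_span_minimal[OF subspace_F]) (use J_sub_F F_antimono in fastforce)
  have B: "x \<in> piece_span J {(a, b). a \<ge> p}" if "x \<in> F p" "x \<in> W (-1)" for x
    by (rule piece_span_weaken[OF _ F_W_m1_sub[OF that]]) auto
  show "F p \<subseteq> piece_span J {(a, b). a \<ge> p}"
  proof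
    fix x assume x: "x \<in> F p"
    obtain v where v: "v \<in> J 0 0" "v - e \<in> W (-1)" by (rule generator_exists)
    obtain c b where cb: "b \<in> W (-1)" "x = c *s v + b" by (rule decompose_generator[OF v])
    show "x \<in> piece_span J {(a, b). a \<ge> p}"
    proof (cases "p \<ge> 1")
      case True
      then show ?thesis using B[OF x] F1_sub x by auto
    next
      case False
      then have vp: "v \<in> F p" using v(1) J_sub_F F_antimono[of p 0] by fastforce
      have "x - c *s v \<in> F p" by (intro vec.subspace_diff[OF subspace_F] vec.subspace_scale[OF subspace_F] x vp)
      then have "b \<in> piece_span J {(a, b). a \<ge> p}" using cb B by simp
      moreover have "v \<in> piece_span J {(a, b). a \<ge> p}" by (rule piece_in_piece_span[of v J 0 0, OF v(1)]) (use False in auto)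
      ultimately show ?thesis unfolding cb(2)
        by (intro vec.subspace_add[OF subspace_piece_span] vec.subspace_scale[OF subspace_piece_span])
    qed
  qed
qed

lemma piece_span_J_ge_0: assumes "k \<ge> 0" shows "piece_span J {(a, b). a + b \<le> k} = UNIV"
proof -
  obtain v where v: "v \<in> J 0 0" "v - e \<in> W (-1)" by (rule generator_exists)
  have "x \<in> piece_span J {(a, b). a + b \<le> k}" for x
  proof -
    obtain c b where cb: "b \<in> W (-1)" "x = c *s v + b" by (rule decompose_generator[OF v])
    have "b \<in> piece_span J {(a, b). a + b \<le> k}"
      by (rule piece_span_weaken[OF _ cb(1)[unfolded W_m1_eq]]) (use assms in auto)
    moreover have "v \<in> piece_span J {(a, b). a + b \<le> k}" by (rule piece_in_piece_span[of v J 0 0, OF v(1)]) (use assms in auto)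
    ultimately show ?thesis unfolding cb(2)
      by (intro vec.subspace_add[OF subspace_piece_span] vec.subspace_scale[OF subspace_piece_span])
  qed
  then show ?thesis by auto
qed

lemma W_eq: "W k = piece_span J {(a, b). a + b \<le> k}"
proof -
  consider "k \<ge> 0" | "k = -1" | "k = -2" | "k \<le> -3" by linarith
  then show ?thesis
  proof cases
    case 1
    then show ?thesis using W_ge piece_span_J_ge_0 by simp
  next
    case 3
    have "J a b \<subseteq> W (-2)" if "a + b \<le> -2" for a b using J_sub_W[of a b] W_mono[OF that] by auto
    then have "piece_span J {(a, b). a + b \<le> -2} \<subseteq> W (-2)" by (intro piece_span_minimal[OF subspace_W]) auto
    moreover have "W (-2) \<subseteq> piece_span J {(a, b). a + b \<le> -2}"
      using J_m1m1 by (auto intro: piece_in_piece_span[of _ J "-1" "-1"])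
    ultimately show ?thesis using 3 by auto
  next
    case 4
    have "piece_span J {(a, b). a + b \<le> k} \<subseteq> {0}"
      by (rule piece_span_minimal) (use 4 J_trivial in auto)
    then show ?thesis using W_le[OF 4] vec.subspace_0[OF subspace_piece_span] by auto
  qed (simp add: W_m1_eq)
qed

text \<open>In a vanishing sum, the term of type \<open>(p, -1 - p)\<close> with the least \<open>p\<close> lies both in
  \<open>F\<^sup>p\<^sup>+\<^sup>1\<close> and in the opposed conjugate step, modulo \<open>W (-2)\<close>.\<close>

lemma direct_sum_J: "direct_sum_decomposition J"
  unfolding direct_sum_decomposition_def piece_span_UNIV
proof (intro conjI allI impI)
  show "piece_span J UNIV = UNIV"
    using piece_span_J_ge_0[of 0] piece_span_mono[of "{(a, b). a + b \<le> 0}" UNIV J] by auto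
  fix A :: "(int \<times> int) set" and v
  assume *: "finite A \<and> (\<forall>(p, q)\<in>A. v p q \<in> J p q) \<and> (\<Sum>(p, q)\<in>A. v p q) = 0"
  define N where "N = {(p, q)\<in>A. v p q \<noteq> 0}"
  have finN: "finite N" using * by (auto simp: N_def intro: finite_subset)
  have sumN: "(\<Sum>(p, q)\<in>N. v p q) = 0"
  proof -
    have "(\<Sum>(p, q)\<in>N. v p q) = (\<Sum>(p, q)\<in>A. v p q)" using * by (intro sum.mono_neutral_left) (auto simp: N_def)
    then show ?thesis using * by simp
  qed
  \<comment> \<open>Each term is minus the sum of the others, so it lies in every subspace that
    contains them.\<close>
  have rest: "v p q \<in> S" if pq: "(p, q) \<in> N" and S: "vec.subspace S"
    "\<And>a b. (a, b) \<in> N \<Longrightarrow> (a, b) \<noteq> (p, q) \<Longrightarrow> v a b \<in> S" for p q S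
  proof -
    have "v p q + (\<Sum>(p, q)\<in>N - {(p, q)}. v p q) = 0"
      using sum.remove[OF finN pq, of "\<lambda>(p, q). v p q"] sumN by simp
    then have "v p q = - (\<Sum>(p, q)\<in>N - {(p, q)}. v p q)" by (simp add: eq_neg_iff_add_eq_0)
    also have "\<dots> \<in> S" using S by (intro vec.subspace_neg vec.subspace_sum) auto
    finally show ?thesis .
  qed
  have inJ: "v p q \<in> J p q" "v p q \<noteq> 0" if "(p, q) \<in> N" for p q using that * by (auto simp: N_def)
  \<comment> \<open>All other pieces lie in \<open>W (-1)\<close>, which meets \<open>J 0 0\<close>
    only in zero.\<close>
  have no00: "(0, 0) \<notin> N"
  proof
    assume 0: "(0, 0) \<in> N"
    have "v 0 0 \<in> W (-1)" by (rule rest[OF 0 subspace_W]) (use inJ(1) J_sub_W_m1 in blast)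
    then show False using J_00_W_m1 inJ 0 by blast
  qed
  define L where "L = {p. (p, - 1 - p) \<in> N}"
  have "L \<subseteq> fst ` N" by (force simp: L_def)
  then have finL: "finite L" using finN by (simp add: finite_subset)
  have cases: "(a, b) \<in> N \<Longrightarrow> (a, b) = (-1, -1) \<or> a \<in> L \<and> b = - 1 - a" for a b
  proof -
    assume ab: "(a, b) \<in> N"
    then have "J a b \<noteq> {0}" using inJ by blast
    then have "a + b = -1 \<or> (a, b) = (0, 0) \<or> (a, b) = (-1, -1)" using J_trivial by blast
    then have "b = - 1 - a \<or> (a, b) = (-1, -1)" using ab no00 by auto
    then show "(a, b) = (-1, -1) \<or> a \<in> L \<and> b = - 1 - a" using ab by (auto simp: L_def)
  qed
  have "L = {}"
  proof (rule ccontr)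
    assume "L \<noteq> {}"
    define p where "p = Min L"
    have p: "(p, - 1 - p) \<in> N" "\<And>a. a \<in> L \<Longrightarrow> p \<le> a"
      using Min_in[OF finL \<open>L \<noteq> {}\<close>] Min_le[OF finL] by (auto simp: p_def L_def)
    let ?S = "gr_F W F (-1) (p + 1)"
    have "v p (- 1 - p) \<in> ?S"
    proof (rule rest[OF p(1) subspace_gr_F])
      fix a b assume ab: "(a, b) \<in> N" "(a, b) \<noteq> (p, - 1 - p)"
      show "v a b \<in> ?S"
      proof (cases "(a, b) = (-1, -1)")
        case True
        then show ?thesis using inJ(1)[OF ab(1)] J_m1m1 gr_F_bounds(1)[of "-1"] by auto
      next
        case False
        then have a: "a \<in> L" "b = - 1 - a" "a \<ge> p + 1" using cases[OF ab(1)] p(2)[of a] ab(2) by force+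
        then have "v a b \<in> F (p + 1)" "v a b \<in> W (-1)"
          using inJ(1)[OF ab(1)] J_sub_F[of a b] F_antimono[of "p + 1" a] J_line[of a b] by auto
        then have "v a b + 0 \<in> ?S"
          unfolding gr_F_def using vec.subspace_0[OF subspace_W] by (intro set_plus_intro) auto
        then show ?thesis by simp
      qed
    qed
    then obtain y w where yw: "y \<in> F (p + 1)" "y \<in> W (-1)" "w \<in> W (-2)" "v p (- 1 - p) = y + w"
      by (auto simp: gr_F_def set_plus_def)
    have vp: "v p (- 1 - p) \<in> J p (- 1 - p)" "v p (- 1 - p) \<noteq> 0" using inJ[OF p(1)] .
    have d: "y - v p (- 1 - p) \<in> W (-2)" using yw vec.subspace_neg[OF subspace_W yw(3)] by simp
    have "- (p + 1) = - 1 - p" by simp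
    then have c: "conjv (v p (- 1 - p)) \<in> F (- (p + 1))" "v p (- 1 - p) \<in> W (-1)"
      using vp(1) J_line[of p "- 1 - p"] by (simp_all only:)
    have "v p (- 1 - p) \<in> W (-2)" by (rule gr_m1_inter(2)[OF yw(1,2) c d])
    then show False using J_line_W_m2[OF _ vp(1)] vp(2) by simp
  qed
  then have N: "N \<subseteq> {(-1, -1)}" using cases by auto
  show "\<forall>(p, q)\<in>A. v p q = 0"
  proof (rule ccontr)
    assume "\<not> (\<forall>(p, q)\<in>A. v p q = 0)"
    then have "N \<noteq> {}" by (auto simp: N_def)
    then have "N = {(-1, -1)}" using N by auto
    then show False using sumN inJ(2)[of "-1" "-1"] by simp
  qed
qed (rule subspace_J)


text \<open>On the line \<open>p + q = -1\<close> and at \<open>(-1, -1)\<close> conjugation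
  exchanges the pieces exactly. At \<open>(0, 0)\<close> it does so only modulo
  \<open>W (-2)\<close>, and there the correction term is exactly \<open>W (-2)\<close>.\<close>

lemma conj_J: "conjv ` J p q + piece_span J {(a, b). a < q \<and> b < p} = J q p + piece_span J {(a, b). a < q \<and> b < p}"
proof -
  let ?U = "piece_span J {(a, b). a < q \<and> b < p}"
  have U_sub: "?U \<subseteq> W (-2)" if "p + q \<le> 0"
  proof (rule piece_span_minimal[OF subspace_W], clarsimp)
    fix a b x assume ab: "a < q" "b < p" "x \<in> J a b"
    then have "x \<in> W (a + b)" using J_sub_W by blast
    then show "x \<in> W (-2)" using W_mono[of "a + b" "-2"] ab that by auto
  qed
  consider "p + q = -1" | "p = 0" "q = 0" | "p = -1" "q = -1" | "J p q = {0}" "J q p = {0}"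
    using J_trivial[of p q] J_trivial[of q p] by force
  then show ?thesis
  proof cases
    case 1
    then have "conjv ` J p q = J q p" by (auto simp: in_conjv_image conjv_J_line conjv_J_line[of q p] add.commute)
    then show ?thesis by simp
  next
    case 2
    have "W (-2) \<subseteq> ?U" using 2 by (auto simp: J_m1m1 intro: piece_in_piece_span[of _ J "-1" "-1"])
    then have U: "?U = W (-2)" using U_sub 2 by auto
    have *: "\<exists>x'\<in>J 0 0. conjv x - x' \<in> W (-2)" if x: "x \<in> J 0 0" for x
    proof -
      obtain w where w: "w \<in> W (-2)" "conjv (x - w) \<in> F 0" using x J_00 by blast
      have "conjv (conjv (x - w) - (- conjv w)) = x" by (simp add: conjv_diff conjv_minus conjv_add)
      then have "conjv (x - w) \<in> J 0 0"
        using w x vec.subspace_neg[OF subspace_W, of "conjv w"] unfolding J_00 conjv_W by metis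
      moreover have "conjv x - conjv (x - w) = conjv w" by (simp add: conjv_diff)
      ultimately show ?thesis using w(1) by (metis conjv_W)
    qed
    have "conjv ` J 0 0 + W (-2) \<subseteq> J 0 0 + W (-2)"
    proof
      fix y assume "y \<in> conjv ` J 0 0 + W (-2)"
      then obtain x w where xw: "x \<in> J 0 0" "w \<in> W (-2)" "y = conjv x + w" by (auto simp: set_plus_def)
      obtain x' where x': "x' \<in> J 0 0" "conjv x - x' \<in> W (-2)" using *[OF xw(1)] by blast
      have "x' + (conjv x - x' + w) \<in> J 0 0 + W (-2)"
        by (rule set_plus_intro[OF x'(1) vec.subspace_add[OF subspace_W x'(2) xw(2)]])
      then show "y \<in> J 0 0 + W (-2)" using xw by simp
    qed
    moreover have "J 0 0 + W (-2) \<subseteq> conjv ` J 0 0 + W (-2)"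
    proof
      fix y assume "y \<in> J 0 0 + W (-2)"
      then obtain x w where xw: "x \<in> J 0 0" "w \<in> W (-2)" "y = x + w" by (auto simp: set_plus_def)
      obtain x' where x': "x' \<in> J 0 0" "conjv x - x' \<in> W (-2)" using *[OF xw(1)] by blast
      have "conjv (conjv x - x') \<in> W (-2)" using x'(2) by (simp add: conjv_W)
      then have "conjv x' + (conjv (conjv x - x') + w) \<in> conjv ` J 0 0 + W (-2)"
        by (intro set_plus_intro imageI x'(1) vec.subspace_add[OF subspace_W _ xw(2)])
      then show "y \<in> conjv ` J 0 0 + W (-2)" using xw by (simp add: conjv_diff)
    qed
    ultimately show ?thesis unfolding U using 2 by simp
  next
    case 3
    then show ?thesis by (simp add: J_m1m1 conjv_image_W)
  next
    case 4
    then show ?thesis by simp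
  qed
qed

lemma is_deligne_bigrading_J: "is_deligne_bigrading W F J"
  unfolding is_deligne_bigrading_def Let_def piece_span_Collect
  by (intro conjI allI direct_sum_J F_eq W_eq conj_J)

text \<open>It suffices to place every piece of \<open>I\<close> inside \<open>J\<close>. In weight
  \<open>-1\<close> the conjugation condition is exact because \<open>W (-3)\<close> is zero. In
  weight \<open>0\<close> the off-diagonal pieces die because \<open>F 1\<close> lies in
  \<open>W (-1)\<close>. In weight \<open>-2\<close> they die because \<open>W (-2)\<close> is a
  line defined over the reals.\<close>

lemma is_deligne_bigrading_unique:
  assumes I: "is_deligne_bigrading W F I" shows "I = J"
proof (rule direct_sum_decomposition_unique[OF _ direct_sum_J])
  note I' = I[unfolded is_deligne_bigrading_def Let_def piece_span_Collect]
  show dI: "direct_sum_decomposition I" using I by (simp add: is_deligne_bigrading_def)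
  have FI: "F p = piece_span I {(a, b). a \<ge> p}" for p
    by (rule I'[THEN conjunct2, THEN conjunct1, rule_format])
  have WI: "W k = piece_span I {(a, b). a + b \<le> k}" for k
    by (rule I'[THEN conjunct2, THEN conjunct2, THEN conjunct1, rule_format])
  have conjI: "conjv ` I p q + piece_span I {(a, b). a < q \<and> b < p} = I q p + piece_span I {(a, b). a < q \<and> b < p}" for p q
    by (rule I'[THEN conjunct2, THEN conjunct2, THEN conjunct2, rule_format])
  have sI: "vec.subspace (I p q)" for p q using dI by (simp add: direct_sum_decomposition_def)
  have IF: "x \<in> F p" if "x \<in> I p q" for x p q
    using that unfolding FI by (rule piece_in_piece_span) simp
  have IW: "x \<in> W (p + q)" if "x \<in> I p q" for x p q
    using that unfolding WI by (rule piece_in_piece_span) simp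
  have IW0: "x = 0" if "x \<in> I p q" "x \<in> W k" "k < p + q" for x p q k
  proof (rule piece_span_disjoint[OF dI])
    show "x \<in> piece_span I {(p, q)}" using that(1) by (rule piece_in_piece_span) simp
    show "x \<in> piece_span I {(a, b). a + b \<le> k}" using that(2) by (simp add: WI)
    show "{(p, q)} \<inter> {(a, b). a + b \<le> k} = {}" using that(3) by auto
  qed
  have conj: "\<exists>y\<in>I q p. conjv x - y \<in> W (p + q - 2)" if "x \<in> I p q" for x p q
  proof -
    have "conjv x + 0 \<in> conjv ` I p q + piece_span I {(a, b). a < q \<and> b < p}"
      using that vec.subspace_0[OF subspace_piece_span] by (intro set_plus_intro) auto
    then obtain y u where "y \<in> I q p" "u \<in> piece_span I {(a, b). a < q \<and> b < p}" "conjv x = y + u"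
      unfolding conjI by (auto simp: set_plus_def)
    moreover have "u \<in> W (p + q - 2)" unfolding WI
      by (rule piece_span_weaken[OF _ \<open>u \<in> _\<close>]) auto
    ultimately show ?thesis by (intro bexI[of _ y]) auto
  qed
  show "I p q \<subseteq> J p q" for p q
  proof
    fix x assume x: "x \<in> I p q"
    have 0: "0 \<in> J p q" by (rule vec.subspace_0[OF subspace_J])
    obtain y where y: "y \<in> I q p" "conjv x - y \<in> W (p + q - 2)" using conj[OF x] by blast
    consider "p + q \<ge> 1" | "p + q = 0" | "p + q = -1" | "p + q = -2" | "p + q \<le> -3" by linarith
    then show "x \<in> J p q"
    proof cases
      case 1
      then have "x = 0" using IW0[OF x, of 0] W_ge[of 0] by simp
      then show ?thesis using 0 by simp
    next
      case 2
      have pos: "z = 0" if "z \<in> I a b" "a + b = 0" "a \<ge> 1" for z a b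
        using IW0[OF that(1), of "-1"] that(2) F1_sub[OF that(3)] IF[OF that(1)] by auto
      consider "p = 0" "q = 0" | "p \<ge> 1" | "q \<ge> 1" using 2 by linarith
      then show ?thesis
      proof cases
        case 1
        have "conjv (conjv x - y) \<in> W (-2)" using y(2) 1 by (simp add: conjv_W)
        moreover have "conjv (x - conjv (conjv x - y)) = y" by (simp add: conjv_diff)
        ultimately show ?thesis using IF[OF x] IF[OF y(1)] 1 unfolding 1 J_00 by metis
      next
        case 2
        then have "x = 0" using pos[OF x] \<open>p + q = 0\<close> by simp
        then show ?thesis using 0 by simp
      next
        case 3
        then have "y = 0" using pos[OF y(1)] \<open>p + q = 0\<close> by simp
        then have "x \<in> W (-2)" using y(2) \<open>p + q = 0\<close> by (simp add: conjv_W)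
        then have "x = 0" using IW0[OF x, of "-2"] \<open>p + q = 0\<close> by simp
        then show ?thesis using 0 by simp
      qed
    next
      case 3
      then have "conjv x = y" using y(2) W_le[of "p + q - 2"] by simp
      then show ?thesis using 3 IF[OF x] IF[OF y(1)] IW[OF x] by (simp add: J_line)
    next
      case 4
      show ?thesis
      proof (cases "p = -1 \<and> q = -1")
        case True
        then show ?thesis using IW[OF x] by (simp add: J_m1m1)
      next
        case False
        then have pq: "p \<noteq> q" using 4 by auto
        have cx: "conjv x = y" using y(2) W_le[of "p + q - 2"] 4 by simp
        obtain c d where cd: "x = c *s f" "y = d *s f" using IW[OF x] IW[OF y(1)] 4 W_m2 by (auto simp: add.commute)
        then have "d = cnj c" using cx f_nz by (simp add: conjv_scale conjv_f)
        \<comment> \<open>A multiple of \<open>x\<close> that lies in both \<open>I p q\<close> and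
          \<open>I q p\<close>; scaling both sides avoids a division by \<open>c\<close>.\<close>
        then have "cnj c *s x = c *s y" using cd by (simp add: mult.commute)
        then have "cnj c *s x \<in> I q p" using vec.subspace_scale[OF sI y(1)] by simp
        then have "cnj c *s x \<in> piece_span I {(q, p)}" by (rule piece_in_piece_span) simp
        moreover have "cnj c *s x \<in> I p q" using vec.subspace_scale[OF sI x] by simp
        then have "cnj c *s x \<in> piece_span I {(p, q)}" by (rule piece_in_piece_span) simp
        ultimately have "cnj c *s x = 0"
          using pq by (intro piece_span_disjoint[OF dI, of "{(q, p)}" "{(p, q)}"]) simp_all
        then have "x = 0" using cd(1) by auto
        then show ?thesis using 0 by simp
      qed
    next
      case 5
      then have "x = 0" using IW[OF x] W_le by auto
      then show ?thesis using 0 by simp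
    qed
  qed
qed

lemma deligne_bigrading_eq: "deligne_bigrading W F = J"
  unfolding deligne_bigrading_def
  using is_deligne_bigrading_J is_deligne_bigrading_unique by (rule the_equality)

section \<open>The grading operator and the Deligne splitting\<close>

lemma piece_proj_J: "x \<in> J p q \<Longrightarrow> piece_proj J T *v x = (if (p, q) \<in> T then x else 0)"
  using piece_proj_id[OF direct_sum_J piece_in_piece_span[of x J p q T]]
    piece_proj_0[OF direct_sum_J piece_in_piece_span[of x J p q "{(p, q)}"]] by auto

text \<open>The vector \<open>v - conjv v\<close> is the negative of its conjugate and
  \<open>f\<close> is real. Hence \<open>- (\<i> / 2) * c\<close> is a real number.\<close>

lemma defect_imaginary: assumes "v - conjv v = c *s f" shows "cnj c = - c"
proof -
  have "cnj c *s f = conjv (v - conjv v)" using assms by (simp add: conjv_scale conjv_f)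
  also have "\<dots> = - (v - conjv v)" by (simp add: conjv_diff)
  also have "\<dots> = (- c) *s f" using assms by (metis vec.scale_minus_left)
  finally show ?thesis using f_nz unfolding vector_mul_rcancel by blast
qed

text \<open>If \<open>v - conjv v = c f\<close>, then \<open>v - (c / 2) f\<close> is real, so that \<open>\<delta>\<close> measures half the defect \<open>c\<close>.\<close>

lemma hom_coord_deligne_delta:
  assumes v: "v \<in> F 0" "v - e \<in> W (-1)" "v - conjv v = c *s f"
  shows "hom_coord l e f (deligne_delta W F) = - (\<i> / 2) * c / complex_of_real l"
proof -
  have cf: "c *s f \<in> W (-2)" using W_m2 by auto
  have "v - c *s f = conjv v" using v(3) by (simp add: algebra_simps)
  then have vJ: "v \<in> J 0 0" using v(1) cf unfolding J_00 by (intro conjI bexI[of _ "c *s f"]) auto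
  let ?PL = "piece_proj J {(a, b). a + b = -1}" and ?Pf = "piece_proj J {(-1, -1)}"
  \<comment> \<open>The weights \<open>0\<close>, \<open>-1\<close> and \<open>-2\<close> as a
    combination of projections; this is the witness for the existence of \<open>Y\<close>.\<close>
  let ?Y0 = "0 - ?PL - ?Pf - ?Pf"
  have Y0: "?Y0 *v x = of_int (p + q) *s x" if x: "x \<in> J p q" for p q x
  proof -
    have "?Y0 *v x = - (?PL *v x) - ?Pf *v x - ?Pf *v x"
      by (simp add: matrix_vector_mult_def vec_eq_iff sum_subtractf sum_negf left_diff_distrib sum_distrib_left mult.assoc)
    also have "\<dots> = of_int (p + q) *s x"
    proof (cases "p + q = -1 \<or> (p, q) = (0, 0) \<or> (p, q) = (-1, -1)")
      case True
      then consider "p + q = -1" | "p = 0" "q = 0" | "p = -1" "q = -1" by blast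
      then show ?thesis
      proof cases
        case 1
        then have "of_int (p + q) = (-1 :: complex)" by simp
        moreover have "(p, q) \<noteq> (-1, -1)" using 1 by auto
        ultimately show ?thesis using 1 by (auto simp: piece_proj_J[OF x] simp del: of_int_add)
      qed (simp_all add: piece_proj_J[OF x] vec_eq_iff)
    next
      case False
      then show ?thesis using x J_trivial[of p q] by auto
    qed
    finally show ?thesis .
  qed
  define Y where "Y = deligne_Y W F"
  have Y: "\<forall>p q. \<forall>v\<in>J p q. Y *v v = of_int (p + q) *s v"
    unfolding Y_def deligne_Y_def deligne_bigrading_eq
  proof (rule theI[of _ ?Y0])
    fix Y' assume *: "\<forall>p q. \<forall>v\<in>J p q. Y' *v v = of_int (p + q) *s v"
    show "Y' = ?Y0" by (rule matrix_eq_on_pieces[OF direct_sum_J]) (use * Y0 in metis)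
  qed (use Y0 in blast)
  define D where "D = Y - conjm Y"
  have D: "D *v x = Y *v x - conjv (Y *v conjv x)" for x
    by (simp add: D_def matrix_vector_mult_diff_rdistrib conjm_mult_vec)
  have Yf: "Y *v w = (-2) *s w" if "w \<in> W (-2)" for w
  proof -
    have "w \<in> J (-1) (-1)" using that J_m1m1 by simp
    then have "Y *v w = of_int (-1 + -1) *s w" using Y by blast
    then show ?thesis by simp
  qed
  \<comment> \<open>On \<open>W (-1)\<close> conjugation maps pieces to pieces of the same weight,
    so \<open>Y\<close> is real there and only its value on a lift of \<open>e\<close>
    matters.\<close>
  have "piece_span J {(a, b). a + b \<le> -1} \<subseteq> {x. D *v x = 0}"
  proof (rule piece_span_minimal, unfold vec.subspace_def; clarsimp?)
    fix a b :: int and x assume ab: "a + b \<le> -1" "x \<in> J a b"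
    show "D *v x = 0"
    proof (cases "a + b = -1")
      case True
      then have "conjv x \<in> J b a" using ab by (simp add: conjv_J_line)
      then have "Y *v conjv x = of_int (b + a) *s conjv x" "Y *v x = of_int (a + b) *s x" using Y ab by blast+
      then show ?thesis using True by (simp add: D conjv_minus add.commute del: of_int_add)
    next
      case False
      then have "x \<in> W (-2)" using J_sub_W[of a b] W_mono[of "a + b" "-2"] ab by auto
      then show ?thesis by (simp add: D Yf conjv_W conjv_scale conjv_minus)
    qed
  qed (auto simp: matrix_vector_right_distrib vector_scalar_commute)
  then have DW: "D *v x = 0" if "x \<in> W (-1)" for x using that W_m1_eq by auto
  have "cnj c = - c" by (rule defect_imaginary[OF v(3)])
  have "Y *v v = 0" using Y vJ by force
  moreover have "Y *v conjv v = Y *v v - c *s (Y *v f)"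
  proof -
    have "conjv v = v - c *s f" using v(3) by (simp add: algebra_simps)
    then show ?thesis by (simp add: matrix_vector_mult_diff_distrib vector_scalar_commute)
  qed
  \<comment> \<open>From \<open>conjv v = v - c *s f\<close> the operator \<open>Y\<close> sends
    \<open>conjv v\<close> to \<open>2 * c\<close> times \<open>f\<close>; the conjugate of this is
    subtracted.\<close>
  ultimately have "D *v v = - (cnj c * 2) *s f" using Yf[OF f_in]
    by (simp add: D conjv_scale conjv_f conjv_minus vec.scale_minus_left conjv_diff)
  then have Dv: "D *v v = (2 * c) *s f" using \<open>cnj c = - c\<close> by (simp add: mult.commute)
  have "D *v (v - e) = 0" using v(2) by (rule DW)
  then have De: "D *v e = (2 * c) *s f" using Dv by (simp add: matrix_vector_mult_diff_distrib)
  \<comment> \<open>The factor in front of \<open>Y\<close> minus its conjugate;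
    \<open>2 * c / (4 * \<i>)\<close> is \<open>- (\<i> / 2) * c\<close>.\<close>
  define k :: complex where "k = 1 / (4 * \<i>)"
  have "deligne_delta W F = (\<chi> i j. k * D $ i $ j)" by (simp add: deligne_delta_def D_def Y_def k_def)
  then have "deligne_delta W F *v e = k *s (D *v e)"
    by (simp add: vec_eq_iff matrix_vector_mult_def sum_distrib_left mult.assoc)
  also have "\<dots> = (- (\<i> / 2) * c) *s f" unfolding De by (simp add: k_def vec_eq_iff field_simps)
  finally have *: "deligne_delta W F *v e = (- (\<i> / 2) * c) *s f" .
  have "(THE d. deligne_delta W F *v e = d *s f) = - (\<i> / 2) * c"
    unfolding * using f_nz by (intro the_equality) (auto simp only: vector_mul_rcancel)
  then show ?thesis by (simp add: hom_coord_def)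
qed

end

section \<open>Nilpotent exponentials\<close>

definition matpow :: "complex ^ 'n ^ 'n \<Rightarrow> nat \<Rightarrow> complex ^ 'n ^ 'n" where
  "matpow X k = (((**) X) ^^ k) (mat 1)"

lemma matpow_0 [simp]: "matpow X 0 = mat 1"
  by (simp add: matpow_def)

lemma matpow_Suc: "matpow X (Suc k) = X ** matpow X k"
  by (simp add: matpow_def)

lemma matpow_add: "matpow X (j + k) = matpow X j ** matpow X k"
  by (induction j) (simp_all add: matpow_Suc matrix_mul_lid matrix_mul_assoc)

lemma scaleR_matrix_mult:
  fixes A B :: "complex ^ 'n ^ 'n"
  shows "(c *\<^sub>R A) ** B = c *\<^sub>R (A ** B)" "A ** (c *\<^sub>R B) = c *\<^sub>R (A ** B)"
  by (simp_all add: matrix_matrix_mult_def vec_eq_iff scaleR_sum_right)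

lemma scaleR_matrix_vector:
  fixes A :: "complex ^ 'n ^ 'n"
  shows "(c *\<^sub>R A) *v x = c *\<^sub>R (A *v x)" "A *v (c *\<^sub>R x) = c *\<^sub>R (A *v x)"
  by (simp_all add: matrix_vector_mult_def vec_eq_iff scaleR_sum_right)

lemma sum_matrix_vector:
  fixes A :: "'a \<Rightarrow> complex ^ 'n ^ 'n"
  shows "(\<Sum>i\<in>S. A i) *v x = (\<Sum>i\<in>S. A i *v x)" "B *v (\<Sum>i\<in>S. g i) = (\<Sum>i\<in>S. B *v g i)"
proof -
  have "0 *v x = 0" "B *v 0 = 0" by (simp_all add: matrix_vector_mult_def vec_eq_iff)
  then show "(\<Sum>i\<in>S. A i) *v x = (\<Sum>i\<in>S. A i *v x)" "B *v (\<Sum>i\<in>S. g i) = (\<Sum>i\<in>S. B *v g i)"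
    by (induction S rule: infinite_finite_induct)
       (simp_all add: matrix_vector_mult_add_rdistrib matrix_vector_right_distrib)
qed

lemma scaleR_eq_scale: "c *\<^sub>R (x :: complex ^ 'n) = complex_of_real c *s x"
  by (simp add: vec_eq_iff scaleR_conv_of_real[where 'a = complex])

lemma subspace_vec_subspace: "vec.subspace (S :: (complex ^ 'n) set) \<Longrightarrow> subspace S"
  by (simp add: subspace_def vec.subspace_def scaleR_eq_scale)

lemma matpow_scaleR: "matpow (c *\<^sub>R X) k = c ^ k *\<^sub>R matpow X k"
  by (induction k) (simp_all add: matpow_Suc scaleR_matrix_mult)

lemma matpow_vanish: "matpow X N = 0 \<Longrightarrow> N \<le> k \<Longrightarrow> matpow X k = 0"
  using matpow_add[of X "k - N" N] by (simp add: matrix_matrix_mult_def vec_eq_iff)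

lemma matrix_exp_nilpotent:
  assumes "matpow X N = 0"
  shows "matrix_exp X = (\<Sum>k<N. (1 / fact k) *\<^sub>R matpow X k)"
proof -
  have "(\<Sum>k. (1 / fact k) *\<^sub>R matpow X k) = (\<Sum>k<N. (1 / fact k) *\<^sub>R matpow X k)"
    using matpow_vanish[OF assms] by (intro suminf_finite) auto
  then show ?thesis by (simp add: matrix_exp_def matpow_def)
qed

lemma matrix_exp_vector:
  assumes "matpow X N = 0"
  shows "matrix_exp (t *\<^sub>R X) *v x = (\<Sum>k<N. (t ^ k / fact k) *\<^sub>R (matpow X k *v x))"
proof -
  have "matpow (t *\<^sub>R X) N = 0" using assms by (simp add: matpow_scaleR)
  then show ?thesis
    by (simp add: matrix_exp_nilpotent sum_matrix_vector scaleR_matrix_vector matpow_scaleR)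
qed

text \<open>With all powers from \<open>N\<close> on equal to zero, both exponentials are finite
  sums; grouping the product by total degree leaves the binomial theorem.\<close>

lemma matrix_exp_add:
  assumes "matpow X N = 0"
  shows "matrix_exp (s *\<^sub>R X) *v (matrix_exp (t *\<^sub>R X) *v x) = matrix_exp ((s + t) *\<^sub>R X) *v x"
proof -
  let ?c = "\<lambda>i j. s ^ i / fact i * (t ^ j / fact j)"
  have van: "matpow X (i + j) *v x = 0" if "\<not> i + j < N" for i j
    using that by (simp add: matpow_vanish[OF assms])
  have "matrix_exp (s *\<^sub>R X) *v (matpow X j *v x) = (\<Sum>i<N. (s ^ i / fact i) *\<^sub>R (matpow X (i + j) *v x))" for j
    unfolding matrix_exp_vector[OF assms] by (simp add: matpow_add matrix_vector_mul_assoc)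
  then have "matrix_exp (s *\<^sub>R X) *v (matrix_exp (t *\<^sub>R X) *v x)
      = (\<Sum>j<N. \<Sum>i<N. ?c i j *\<^sub>R (matpow X (i + j) *v x))"
    unfolding matrix_exp_vector[OF assms, of t]
    by (simp add: sum_matrix_vector(2) scaleR_matrix_vector(2) scaleR_sum_right mult.commute)
  also have "\<dots> = (\<Sum>i<N. \<Sum>j<N. ?c i j *\<^sub>R (matpow X (i + j) *v x))"
    by (rule sum.swap)
  also have "\<dots> = (\<Sum>(i, j)\<in>{..<N} \<times> {..<N}. ?c i j *\<^sub>R (matpow X (i + j) *v x))"
    by (simp add: sum.cartesian_product)
  \<comment> \<open>The square of indices is cut down to the triangle, since terms of total degree
    at least \<open>N\<close> vanish.\<close>
  also have "\<dots> = (\<Sum>(i, j)\<in>{(i, j). i + j < N}. ?c i j *\<^sub>R (matpow X (i + j) *v x))"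
    by (rule sum.mono_neutral_right, simp, force) (use van in force)
  also have "\<dots> = (\<Sum>n<N. \<Sum>i\<le>n. ?c i (n - i) *\<^sub>R (matpow X n *v x))"
    by (simp add: sum.triangle_reindex)
  also have "\<dots> = (\<Sum>n<N. ((s + t) ^ n / fact n) *\<^sub>R (matpow X n *v x))"
  proof (rule sum.cong[OF refl])
    fix n
    have "(\<Sum>i\<le>n. ?c i (n - i)) = (s + t) ^ n / fact n"
      unfolding binomial_ring sum_divide_distrib
      by (rule sum.cong) (auto simp: binomial_fact)
    then show "(\<Sum>i\<le>n. ?c i (n - i) *\<^sub>R (matpow X n *v x)) = ((s + t) ^ n / fact n) *\<^sub>R (matpow X n *v x)"
      by (simp flip: scaleR_sum_left)
  qed
  finally show ?thesis by (simp add: matrix_exp_vector[OF assms])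
qed

lemma matrix_exp_minus:
  assumes "matpow X N = 0"
  shows "matrix_exp (- t *\<^sub>R X) *v (matrix_exp (t *\<^sub>R X) *v x) = x"
proof -
  have "matpow (0 :: complex ^ 'a ^ 'a) 1 = 0" using matpow_Suc[of 0 0] by simp
  then have "matrix_exp (0 :: complex ^ 'a ^ 'a) = mat 1" by (simp add: matrix_exp_nilpotent[of _ 1])
  then show ?thesis using matrix_exp_add[OF assms, of "- t" t] by simp
qed

lemma invertible_matrix_exp:
  assumes "matpow X N = 0" shows "invertible (matrix_exp (t *\<^sub>R X))"
  unfolding invertible_def
proof (intro exI conjI)
  show "matrix_exp (t *\<^sub>R X) ** matrix_exp (- t *\<^sub>R X) = mat 1"
    "matrix_exp (- t *\<^sub>R X) ** matrix_exp (t *\<^sub>R X) = mat 1"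
    using matrix_exp_minus[OF assms, of t] matrix_exp_minus[OF assms, of "- t"]
    by (simp_all add: matrix_eq flip: matrix_vector_mul_assoc)
qed

text \<open>The difference quotients lie in \<open>S\<close>, and a finite-dimensional subspace is
  closed.\<close>

lemma has_vector_derivative_in_subspace:
  fixes g :: "real \<Rightarrow> 'a::euclidean_space"
  assumes "(g has_vector_derivative g') (at t)" "subspace S" "\<forall>\<^sub>F s in nhds t. g s \<in> S"
  shows "g' \<in> S"
proof (rule Lim_in_closed_set)
  show "closed S" using assms(2) by (rule closed_subspace)
  have "(\<lambda>h. norm (g (t + h) - g t - h *\<^sub>R g') / norm h) \<midarrow>0\<rightarrow> 0"
    using assms(1) by (simp add: has_vector_derivative_def has_derivative_at)
  moreover have "norm (g (t + h) - g t - h *\<^sub>R g') / norm h = norm ((g (t + h) - g t) /\<^sub>R h - g')" if "h \<noteq> 0" for h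
  proof -
    have "(g (t + h) - g t) /\<^sub>R h - g' = (g (t + h) - g t - h *\<^sub>R g') /\<^sub>R h"
      using that by (simp add: scaleR_diff_right)
    then show ?thesis by (simp add: divide_inverse mult.commute)
  qed
  ultimately have "(\<lambda>h. norm ((g (t + h) - g t) /\<^sub>R h - g')) \<midarrow>0\<rightarrow> 0"
    by (subst (asm) LIM_equal) auto
  then show "((\<lambda>h. (g (t + h) - g t) /\<^sub>R h) \<longlongrightarrow> g') (at 0)"
    by (simp add: tendsto_norm_zero_cancel Lim_null[of _ g'])
  have t: "g t \<in> S" using assms(3) by (rule eventually_nhds_x_imp_x)
  have "\<forall>\<^sub>F h in nhds 0. g (t + h) \<in> S"
  proof -
    have "((\<lambda>h. t + h) \<longlongrightarrow> t + 0) (nhds 0)" by (intro tendsto_intros filterlim_ident)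
    then show ?thesis using eventually_compose_filterlim[OF assms(3), of "\<lambda>h. t + h" "nhds 0"] by simp
  qed
  then show "\<forall>\<^sub>F h in at 0. (g (t + h) - g t) /\<^sub>R h \<in> S"
    unfolding eventually_at_filter
    by (rule eventually_mono) (use t assms(2) in \<open>auto intro: subspace_scale subspace_diff\<close>)
qed simp

text \<open>At zero only the linear term contributes; \<open>N \<ge> 2\<close> ensures that it
  occurs in the sum.\<close>

lemma exp_sum_has_vector_derivative:
  fixes a :: "nat \<Rightarrow> 'a::real_normed_vector"
  assumes "N \<ge> 2"
  shows "((\<lambda>t. \<Sum>k<N. (t ^ k / fact k) *\<^sub>R a k) has_vector_derivative a 1) (at 0)"
proof -
  have "((\<lambda>t::real. (t ^ k / fact k) *\<^sub>R a k) has_vector_derivative (if k = 1 then a 1 else 0)) (at 0)" for k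
  proof -
    have "((\<lambda>t::real. t ^ k / fact k) has_field_derivative (if k = 1 then 1 else 0)) (at 0)"
      by (rule derivative_eq_intros | simp)+ (cases k; auto simp: power_0_left)
    from has_vector_derivative_scaleR[OF this has_vector_derivative_const[of "a k"]] show ?thesis by (simp split: if_splits)
  qed
  then have "((\<lambda>t. \<Sum>k<N. (t ^ k / fact k) *\<^sub>R a k) has_vector_derivative (\<Sum>k<N. if k = 1 then a 1 else 0)) (at 0)"
    by (intro has_vector_derivative_sum)
  then show ?thesis using assms by simp
qed

text \<open>For nilpotent endomorphisms membership in the Lie algebra is an infinitesimal condition, hence
  linear.\<close>

definition infinitesimal :: "'n::finite filtration \<Rightarrow> (int \<Rightarrow> complex ^ 'n \<Rightarrow> complex ^ 'n \<Rightarrow> complex) \<Rightarrow> (complex ^ 'n ^ 'n) set" where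
  "infinitesimal W Q = {X. \<forall>k. \<forall>x\<in>W k. X *v x \<in> W k \<and> (\<forall>y\<in>W k. Q k (X *v x) y + Q k x (X *v y) = 0)}"

locale bilinear_forms =
  fixes W :: "'n::finite filtration" and Q :: "int \<Rightarrow> complex ^ 'n \<Rightarrow> complex ^ 'n \<Rightarrow> complex"
  assumes sub: "vec.subspace (W k)"
    and Q_add: "x \<in> W k \<Longrightarrow> y \<in> W k \<Longrightarrow> z \<in> W k \<Longrightarrow> Q k (x + y) z = Q k x z + Q k y z"
    and Q_scale: "x \<in> W k \<Longrightarrow> y \<in> W k \<Longrightarrow> Q k (c *s x) y = c * Q k x y"
    and Q_sym: "x \<in> W k \<Longrightarrow> y \<in> W k \<Longrightarrow> Q k x y = (-1) powi k * Q k y x"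
begin

lemma Q_add_right: "x \<in> W k \<Longrightarrow> y \<in> W k \<Longrightarrow> z \<in> W k \<Longrightarrow> Q k z (x + y) = Q k z x + Q k z y"
  using Q_sym[of z k x] Q_sym[of z k y] Q_sym[of z k "x + y"] Q_add[of x k y z] vec.subspace_add[OF sub]
  by (simp add: algebra_simps)

lemma Q_scale_right: "x \<in> W k \<Longrightarrow> y \<in> W k \<Longrightarrow> Q k y (c *s x) = c * Q k y x"
  using Q_sym[of y k x] Q_sym[of y k "c *s x"] Q_scale[of x k y c] vec.subspace_scale[OF sub]
  by (simp add: algebra_simps)

lemma sum_in_W: "(\<And>i. i \<in> S \<Longrightarrow> x i \<in> W k) \<Longrightarrow> (\<Sum>i\<in>S. c i *\<^sub>R x i) \<in> W k"
  by (auto simp: scaleR_eq_scale intro!: vec.subspace_sum[OF sub] vec.subspace_scale[OF sub])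

lemma Q_sum:
  assumes "finite S" "\<And>i. i \<in> S \<Longrightarrow> x i \<in> W k" "z \<in> W k"
  shows "Q k (\<Sum>i\<in>S. c i *\<^sub>R x i) z = (\<Sum>i\<in>S. c i *\<^sub>R Q k (x i) z)"
    "Q k z (\<Sum>i\<in>S. c i *\<^sub>R x i) = (\<Sum>i\<in>S. c i *\<^sub>R Q k z (x i))"
proof -
  have 0: "0 \<in> W k" by (rule vec.subspace_0[OF sub])
  have *: "Q k 0 z = 0" "Q k z 0 = 0" using Q_scale[OF 0 assms(3), of 0] Q_scale_right[OF 0 assms(3), of 0] by simp_all
  have W: "c i *\<^sub>R x i \<in> W k" if "x i \<in> W k" for i using that by (simp add: scaleR_eq_scale vec.subspace_scale[OF sub])
  have s: "Q k (c i *\<^sub>R x i) z = c i *\<^sub>R Q k (x i) z" "Q k z (c i *\<^sub>R x i) = c i *\<^sub>R Q k z (x i)"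
    if "x i \<in> W k" for i
    using that by (simp_all add: scaleR_eq_scale Q_scale Q_scale_right assms(3) scaleR_conv_of_real[where 'a = complex])
  show "Q k (\<Sum>i\<in>S. c i *\<^sub>R x i) z = (\<Sum>i\<in>S. c i *\<^sub>R Q k (x i) z)"
    using assms(1,2) by (induction S rule: finite_induct) (simp_all add: * W s Q_add sum_in_W assms(3))
  show "Q k z (\<Sum>i\<in>S. c i *\<^sub>R x i) = (\<Sum>i\<in>S. c i *\<^sub>R Q k z (x i))"
    using assms(1,2) by (induction S rule: finite_induct) (simp_all add: * W s Q_add_right sum_in_W assms(3))
qed

lemma infinitesimal_matpow:
  assumes "X \<in> infinitesimal W Q" "x \<in> W k"
  shows "matpow X i *v x \<in> W k"
    and "y \<in> W k \<Longrightarrow> Q k (matpow X i *v x) y = (-1) ^ i * Q k x (matpow X i *v y)"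
proof -
  have W: "matpow X i *v z \<in> W k" if "z \<in> W k" for i z
    using that assms(1) by (induction i) (auto simp: matpow_Suc infinitesimal_def simp flip: matrix_vector_mul_assoc)
  then show "matpow X i *v x \<in> W k" using assms(2) .
  have 1: "Q k (X *v u) v = - Q k u (X *v v)" "X *v u \<in> W k" if "u \<in> W k" "v \<in> W k" for u v
    using assms(1) that by (auto simp: infinitesimal_def add_eq_0_iff)
  have comm: "X *v (matpow X i *v v) = matpow X i *v (X *v v)" for i v
    using matpow_add[of X 1 i] matpow_add[of X i 1] by (simp add: matpow_Suc matrix_vector_mul_assoc)
  show "Q k (matpow X i *v x) y = (-1) ^ i * Q k x (matpow X i *v y)" if "y \<in> W k"
    using that
  proof (induction i arbitrary: y)
    case (Suc i)
    have "Q k (matpow X (Suc i) *v x) y = - Q k (matpow X i *v x) (X *v y)"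
      using 1[OF W[OF assms(2)] Suc.prems] by (simp add: matpow_Suc flip: matrix_vector_mul_assoc)
    also have "\<dots> = - ((-1) ^ i * Q k x (matpow X i *v (X *v y)))"
      using Suc.IH[of "X *v y"] 1(2)[OF Suc.prems Suc.prems] by simp
    finally show ?case by (simp add: matpow_Suc comm flip: matrix_vector_mul_assoc)
  qed simp
qed

text \<open>Skewness makes \<open>exp (- t X)\<close> the adjoint and hence the inverse of
  \<open>exp (t X)\<close>, which is then an isometry. Conversely, the invariance is a polynomial
  identity in \<open>t\<close>, and its linear coefficient is the infinitesimal condition.\<close>

lemma nilpotent_lie_alg_iff:
  assumes N: "matpow X N = 0" "N \<ge> 2"
  shows "X \<in> lie_alg W Q \<longleftrightarrow> X \<in> infinitesimal W Q"
proof
  let ?E = "\<lambda>t. matrix_exp (t *\<^sub>R X)"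
  assume X: "X \<in> infinitesimal W Q"
  have in_W: "?E t *v x \<in> W k" if "x \<in> W k" for t x k
    unfolding matrix_exp_vector[OF N(1)] by (intro sum_in_W infinitesimal_matpow X that)
  \<comment> \<open>Each factor \<open>X\<close> moved across \<open>Q\<close> contributes a sign,
    which turns \<open>t\<close> into \<open>- t\<close>.\<close>
  have adj: "Q k (?E t *v x) z = Q k x (?E (- t) *v z)" if "x \<in> W k" "z \<in> W k" for k x z t
  proof -
    have "Q k (?E t *v x) z = (\<Sum>i<N. (t ^ i / fact i) *\<^sub>R Q k (matpow X i *v x) z)"
      unfolding matrix_exp_vector[OF N(1)] by (intro Q_sum infinitesimal_matpow X that) simp
    also have "\<dots> = (\<Sum>i<N. ((- t) ^ i / fact i) *\<^sub>R Q k x (matpow X i *v z))"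
    proof (rule sum.cong[OF refl])
      fix i
      have "(t ^ i / fact i) *\<^sub>R ((-1) ^ i * Q k x (matpow X i *v z)) = ((- t) ^ i / fact i) *\<^sub>R Q k x (matpow X i *v z)"
        by (simp add: scaleR_conv_of_real[where 'a = complex] power_minus[of t] mult_ac)
      then show "(t ^ i / fact i) *\<^sub>R Q k (matpow X i *v x) z = ((- t) ^ i / fact i) *\<^sub>R Q k x (matpow X i *v z)"
        by (simp add: infinitesimal_matpow(2)[OF X that])
    qed
    also have "\<dots> = Q k x (?E (- t) *v z)"
      unfolding matrix_exp_vector[OF N(1)] by (intro Q_sum(2)[symmetric] infinitesimal_matpow X that) simp
    finally show ?thesis .
  qed
  have "?E t \<in> aut_group W Q" for t
    unfolding aut_group_def
  proof (clarify, intro conjI allI ballI)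
    show "invertible (?E t)" by (rule invertible_matrix_exp[OF N(1)])
    fix k
    show "((*v) (?E t)) ` W k = W k"
    proof (intro equalityI subsetI)
      fix x assume "x \<in> W k"
      then have "?E t *v (?E (- t) *v x) \<in> (*v) (?E t) ` W k" using in_W by blast
      then show "x \<in> (*v) (?E t) ` W k" using matrix_exp_minus[OF N(1), of "- t" x] by simp
    qed (use in_W in auto)
    fix x y assume "x \<in> W k" "y \<in> W k"
    then show "Q k (?E t *v x) (?E t *v y) = Q k x y"
      using adj in_W matrix_exp_minus[OF N(1), of t y] by simp
  qed
  then show "X \<in> lie_alg W Q" by (simp add: lie_alg_def)
next
  let ?E = "\<lambda>t. matrix_exp (t *\<^sub>R X)"
  assume "X \<in> lie_alg W Q"
  then have E: "?E t \<in> aut_group W Q" for t by (simp add: lie_alg_def)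
  then have in_W: "?E t *v x \<in> W k" if "x \<in> W k" for t x k using that unfolding aut_group_def by blast
  have X1: "matpow X 1 = X" by (simp add: matpow_Suc[of X 0, simplified])
  have XW: "X *v x \<in> W k" if "x \<in> W k" for k x
  proof (rule has_vector_derivative_in_subspace)
    show "((\<lambda>t. ?E t *v x) has_vector_derivative X *v x) (at 0)"
      using exp_sum_has_vector_derivative[OF N(2), of "\<lambda>k. matpow X k *v x"] unfolding matrix_exp_vector[OF N(1)] X1 .
  qed (use that in_W sub in \<open>auto intro: subspace_vec_subspace\<close>)
  then have pow: "matpow X i *v x \<in> W k" if "x \<in> W k" for i k x
    using that by (induction i) (auto simp: matpow_Suc simp flip: matrix_vector_mul_assoc)
  have "Q k (X *v x) y = - Q k x (X *v y)" if xy: "x \<in> W k" "y \<in> W k" for k x y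
  proof -
    \<comment> \<open>With one exponential moved to the other side, each side is a single polynomial
      in \<open>t\<close>, without products of two exponentials.\<close>
    have "Q k (?E t *v x) y = Q k x (?E (- t) *v y)" for t
    proof -
      have "Q k (?E t *v x) (?E t *v (?E (- t) *v y)) = Q k x (?E (- t) *v y)"
        using E[of t] xy in_W[OF xy(2)] unfolding aut_group_def by blast
      then show ?thesis using matrix_exp_minus[OF N(1), of "- t" y] by simp
    qed
    then have *: "(\<Sum>i<N. (t ^ i / fact i) *\<^sub>R Q k (matpow X i *v x) y)
        = (\<Sum>i<N. (t ^ i / fact i) *\<^sub>R ((-1) ^ i * Q k x (matpow X i *v y)))" for t
    proof -
      have "(\<Sum>i<N. (t ^ i / fact i) *\<^sub>R Q k (matpow X i *v x) y) = Q k (?E t *v x) y"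
        unfolding matrix_exp_vector[OF N(1)] by (intro Q_sum(1)[symmetric] pow xy) simp
      also have "\<dots> = Q k x (?E (- t) *v y)" by fact
      also have "\<dots> = (\<Sum>i<N. ((- t) ^ i / fact i) *\<^sub>R Q k x (matpow X i *v y))"
        unfolding matrix_exp_vector[OF N(1)] by (intro Q_sum pow xy) simp
      also have "\<dots> = (\<Sum>i<N. (t ^ i / fact i) *\<^sub>R ((-1) ^ i * Q k x (matpow X i *v y)))"
        by (rule sum.cong) (simp_all add: scaleR_conv_of_real[where 'a = complex] power_minus[of t] mult_ac)
      finally show ?thesis .
    qed
    have "Q k (matpow X 1 *v x) y = (-1) ^ 1 * Q k x (matpow X 1 *v y)"
      by (rule vector_derivative_unique_at[OF exp_sum_has_vector_derivative[OF N(2), of "\<lambda>i. Q k (matpow X i *v x) y"]])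
         (use exp_sum_has_vector_derivative[OF N(2), of "\<lambda>i. (-1) ^ i * Q k x (matpow X i *v y)"] in \<open>simp only: *\<close>)
    then show ?thesis by (simp only: X1) simp
  qed
  then show "X \<in> infinitesimal W Q" using XW by (simp add: infinitesimal_def)
qed

lemma subspace_infinitesimal: "subspace (infinitesimal W Q)"
proof (rule subspaceI)
  show "0 \<in> infinitesimal W Q"
    using Q_sum[of "{}"] vec.subspace_0[OF sub] by (auto simp: infinitesimal_def)
next
  fix X Y assume *: "X \<in> infinitesimal W Q" "Y \<in> infinitesimal W Q"
  then have W: "X *v x \<in> W k" "Y *v x \<in> W k" if "x \<in> W k" for x k using that by (auto simp: infinitesimal_def)
  have "Q k (X *v x) y = - Q k x (X *v y)" "Q k (Y *v x) y = - Q k x (Y *v y)" if "x \<in> W k" "y \<in> W k" for x y k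
    using * that by (auto simp: infinitesimal_def add_eq_0_iff)
  then show "X + Y \<in> infinitesimal W Q"
    by (auto simp: infinitesimal_def matrix_vector_mult_add_rdistrib W Q_add Q_add_right vec.subspace_add[OF sub])
next
  fix c X assume *: "X \<in> infinitesimal W Q"
  then have W: "X *v x \<in> W k" if "x \<in> W k" for x k using that by (auto simp: infinitesimal_def)
  have "Q k (X *v x) y = - Q k x (X *v y)" if "x \<in> W k" "y \<in> W k" for x y k
    using * that by (auto simp: infinitesimal_def add_eq_0_iff)
  then show "c *\<^sub>R X \<in> infinitesimal W Q"
    by (auto simp: infinitesimal_def scaleR_matrix_vector W scaleR_eq_scale Q_scale Q_scale_right vec.subspace_scale[OF sub])
qed

end

section \<open>Horizontal endomorphisms\<close>

context biext
begin

sublocale bilinear_forms W Q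
proof
  show "vec.subspace (W k)" for k by (rule subspace_W)
  have Q: "\<forall>k. \<forall>x\<in>W k. \<forall>y\<in>W k. \<forall>z\<in>W k. \<forall>c.
        Q k (x + y) z = Q k x z + Q k y z \<and> Q k (c *s x) y = c * Q k x y \<and>
        Q k x y = (-1) powi k * Q k y x"
    using type unfolding biextension_type_def graded_polarization_def by (elim conjE)
  then show "Q k (x + y) z = Q k x z + Q k y z" if "x \<in> W k" "y \<in> W k" "z \<in> W k" for x y z k
    using that by metis
  show "Q k (c *s x) y = c * Q k x y" if "x \<in> W k" "y \<in> W k" for x y k c
    using that Q by metis
  show "Q k x y = (-1) powi k * Q k y x" if "x \<in> W k" "y \<in> W k" for x y k
    using that Q by metis
qed

text \<open>This condition is linear in the matrix, holds for all of \<open>q_alg\<close>, passes to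
  derivatives of matrix functions, and already implies nilpotency.\<close>

definition lowering :: "(complex ^ 'n ^ 'n) set" where
  "lowering = {X. \<forall>p q. \<forall>v\<in>J p q. X *v v \<in> piece_span J {(a, b). a < p}}"

lemma piece_span_map:
  assumes "\<And>a b v. (a, b) \<in> S \<Longrightarrow> v \<in> J a b \<Longrightarrow> X *v v \<in> piece_span J T" "x \<in> piece_span J S"
  shows "X *v x \<in> piece_span J T"
proof -
  have "vec.subspace {x. X *v x \<in> piece_span J T}"
    using subspace_piece_span[of J T] unfolding vec.subspace_def
    by (auto simp: matrix_vector_right_distrib vector_scalar_commute matrix_vector_mult_0_right)
  then have "piece_span J S \<subseteq> {x. X *v x \<in> piece_span J T}"
    by (rule piece_span_minimal) (use assms(1) in auto)
  then show ?thesis using assms(2) by auto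
qed

lemma J_bounds: obtains p0 p1 where "\<And>p q. p \<ge> p1 \<Longrightarrow> J p q = {0}" "\<And>p q. p < p0 \<Longrightarrow> J p q = {0}"
proof -
  obtain p0 p1 where p: "\<And>p. p \<le> p0 \<Longrightarrow> F p = UNIV" "\<And>p. p \<ge> p1 \<Longrightarrow> F p = {0}" by (rule F_bounds) blast
  have 0: "0 \<in> J p q" for p q by (rule vec.subspace_0[OF subspace_J])
  have "J p q = {0}" if "p \<ge> p1" for p q using J_sub_F[of p q] p(2)[OF that] 0[of p q] by auto
  moreover have "J p q = {0}" if "p < p0" for p q
  proof -
    have "x = 0" if "x \<in> J p q" for x
    proof (rule piece_span_disjoint[OF direct_sum_J])
      show "x \<in> piece_span J {(p, q)}" using that by (rule piece_in_piece_span) simp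
      show "x \<in> piece_span J {(a, b). a \<ge> p0}" using p(1)[of p0] F_eq[of p0] by auto
      show "{(p, q)} \<inter> {(a, b). a \<ge> p0} = {}" using \<open>p < p0\<close> by auto
    qed
    then show ?thesis using 0[of p q] by auto
  qed
  ultimately show ?thesis using that by blast
qed

text \<open>Only finitely many first indices carry nonzero pieces, and every application of
  \<open>X\<close> lowers the index. The exponent does not depend on \<open>X\<close>, so the
  exponential of a whole family is a polynomial of fixed degree.\<close>

lemma lowering_nilpotent: obtains N where "N \<ge> 2" "\<And>X. X \<in> lowering \<Longrightarrow> matpow X N = 0"
proof -
  obtain p0 p1 where p: "\<And>p q. p \<ge> p1 \<Longrightarrow> J p q = {0}" "\<And>p q. p < p0 \<Longrightarrow> J p q = {0}" by (rule J_bounds) blast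
  \<comment> \<open>The first summand exhausts the nonzero indices; adding \<open>2\<close> gives
    room for the linear term of the exponential.\<close>
  define N where "N = nat (p1 - p0) + 2"
  have "matpow X N = 0" if X: "X \<in> lowering" for X
  proof -
    let ?L = "\<lambda>p. piece_span J {(a, b). a < p}"
    have "piece_span J UNIV \<subseteq> ?L p1"
    proof (rule piece_span_minimal[OF subspace_piece_span], rule subsetI)
      fix a b x assume "x \<in> J a b"
      then show "x \<in> ?L p1"
        using p(1)[of a b] vec.subspace_0[OF subspace_piece_span[of J]] piece_in_piece_span[of x J a b]
        by (cases "a < p1") auto
    qed
    then have "?L p1 = UNIV" using direct_sum_J by (auto simp: direct_sum_decomposition_def piece_span_UNIV)
    moreover have "matpow X k *v x \<in> ?L (p - int k)" if "x \<in> ?L p" for k p x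
      using that
    proof (induction k)
      case (Suc k)
      have "X *v (matpow X k *v x) \<in> ?L (p - int k - 1)"
      proof (rule piece_span_map[OF _ Suc.IH[OF Suc.prems]])
        fix a b v assume "(a, b) \<in> {(a, b). a < p - int k}" "v \<in> J a b"
        then have "X *v v \<in> ?L a" using X by (auto simp: lowering_def)
        then show "X *v v \<in> ?L (p - int k - 1)"
          by (rule piece_span_weaken[rotated]) (use \<open>(a, b) \<in> _\<close> in auto)
      qed
      then show ?case by (simp add: matpow_Suc algebra_simps flip: matrix_vector_mul_assoc)
    qed simp
    moreover have "?L (p1 - int N) \<subseteq> {0}"
    proof (rule piece_span_minimal, simp, clarify)
      fix a b x assume ab: "a < p1 - int N" "x \<in> J a b"
      have "int N \<ge> p1 - p0" by (simp add: N_def)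
      then have "J a b = {0}" using ab by (intro p(2)) linarith
      then show "x = 0" using ab(2) by simp
    qed
    ultimately have "matpow X N *v x = 0" for x by blast
    then show ?thesis by (simp add: matrix_eq)
  qed
  then show ?thesis using that[of N] by (simp add: N_def)
qed

lemma subspace_maps:
  "subspace {X. \<forall>p q. \<forall>v\<in>J p q. X *v v \<in> piece_span J (T p q)}"
  by (auto simp: subspace_def matrix_vector_mult_add_rdistrib scaleR_matrix_vector scaleR_eq_scale
      intro: vec.subspace_add[OF subspace_piece_span] vec.subspace_scale[OF subspace_piece_span]
        vec.subspace_0[OF subspace_piece_span])

lemma piece_span_single: "piece_span J {(p, q)} = J p q"
proof
  show "piece_span J {(p, q)} \<subseteq> J p q" by (rule piece_span_minimal[OF subspace_J]) auto
  show "J p q \<subseteq> piece_span J {(p, q)}" by (auto intro: piece_in_piece_span)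
qed

lemma lie_piece_lowering:
  assumes "X \<in> lie_piece W Q F r s" "r < 0" shows "X \<in> lowering"
  unfolding lowering_def
proof (clarify)
  fix p q v assume "v \<in> J p q"
  then have "X *v v \<in> J (p + r) (q + s)" using assms(1) by (auto simp: lie_piece_def deligne_bigrading_eq)
  then show "X *v v \<in> piece_span J {(a, b). a < p}" by (rule piece_in_piece_span) (use assms(2) in simp)
qed

text \<open>For \<open>r < 0\<close> the mapping property alone gives nilpotency, so membership in
  the Lie algebra can be tested infinitesimally and the piece is a linear subspace.\<close>

lemma lie_piece_iff:
  assumes "r < 0"
  shows "X \<in> lie_piece W Q F r s \<longleftrightarrow> X \<in> infinitesimal W Q \<and> (\<forall>p q. \<forall>v\<in>J p q. X *v v \<in> J (p + r) (q + s))"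
proof -
  obtain N where N: "N \<ge> 2" "\<And>X. X \<in> lowering \<Longrightarrow> matpow X N = 0" by (rule lowering_nilpotent) blast
  have low: "X \<in> lowering" if "\<forall>p q. \<forall>v\<in>J p q. X *v v \<in> J (p + r) (q + s)"
    unfolding lowering_def
  proof (clarify)
    fix p q v assume "v \<in> J p q"
    then have "X *v v \<in> J (p + r) (q + s)" using that by blast
    then show "X *v v \<in> piece_span J {(a, b). a < p}" by (rule piece_in_piece_span) (use assms in simp)
  qed
  have "X \<in> lie_alg W Q \<longleftrightarrow> X \<in> infinitesimal W Q" if "X \<in> lowering"
    using nilpotent_lie_alg_iff[OF N(2)[OF that] N(1)] .
  then show ?thesis using low by (auto simp: lie_piece_def deligne_bigrading_eq)
qed

lemma subspace_lie_piece: assumes "r < 0" shows "subspace (lie_piece W Q F r s)"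
proof -
  have "lie_piece W Q F r s = infinitesimal W Q \<inter> {X. \<forall>p q. \<forall>v\<in>J p q. X *v v \<in> piece_span J {(p + r, q + s)}}"
    using lie_piece_iff[OF assms] by (auto simp: piece_span_single)
  then show ?thesis using subspace_infinitesimal subspace_maps[of "\<lambda>p q. {(p + r, q + s)}"] by (simp add: subspace_inter)
qed

definition weight_preserving :: "(complex ^ 'n ^ 'n) set" where
  "weight_preserving = {X. \<forall>k. \<forall>x\<in>W k. X *v x \<in> W k}"

lemma subspace_weight_preserving: "subspace weight_preserving"
  by (auto simp: subspace_def weight_preserving_def matrix_vector_mult_add_rdistrib scaleR_matrix_vector scaleR_eq_scale
      intro: vec.subspace_add[OF subspace_W] vec.subspace_scale[OF subspace_W] vec.subspace_0[OF subspace_W])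

lemma q_alg_sub: "q_alg W Q F \<subseteq> lowering \<inter> weight_preserving"
  unfolding q_alg_def
proof (rule span_minimal)
  show "subspace (lowering \<inter> weight_preserving)"
    unfolding lowering_def using subspace_maps[of "\<lambda>p q. {(a, b). a < p}"] subspace_weight_preserving by (rule subspace_inter)
  show "\<Union>{lie_piece W Q F r s |r s. r < 0} \<subseteq> lowering \<inter> weight_preserving"
  proof
    fix X assume "X \<in> \<Union>{lie_piece W Q F r s |r s. r < 0}"
    then obtain r s where X: "X \<in> lie_piece W Q F r s" "r < 0" by blast
    then have "X \<in> infinitesimal W Q" using lie_piece_iff by blast
    then show "X \<in> lowering \<inter> weight_preserving"
      using lie_piece_lowering[OF X] by (auto simp: weight_preserving_def infinitesimal_def)
  qed
qed

lemma horizontal_sub_q: "horizontal_part W Q F \<subseteq> q_alg W Q F"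
  unfolding q_alg_def horizontal_part_def by (rule span_mono) force

text \<open>\<open>X *v f\<close> stays in the line \<open>W (-2)\<close>, which has type
  \<open>(-1, -1)\<close>, but must have first index below \<open>-1\<close>.\<close>

lemma lowering_f: assumes "X \<in> lowering \<inter> weight_preserving" shows "X *v f = 0"
proof (rule piece_span_disjoint[OF direct_sum_J])
  have f: "f \<in> J (-1) (-1)" using f_in by (simp add: J_m1m1)
  show "X *v f \<in> piece_span J {(a, b). a < -1}" using assms f by (auto simp: lowering_def)
  have "X *v f \<in> J (-1) (-1)" using assms f_in by (auto simp: weight_preserving_def J_m1m1)
  then show "X *v f \<in> piece_span J {(-1, -1)}" by (rule piece_in_piece_span) simp
qed auto

lemma lowering_W: assumes "X \<in> lowering \<inter> weight_preserving" "x \<in> W k" shows "X *v x \<in> W k"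
  using assms by (auto simp: weight_preserving_def)

lemma lowering_J_00: assumes "X \<in> lowering" "v \<in> J 0 0" shows "X *v v \<in> W (-1)"
proof -
  have "X *v v \<in> piece_span J {(a, b). a < 0}" using assms by (auto simp: lowering_def)
  moreover have "piece_span J {(a, b). a < 0} \<subseteq> W (-1)"
    by (rule piece_span_minimal[OF subspace_W]) (use J_sub_W_m1 in auto)
  ultimately show ?thesis by auto
qed

text \<open>Splitting the span at \<open>s = 0\<close> gives a candidate for the Hodge component. It
  is the only one, because combinations of elements of other types map \<open>J p q\<close> into the
  sum of all pieces except \<open>J (p - 1) q\<close>.\<close>

lemma horizontal_decomposition:
  assumes "X \<in> horizontal_part W Q F"
  defines "Z \<equiv> hodge_component W Q F (-1) 0 X"
  shows "\<And>p q v. v \<in> J p q \<Longrightarrow> Z *v v \<in> J (p - 1) q" "Z \<in> weight_preserving"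
    "\<And>p q v. v \<in> J p q \<Longrightarrow> (X - Z) *v v \<in> piece_span J {(a, b). a = p - 1 \<and> b \<noteq> q}"
proof -
  let ?R = "\<Union>s\<in>{s. s \<noteq> 0}. lie_piece W Q F (-1) s"
  have "(\<Union>s. lie_piece W Q F (-1) s) \<subseteq> lie_piece W Q F (-1) 0 \<union> ?R"
  proof
    fix Y assume "Y \<in> (\<Union>s. lie_piece W Q F (-1) s)"
    then obtain s where "Y \<in> lie_piece W Q F (-1) s" by blast
    then show "Y \<in> lie_piece W Q F (-1) 0 \<union> ?R" by (cases "s = 0") auto
  qed
  then have "X \<in> span (lie_piece W Q F (-1) 0 \<union> ?R)"
    using assms(1) span_mono unfolding horizontal_part_def by blast
  moreover have "span (lie_piece W Q F (-1) 0) = lie_piece W Q F (-1) 0"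
    using subspace_lie_piece[of "-1" 0] by simp
  ultimately obtain Z' R where ZR: "Z' \<in> lie_piece W Q F (-1) 0" "R \<in> span ?R" "X = Z' + R"
    unfolding span_Un by auto
  have maps: "Y *v v \<in> J (p + a) (q + b)" if "Y \<in> lie_piece W Q F a b" "v \<in> J p q" for Y a b p q v
    using that by (auto simp: lie_piece_def deligne_bigrading_eq)
  have "Z = Z'"
    unfolding Z_def hodge_component_def
  proof (rule the_equality)
    have "?R \<subseteq> \<Union>{lie_piece W Q F a b | a b. (a, b) \<noteq> (- 1, 0)}" by blast
    then have "R \<in> span (\<Union>{lie_piece W Q F a b | a b. (a, b) \<noteq> (- 1, 0)})" using ZR(2) span_mono by blast
    then show "Z' \<in> lie_piece W Q F (- 1) 0 \<and> X - Z' \<in> span (\<Union>{lie_piece W Q F a b |a b. (a, b) \<noteq> (- 1, 0)})"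
      using ZR by simp
  next
    fix Y assume Y: "Y \<in> lie_piece W Q F (- 1) 0 \<and> X - Y \<in> span (\<Union>{lie_piece W Q F a b |a b. (a, b) \<noteq> (- 1, 0)})"
    let ?T = "\<lambda>p q. - {(p - 1, q)}"
    let ?M = "{X. \<forall>p q. \<forall>v\<in>J p q. X *v v \<in> piece_span J (?T p q)}"
    have "span (\<Union>{lie_piece W Q F a b |a b. (a, b) \<noteq> (- 1, 0)}) \<subseteq> ?M"
    proof (rule span_minimal[OF _ subspace_maps], rule subsetI)
      fix X assume "X \<in> \<Union>{lie_piece W Q F a b |a b. (a, b) \<noteq> (- 1, 0)}"
      then obtain a b where ab: "X \<in> lie_piece W Q F a b" "(a, b) \<noteq> (-1, 0)" by blast
      have "X *v v \<in> piece_span J (?T p q)" if "v \<in> J p q" for p q v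
        by (rule piece_in_piece_span[of _ J "p + a" "q + b"]) (use maps[OF ab(1) that] ab(2) in auto)
      then show "X \<in> ?M" by blast
    qed
    moreover have "span ?R \<subseteq> span (\<Union>{lie_piece W Q F a b |a b. (a, b) \<noteq> (- 1, 0)})" by (rule span_mono) blast
    ultimately have M: "X - Y \<in> ?M" "X - Z' \<in> ?M" using Y ZR by auto
    have "(X - Z') - (X - Y) \<in> ?M" by (rule subspace_diff[OF subspace_maps M(2,1)])
    then have M: "Y - Z' \<in> ?M" by simp
    show "Y = Z'"
    proof (rule matrix_eq_on_pieces[OF direct_sum_J])
      fix p q v assume v: "v \<in> J p q"
      have "Y *v v - Z' *v v \<in> J (p - 1) q"
        using maps[OF conjunct1[OF Y] v] maps[OF ZR(1) v] vec.subspace_diff[OF subspace_J] by simp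
      then have 1: "Y *v v - Z' *v v \<in> piece_span J {(p - 1, q)}" by (rule piece_in_piece_span) simp
      have "(Y - Z') *v v \<in> piece_span J (?T p q)" using M v by blast
      then have 2: "Y *v v - Z' *v v \<in> piece_span J (?T p q)" by (simp add: matrix_vector_mult_diff_rdistrib)
      have "Y *v v - Z' *v v = 0" by (rule piece_span_disjoint[OF direct_sum_J _ 1 2]) simp
      then show "Y *v v = Z' *v v" by simp
    qed
  qed
  moreover have "span ?R \<subseteq> {X. \<forall>p q. \<forall>v\<in>J p q. X *v v \<in> piece_span J {(a, b). a = p - 1 \<and> b \<noteq> q}}"
  proof (rule span_minimal[OF _ subspace_maps], clarify)
    fix X s p q v assume X: "X \<in> lie_piece W Q F (-1) s" "s \<noteq> 0" "v \<in> J p q"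
    show "X *v v \<in> piece_span J {(a, b). a = p - 1 \<and> b \<noteq> q}"
      by (rule piece_in_piece_span[of _ J "p + -1" "q + s"]) (use maps[OF X(1,3)] X(2) in auto)
  qed
  ultimately show "\<And>p q v. v \<in> J p q \<Longrightarrow> (X - Z) *v v \<in> piece_span J {(a, b). a = p - 1 \<and> b \<noteq> q}"
    using ZR by auto
  show "\<And>p q v. v \<in> J p q \<Longrightarrow> Z *v v \<in> J (p - 1) q" using maps[OF ZR(1)] \<open>Z = Z'\<close> by fastforce
  show "Z \<in> weight_preserving" using ZR(1) lie_piece_iff[of "-1" Z' 0] \<open>Z = Z'\<close>
    by (auto simp: weight_preserving_def infinitesimal_def)
qed

text \<open>Hence the period tangent has only one representative among the lowering endomorphisms.\<close>

lemma lowering_preserving_F: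
  assumes "X \<in> lowering" "\<And>p x. x \<in> F p \<Longrightarrow> X *v x \<in> F p" shows "X = 0"
proof (rule matrix_eq_on_pieces[OF direct_sum_J])
  fix p q v assume v: "v \<in> J p q"
  have 1: "X *v v \<in> piece_span J {(a, b). a < p}" using assms(1) v by (auto simp: lowering_def)
  have "X *v v \<in> F p" using assms(2) v J_sub_F by blast
  then have 2: "X *v v \<in> piece_span J {(a, b). a \<ge> p}" using F_eq by simp
  have "X *v v = 0" by (rule piece_span_disjoint[OF direct_sum_J _ 1 2]) auto
  then show "X *v v = 0 *v v" by (simp add: matrix_vector_mult_def vec_eq_iff)
qed

end

section \<open>Wirtinger calculus\<close>

text \<open>Every real-linear map of the complex plane has the form
  \<open>a * h + b * cnj h\<close>, so this is plain real differentiability with the two Wirtinger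
  derivatives as explicit data.\<close>

definition has_wirtinger :: "(complex \<Rightarrow> complex) \<Rightarrow> complex \<Rightarrow> complex \<Rightarrow> complex \<Rightarrow> bool" where
  "has_wirtinger g a b z \<longleftrightarrow> (g has_derivative (\<lambda>h. a * h + b * cnj h)) (at z)"

lemma has_wirtinger_imp:
  assumes "has_wirtinger g a b z" shows "wirtinger g z = a" "wirtinger_bar g z = b" "g differentiable (at z)"
proof -
  have "frechet_derivative g (at z) = (\<lambda>h. a * h + b * cnj h)"
    using frechet_derivative_at[OF assms[unfolded has_wirtinger_def]] by simp
  then show "wirtinger g z = a" "wirtinger_bar g z = b"
    by (simp_all add: wirtinger_def wirtinger_bar_def algebra_simps)
  show "g differentiable (at z)" using assms unfolding has_wirtinger_def differentiable_def by blast
qed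

lemma differentiable_has_wirtinger:
  assumes "g differentiable (at z)" shows "has_wirtinger g (wirtinger g z) (wirtinger_bar g z) z"
proof -
  let ?D = "frechet_derivative g (at z)"
  have D: "(g has_derivative ?D) (at z)" using assms by (simp add: frechet_derivative_works)
  then have lin: "linear ?D" by (rule has_derivative_linear)
  have "?D h = wirtinger g z * h + wirtinger_bar g z * cnj h" for h
  proof -
    have "?D h = ?D (Re h *\<^sub>R 1 + Im h *\<^sub>R \<i>)"
      by (rule arg_cong[of _ _ ?D]) (simp add: complex_eq_iff)
    also have "\<dots> = Re h *\<^sub>R ?D 1 + Im h *\<^sub>R ?D \<i>" by (simp add: linear_add[OF lin] linear_cmul[OF lin])
    also have "\<dots> = wirtinger g z * h + wirtinger_bar g z * cnj h"
      by (simp add: wirtinger_def wirtinger_bar_def complex_eq_iff algebra_simps add_divide_distrib diff_divide_distrib)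
    finally show ?thesis .
  qed
  then have "?D = (\<lambda>h. wirtinger g z * h + wirtinger_bar g z * cnj h)" by blast
  then show ?thesis using D by (simp add: has_wirtinger_def)
qed

lemma has_wirtinger_const: "has_wirtinger (\<lambda>_. c) 0 0 z"
  by (simp add: has_wirtinger_def)

lemma has_wirtinger_add:
  "has_wirtinger g a b z \<Longrightarrow> has_wirtinger k c d z \<Longrightarrow> has_wirtinger (\<lambda>w. g w + k w) (a + c) (b + d) z"
  unfolding has_wirtinger_def by (drule (1) has_derivative_add) (simp add: algebra_simps)

lemma has_wirtinger_mult:
  "has_wirtinger g a b z \<Longrightarrow> has_wirtinger k c d z \<Longrightarrow>
    has_wirtinger (\<lambda>w. g w * k w) (a * k z + g z * c) (b * k z + g z * d) z"
  unfolding has_wirtinger_def by (drule (1) has_derivative_mult) (simp add: algebra_simps)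

lemma has_wirtinger_cnj: "has_wirtinger g a b z \<Longrightarrow> has_wirtinger (\<lambda>w. cnj (g w)) (cnj b) (cnj a) z"
  unfolding has_wirtinger_def by (drule has_derivative_cnj) (simp add: algebra_simps)

lemma has_wirtinger_field: "(g has_field_derivative a) (at z) \<Longrightarrow> has_wirtinger g a 0 z"
  by (simp add: has_wirtinger_def has_field_derivative_def)

lemma has_wirtinger_inverse:
  assumes "has_wirtinger g a b z" "g z \<noteq> 0"
  shows "has_wirtinger (\<lambda>w. inverse (g w)) (- a * (inverse (g z))\<^sup>2) (- b * (inverse (g z))\<^sup>2) z"
  using Deriv.has_derivative_inverse[OF assms(2,1)[unfolded has_wirtinger_def]]
  by (simp add: has_wirtinger_def algebra_simps power2_eq_square)

lemma has_derivative_nhds_cong: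
  assumes "\<forall>\<^sub>F w in nhds z. g w = k w" "(g has_derivative D) (at z)" shows "(k has_derivative D) (at z)"
  by (rule has_derivative_transform_eventually[OF assms(2)])
     (use assms(1) eventually_nhds_x_imp_x[OF assms(1)] in \<open>auto simp: eventually_at_filter elim: eventually_mono\<close>)

lemma has_wirtinger_cong:
  "\<forall>\<^sub>F w in nhds z. g w = k w \<Longrightarrow> has_wirtinger g a b z \<Longrightarrow> has_wirtinger k a b z"
  unfolding has_wirtinger_def by (rule has_derivative_nhds_cong)

text \<open>Twice (real) differentiable functions, in a form closed under the ring operations.\<close>

definition wirtinger2 :: "(complex \<Rightarrow> complex) \<Rightarrow> complex \<Rightarrow> bool" where
  "wirtinger2 g z \<longleftrightarrow> (\<exists>g1 g2. (\<forall>\<^sub>F w in nhds z. has_wirtinger g (g1 w) (g2 w) w) \<and>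
     g1 differentiable (at z) \<and> g2 differentiable (at z))"

lemma wirtinger2I:
  "\<forall>\<^sub>F w in nhds z. has_wirtinger g (a w) (b w) w \<Longrightarrow> a differentiable (at z) \<Longrightarrow> b differentiable (at z)
    \<Longrightarrow> wirtinger2 g z"
  unfolding wirtinger2_def by blast

definition mixed :: "(complex \<Rightarrow> complex) \<Rightarrow> complex \<Rightarrow> complex" where
  "mixed g z = wirtinger (wirtinger_bar g) z"

lemma wirtinger2_imp:
  assumes "wirtinger2 g z"
  shows "\<forall>\<^sub>F w in nhds z. has_wirtinger g (wirtinger g w) (wirtinger_bar g w) w"
    "wirtinger g differentiable (at z)" "wirtinger_bar g differentiable (at z)" "g differentiable (at z)"
    "has_wirtinger g (wirtinger g z) (wirtinger_bar g z) z"
proof -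
  obtain g1 g2 where g: "\<forall>\<^sub>F w in nhds z. has_wirtinger g (g1 w) (g2 w) w"
    "g1 differentiable (at z)" "g2 differentiable (at z)" using assms by (auto simp: wirtinger2_def)
  have eq: "\<forall>\<^sub>F w in nhds z. g1 w = wirtinger g w" "\<forall>\<^sub>F w in nhds z. g2 w = wirtinger_bar g w"
    using g(1) by (auto elim!: eventually_mono simp: has_wirtinger_imp)
  show *: "\<forall>\<^sub>F w in nhds z. has_wirtinger g (wirtinger g w) (wirtinger_bar g w) w"
    using g(1) by (auto elim!: eventually_mono simp: has_wirtinger_imp)
  show "wirtinger g differentiable (at z)" "wirtinger_bar g differentiable (at z)"
    using g(2,3) has_derivative_nhds_cong[OF eq(1)] has_derivative_nhds_cong[OF eq(2)]
    unfolding differentiable_def by blast+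
  show "has_wirtinger g (wirtinger g z) (wirtinger_bar g z) z" by (rule eventually_nhds_x_imp_x[OF *])
  then show "g differentiable (at z)" by (rule has_wirtinger_imp)
qed

lemma mixed_eqI:
  assumes "\<forall>\<^sub>F w in nhds z. has_wirtinger g (g1 w) (g2 w) w" "has_wirtinger g2 a b z"
  shows "mixed g z = a"
proof -
  have "\<forall>\<^sub>F w in nhds z. g2 w = wirtinger_bar g w"
    using assms(1) by (auto elim!: eventually_mono simp: has_wirtinger_imp)
  then show ?thesis unfolding mixed_def using has_wirtinger_imp(1) has_wirtinger_cong assms(2) by blast
qed

lemma has_wirtinger_bar:
  assumes "wirtinger2 g z" shows "has_wirtinger (wirtinger_bar g) (mixed g z) (wirtinger_bar (wirtinger_bar g) z) z"
  unfolding mixed_def by (rule differentiable_has_wirtinger[OF wirtinger2_imp(3)[OF assms]])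

lemma wirtinger2_cong:
  assumes "\<forall>\<^sub>F w in nhds z. g w = k w" "wirtinger2 g z"
  shows "wirtinger2 k z" "mixed k z = mixed g z"
proof -
  \<comment> \<open>Second derivatives at \<open>z\<close> require equal first derivatives at all
    nearby points, hence agreement near each of these.\<close>
  have "\<forall>\<^sub>F w in nhds z. \<forall>\<^sub>F y in nhds w. g y = k y"
    using assms(1) by (simp only: eventually_eventually)
  then have ev: "\<forall>\<^sub>F w in nhds z. has_wirtinger k (wirtinger g w) (wirtinger_bar g w) w"
    using wirtinger2_imp(1)[OF assms(2)] by eventually_elim (rule has_wirtinger_cong)
  show "wirtinger2 k z" by (rule wirtinger2I[OF ev wirtinger2_imp(2,3)[OF assms(2)]])
  show "mixed k z = mixed g z" by (rule mixed_eqI[OF ev has_wirtinger_bar[OF assms(2)]])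
qed

lemma wirtinger2_const: "wirtinger2 (\<lambda>_. c) z"
  by (rule wirtinger2I[where a = "\<lambda>_. 0" and b = "\<lambda>_. 0"]) (simp_all add: has_wirtinger_const)

lemma wirtinger_const: "wirtinger (\<lambda>_. c) z = 0" "wirtinger_bar (\<lambda>_. c) z = 0" "mixed (\<lambda>_. c) z = 0"
  using has_wirtinger_imp[OF has_wirtinger_const]
    mixed_eqI[OF always_eventually[OF allI[OF has_wirtinger_const]] has_wirtinger_const] by auto

lemma wirtinger2_add:
  assumes "wirtinger2 g z" "wirtinger2 k z"
  shows "wirtinger2 (\<lambda>w. g w + k w) z" "mixed (\<lambda>w. g w + k w) z = mixed g z + mixed k z"
proof -
  have ev: "\<forall>\<^sub>F w in nhds z. has_wirtinger (\<lambda>w. g w + k w) (wirtinger g w + wirtinger k w) (wirtinger_bar g w + wirtinger_bar k w) w"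
    using eventually_conj[OF wirtinger2_imp(1)[OF assms(1)] wirtinger2_imp(1)[OF assms(2)]]
    by (auto elim!: eventually_mono intro: has_wirtinger_add)
  show "wirtinger2 (\<lambda>w. g w + k w) z"
    by (rule wirtinger2I[OF ev]; intro differentiable_add wirtinger2_imp assms)
  show "mixed (\<lambda>w. g w + k w) z = mixed g z + mixed k z"
    by (rule mixed_eqI[OF ev has_wirtinger_add[OF has_wirtinger_bar[OF assms(1)] has_wirtinger_bar[OF assms(2)]]])
qed

lemma wirtinger2_mult:
  assumes "wirtinger2 g z" "wirtinger2 k z"
  shows "wirtinger2 (\<lambda>w. g w * k w) z"
    "mixed (\<lambda>w. g w * k w) z = mixed g z * k z + wirtinger_bar g z * wirtinger k z
       + wirtinger g z * wirtinger_bar k z + g z * mixed k z"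
proof -
  have ev: "\<forall>\<^sub>F w in nhds z. has_wirtinger (\<lambda>w. g w * k w) (wirtinger g w * k w + g w * wirtinger k w)
      (wirtinger_bar g w * k w + g w * wirtinger_bar k w) w"
    using eventually_conj[OF wirtinger2_imp(1)[OF assms(1)] wirtinger2_imp(1)[OF assms(2)]]
    by (auto elim!: eventually_mono intro: has_wirtinger_mult)
  show "wirtinger2 (\<lambda>w. g w * k w) z"
    by (rule wirtinger2I[OF ev]; intro differentiable_add differentiable_mult wirtinger2_imp assms)
  have "mixed (\<lambda>w. g w * k w) z = (mixed g z * k z + wirtinger_bar g z * wirtinger k z)
       + (wirtinger g z * wirtinger_bar k z + g z * mixed k z)"
    by (rule mixed_eqI[OF ev has_wirtinger_add[OF
          has_wirtinger_mult[OF has_wirtinger_bar[OF assms(1)] wirtinger2_imp(5)[OF assms(2)]]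
          has_wirtinger_mult[OF wirtinger2_imp(5)[OF assms(1)] has_wirtinger_bar[OF assms(2)]]]])
  then show "mixed (\<lambda>w. g w * k w) z = mixed g z * k z + wirtinger_bar g z * wirtinger k z
       + wirtinger g z * wirtinger_bar k z + g z * mixed k z" by simp
qed

lemma wirtinger2_cnj:
  assumes "wirtinger2 g z" shows "wirtinger2 (\<lambda>w. cnj (g w)) z"
proof (rule wirtinger2I)
  show "\<forall>\<^sub>F w in nhds z. has_wirtinger (\<lambda>w. cnj (g w)) (cnj (wirtinger_bar g w)) (cnj (wirtinger g w)) w"
    using wirtinger2_imp(1)[OF assms] by (auto elim!: eventually_mono intro: has_wirtinger_cnj)
  show "(\<lambda>w. cnj (wirtinger_bar g w)) differentiable (at z)" "(\<lambda>w. cnj (wirtinger g w)) differentiable (at z)"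
    using wirtinger2_imp(2,3)[OF assms] unfolding differentiable_def by (auto intro: has_derivative_cnj)
qed

lemma wirtinger2_inverse:
  assumes "wirtinger2 g z" "g z \<noteq> 0" shows "wirtinger2 (\<lambda>w. inverse (g w)) z"
proof (rule wirtinger2I)
  note d = wirtinger2_imp[OF assms(1)]
  have "isCont g z" using d(4) by (rule differentiable_imp_continuous_within)
  then have "\<forall>\<^sub>F w in nhds z. g w \<noteq> 0"
    using assms(2) by (simp add: tendsto_imp_eventually_ne eventually_nhds_conv_at isCont_def)
  then show "\<forall>\<^sub>F w in nhds z. has_wirtinger (\<lambda>w. inverse (g w)) (- wirtinger g w * (inverse (g w))\<^sup>2)
      (- wirtinger_bar g w * (inverse (g w))\<^sup>2) w"
    using d(1) by eventually_elim (rule has_wirtinger_inverse)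
  show "(\<lambda>w. - wirtinger g w * (inverse (g w))\<^sup>2) differentiable (at z)"
    "(\<lambda>w. - wirtinger_bar g w * (inverse (g w))\<^sup>2) differentiable (at z)"
    by (intro differentiable_mult differentiable_minus differentiable_power differentiable_inverse d assms(2))+
qed

lemma wirtinger2_sum:
  assumes "\<And>i. i \<in> S \<Longrightarrow> wirtinger2 (g i) z"
  shows "wirtinger2 (\<lambda>w. \<Sum>i\<in>S. g i w) z" "mixed (\<lambda>w. \<Sum>i\<in>S. g i w) z = (\<Sum>i\<in>S. mixed (g i) z)"
proof -
  have "wirtinger2 (\<lambda>w. \<Sum>i\<in>S. g i w) z \<and> mixed (\<lambda>w. \<Sum>i\<in>S. g i w) z = (\<Sum>i\<in>S. mixed (g i) z)"
    using assms
    by (induction S rule: infinite_finite_induct) (auto simp: wirtinger_const wirtinger2_const wirtinger2_add)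
  then show "wirtinger2 (\<lambda>w. \<Sum>i\<in>S. g i w) z" "mixed (\<lambda>w. \<Sum>i\<in>S. g i w) z = (\<Sum>i\<in>S. mixed (g i) z)" by auto
qed

lemma wirtinger2_prod:
  assumes "\<And>i. i \<in> S \<Longrightarrow> wirtinger2 (g i) z" shows "wirtinger2 (\<lambda>w. \<Prod>i\<in>S. g i w) z"
  using assms by (induction S rule: infinite_finite_induct) (auto simp: wirtinger2_const wirtinger2_mult)

lemma wirtinger2_det:
  assumes "\<And>i j. wirtinger2 (\<lambda>w. A w $ i $ j) z" shows "wirtinger2 (\<lambda>w. det (A w)) z"
  unfolding det_def by (intro wirtinger2_sum wirtinger2_mult wirtinger2_const wirtinger2_prod assms)

lemma has_wirtinger_sum:
  assumes "\<And>i. i \<in> S \<Longrightarrow> has_wirtinger (g i) (a i) (b i) z"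
  shows "has_wirtinger (\<lambda>w. \<Sum>i\<in>S. g i w) (\<Sum>i\<in>S. a i) (\<Sum>i\<in>S. b i) z"
  using assms by (induction S rule: infinite_finite_induct) (auto simp: has_wirtinger_const has_wirtinger_add)

text \<open>For \<open>g\<close> the inner derivative \<open>wirtinger_bar\<close> is zero; for its
  conjugate it is the conjugate of \<open>deriv g\<close>, which is antiholomorphic and killed by
  \<open>wirtinger\<close>.\<close>

lemma holomorphic_wirtinger2:
  assumes "g holomorphic_on U" "open U" "z \<in> U"
  shows "wirtinger2 g z" "mixed g z = 0" "has_wirtinger g (deriv g z) 0 z"
    "mixed (\<lambda>w. cnj (g w)) z = 0"
proof -
  have U: "\<forall>\<^sub>F w in nhds z. w \<in> U" using assms(2,3) by (rule eventually_nhds_in_open)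
  have d: "has_wirtinger g (deriv g w) 0 w" if "w \<in> U" for w
    by (rule has_wirtinger_field) (use assms(1,2) that holomorphic_derivI in blast)
  then have ev: "\<forall>\<^sub>F w in nhds z. has_wirtinger g (deriv g w) 0 w" using U by (auto elim: eventually_mono)
  have "(deriv g has_field_derivative deriv (deriv g) z) (at z)"
    using holomorphic_derivI[OF holomorphic_deriv[OF assms(1,2)] assms(2,3)] .
  then have dd: "has_wirtinger (deriv g) (deriv (deriv g) z) 0 z" by (rule has_wirtinger_field)
  show "wirtinger2 g z" by (rule wirtinger2I[OF ev has_wirtinger_imp(3)[OF dd]]) simp
  show "mixed g z = 0" by (rule mixed_eqI[OF ev has_wirtinger_const])
  show "has_wirtinger g (deriv g z) 0 z" by (rule d[OF assms(3)])
  have "\<forall>\<^sub>F w in nhds z. has_wirtinger (\<lambda>w. cnj (g w)) (cnj 0) (cnj (deriv g w)) w"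
    using ev by eventually_elim (rule has_wirtinger_cnj)
  moreover have "has_wirtinger (\<lambda>w. cnj (deriv g w)) (cnj 0) (cnj (deriv (deriv g) z)) z" by (rule has_wirtinger_cnj[OF dd])
  ultimately have "mixed (\<lambda>w. cnj (g w)) z = cnj 0" by (rule mixed_eqI)
  then show "mixed (\<lambda>w. cnj (g w)) z = 0" by simp
qed

text \<open>The system \<open>M x = b\<close> has coefficients that are sums of a holomorphic and an antiholomorphic
  function, so \<open>\<partial>\<partial>\<^sup>-\<close> of \<open>x\<close> only involves products of first derivatives.\<close>

lemma harmonic_linear_system:
  fixes E :: "complex \<Rightarrow> complex ^ 'n ^ 'n::finite"
  assumes E: "holomorphic_mat_on E U" "open U" "0 \<in> U" "E 0 = mat 1"
    and ABC: "A + B + C = mat 1"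
    and v: "A *v (v - conjv v) = 0" "B *v (v - conjv v) = 0"
  defines "M \<equiv> \<lambda>s. E s ** A + conjm (E s) ** B + C"
    and "b \<equiv> \<lambda>s. E s *v v - conjm (E s) *v conjv v"
    and "G \<equiv> deriv_mat E 0"
  obtains x where "\<forall>\<^sub>F s in nhds 0. det (M s) \<noteq> 0 \<and> M s *v x s = b s" "\<And>i. wirtinger2 (\<lambda>s. x s $ i) 0"
    "(\<chi> i. mixed (\<lambda>s. x s $ i) 0) = G *v (A *v (conjm G *v conjv v)) - conjm G *v (B *v (G *v v))"
proof -
  have hol: "(\<lambda>s. E s $ i $ j) holomorphic_on U" for i j using E(1) by (simp add: holomorphic_mat_on_def)
  note w2E = holomorphic_wirtinger2(1)[OF hol E(2,3)]
  have hwE: "has_wirtinger (\<lambda>s. E s $ i $ j) (G $ i $ j) 0 0" for i j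
    using holomorphic_wirtinger2(3)[OF hol E(2,3), of i j] by (simp add: G_def deriv_mat_def)
  have hwcE: "has_wirtinger (\<lambda>s. cnj (E s $ i $ j)) 0 (conjm G $ i $ j) 0" for i j
    using has_wirtinger_cnj[OF hwE, of i j] by (simp add: conjm_def)
  have M: "M s $ i $ j = (\<Sum>k\<in>UNIV. E s $ i $ k * A $ k $ j) + (\<Sum>k\<in>UNIV. cnj (E s $ i $ k) * B $ k $ j) + C $ i $ j" for s i j
    by (simp add: M_def matrix_matrix_mult_def conjm_def)
  define u where "u = - conjv v"
  have b: "b s $ i = (\<Sum>k\<in>UNIV. E s $ i $ k * v $ k) + (\<Sum>k\<in>UNIV. cnj (E s $ i $ k) * u $ k)" for s i
    by (simp add: b_def u_def matrix_vector_mult_def conjm_def sum_negf)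
  note w2 = wirtinger2_add wirtinger2_sum wirtinger2_mult wirtinger2_const wirtinger2_cnj w2E
  have w2M: "wirtinger2 (\<lambda>s. M s $ i $ j) 0" for i j unfolding M by (intro w2)
  have w2b: "wirtinger2 (\<lambda>s. b s $ i) 0" for i unfolding b by (intro w2)
  have mM: "mixed (\<lambda>s. M s $ i $ j) 0 = 0" for i j unfolding M
    by (simp add: w2 wirtinger_const holomorphic_wirtinger2(2,4)[OF hol E(2,3)])
  have mb: "mixed (\<lambda>s. b s $ i) 0 = 0" for i unfolding b
    by (simp add: w2 wirtinger_const holomorphic_wirtinger2(2,4)[OF hol E(2,3)])
  have hM: "has_wirtinger (\<lambda>s. M s $ i $ j) ((G ** A) $ i $ j) ((conjm G ** B) $ i $ j) 0" for i j
  proof -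
    have "has_wirtinger (\<lambda>s. M s $ i $ j)
      ((\<Sum>k\<in>UNIV. G $ i $ k * A $ k $ j + E 0 $ i $ k * 0) + (\<Sum>k\<in>UNIV. 0 * B $ k $ j + cnj (E 0 $ i $ k) * 0) + 0)
      ((\<Sum>k\<in>UNIV. 0 * A $ k $ j + E 0 $ i $ k * 0) + (\<Sum>k\<in>UNIV. conjm G $ i $ k * B $ k $ j + cnj (E 0 $ i $ k) * 0) + 0) 0"
      unfolding M by (intro has_wirtinger_add has_wirtinger_sum has_wirtinger_mult hwE hwcE has_wirtinger_const)
    then show ?thesis by (simp add: matrix_matrix_mult_def)
  qed
  have hb: "has_wirtinger (\<lambda>s. b s $ i) ((G *v v) $ i) (- (conjm G *v conjv v) $ i) 0" for i
  proof -
    have "has_wirtinger (\<lambda>s. b s $ i)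
      ((\<Sum>k\<in>UNIV. G $ i $ k * v $ k + E 0 $ i $ k * 0) + (\<Sum>k\<in>UNIV. 0 * u $ k + cnj (E 0 $ i $ k) * 0))
      ((\<Sum>k\<in>UNIV. 0 * v $ k + E 0 $ i $ k * 0) + (\<Sum>k\<in>UNIV. conjm G $ i $ k * u $ k + cnj (E 0 $ i $ k) * 0)) 0"
      unfolding b by (intro has_wirtinger_add has_wirtinger_sum has_wirtinger_mult hwE hwcE has_wirtinger_const)
    then show ?thesis by (simp add: matrix_vector_mult_def sum_negf u_def)
  qed
  have c1: "conjm (mat 1) = (mat 1 :: complex ^ 'n ^ 'n)" by (simp add: conjm_def mat_def vec_eq_iff)
  have M0: "M 0 = mat 1" using ABC by (simp add: M_def E(4) c1)
  have b0: "b 0 = v - conjv v" by (simp add: b_def E(4) c1)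
  \<comment> \<open>Cramer's rule exhibits the solution as a quotient of polynomials in the
    coefficients, so it inherits two derivatives.\<close>
  define x where "x s = (\<chi> k. det (\<chi> i j. if j = k then b s $ i else M s $ i $ j) / det (M s))" for s
  have w2d: "wirtinger2 (\<lambda>s. det (M s)) 0" by (intro wirtinger2_det w2M)
  have w2x: "wirtinger2 (\<lambda>s. x s $ k) 0" for k
  proof -
    have "wirtinger2 (\<lambda>s. (\<chi> i j. if j = k then b s $ i else M s $ i $ j) $ i $ j) 0" for i j
      by (cases "j = k") (simp_all add: w2M w2b)
    then have "wirtinger2 (\<lambda>s. det (\<chi> i j. if j = k then b s $ i else M s $ i $ j) * inverse (det (M s))) 0"
      by (intro wirtinger2_mult wirtinger2_inverse wirtinger2_det w2M) (auto simp: M0)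
    then show ?thesis by (simp add: x_def divide_inverse)
  qed
  have "isCont (\<lambda>s. det (M s)) 0" by (rule differentiable_imp_continuous_within[OF wirtinger2_imp(4)[OF w2d]])
  then have "\<forall>\<^sub>F s in nhds 0. det (M s) \<noteq> 0"
    by (simp add: tendsto_imp_eventually_ne eventually_nhds_conv_at isCont_def M0)
  then have Mx: "\<forall>\<^sub>F s in nhds 0. det (M s) \<noteq> 0 \<and> M s *v x s = b s"
    by eventually_elim (auto simp: x_def cramer)
  \<comment> \<open>This initial value is killed by \<open>A\<close> and \<open>B\<close>, so the
    derivatives of \<open>M\<close> drop out of the first-order equations.\<close>
  then have Mx0: "x 0 = v - conjv v" using eventually_nhds_x_imp_x[OF Mx] by (simp add: M0 b0)
  have ev: "\<forall>\<^sub>F s in nhds 0. (\<Sum>j\<in>UNIV. M s $ i $ j * x s $ j) = b s $ i" for i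
    using Mx by eventually_elim (auto simp: matrix_vector_mult_def vec_eq_iff)
  define x1 x2 x12 where "x1 = (\<chi> i. wirtinger (\<lambda>s. x s $ i) 0)" and "x2 = (\<chi> i. wirtinger_bar (\<lambda>s. x s $ i) 0)"
    and "x12 = (\<chi> i. mixed (\<lambda>s. x s $ i) 0)"
  have hx: "has_wirtinger (\<lambda>s. x s $ j) (x1 $ j) (x2 $ j) 0" for j
    using wirtinger2_imp(5)[OF w2x, of j] by (simp add: x1_def x2_def)
  have h: "has_wirtinger (\<lambda>s. b s $ i) (\<Sum>j\<in>UNIV. (G ** A) $ i $ j * x 0 $ j + M 0 $ i $ j * x1 $ j)
      (\<Sum>j\<in>UNIV. (conjm G ** B) $ i $ j * x 0 $ j + M 0 $ i $ j * x2 $ j) 0" for i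
    by (rule has_wirtinger_cong[OF ev has_wirtinger_sum]) (rule has_wirtinger_mult[OF hM hx])
  have "G *v v = (G ** A) *v x 0 + M 0 *v x1"
    using has_wirtinger_imp(1)[OF hb] has_wirtinger_imp(1)[OF h]
    by (simp add: vec_eq_iff matrix_vector_mult_def sum.distrib)
  then have x1: "x1 = G *v v" by (simp add: M0 Mx0 v flip: matrix_vector_mul_assoc)
  have "- (conjm G *v conjv v) = (conjm G ** B) *v x 0 + M 0 *v x2"
    using has_wirtinger_imp(2)[OF hb] has_wirtinger_imp(2)[OF h]
    by (simp add: vec_eq_iff matrix_vector_mult_def sum.distrib)
  then have x2: "x2 = - (conjm G *v conjv v)" by (simp add: M0 Mx0 v flip: matrix_vector_mul_assoc)
  \<comment> \<open>The Leibniz rule for the mixed derivative of \<open>M x = b\<close>: those of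
    \<open>M\<close> and \<open>b\<close> vanish, leaving two cross terms and the mixed derivative
    of \<open>x\<close>.\<close>
  have "0 = (\<Sum>j\<in>UNIV. (conjm G ** B) $ i $ j * x1 $ j + (G ** A) $ i $ j * x2 $ j + M 0 $ i $ j * x12 $ j)" for i
  proof -
    have "wirtinger2 (\<lambda>s. \<Sum>j\<in>UNIV. M s $ i $ j * x s $ j) 0" by (intro w2 w2M w2x)
    then have "0 = mixed (\<lambda>s. \<Sum>j\<in>UNIV. M s $ i $ j * x s $ j) 0"
      using wirtinger2_cong(2)[OF ev[of i]] mb[of i] by simp
    then show ?thesis
      by (simp add: wirtinger2_sum wirtinger2_mult w2M w2x mM has_wirtinger_imp[OF hM] x1_def x2_def x12_def)
  qed
  then have "0 = (conjm G ** B) *v x1 + (G ** A) *v x2 + M 0 *v x12"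
    by (simp add: vec_eq_iff matrix_vector_mult_def sum.distrib)
  then have "x12 = - ((conjm G ** B) *v x1) - (G ** A) *v x2" by (simp add: M0 algebra_simps eq_neg_iff_add_eq_0)
  also have "\<dots> = G *v (A *v (conjm G *v conjv v)) - conjm G *v (B *v (G *v v))"
  proof -
    have "X *v (- y) = - (X *v y)" for X :: "complex ^ 'n ^ 'n" and y
      by (simp add: matrix_vector_mult_def vec_eq_iff sum_negf)
    then show ?thesis by (simp add: x1 x2 flip: matrix_vector_mul_assoc)
  qed
  finally show ?thesis using that[OF Mx w2x] by (simp add: x12_def)
qed

section \<open>Transport of the bigrading\<close>

context biext
begin

text \<open>The generator lifts a real vector and is real modulo \<open>W (-2)\<close>. With
  \<open>w\<close> the correction from \<open>J_00\<close>, the vector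
  \<open>a = v - conjv (v - w)\<close> lies in \<open>F 0 \<inter> W (-1)\<close> and is congruent
  to \<open>- conjv a\<close>, so opposedness puts it into \<open>W (-2)\<close>.\<close>

lemma J_00_conj: assumes "v \<in> J 0 0" "v - e \<in> W (-1)" shows "v - conjv v \<in> W (-2)"
proof -
  obtain w where w: "w \<in> W (-2)" "conjv (v - w) \<in> F 0" using assms J_00 by blast
  have w': "conjv w \<in> W (-2)" using w by (simp add: conjv_W)
  have W12: "x \<in> W (-1)" if "x \<in> W (-2)" for x using W_mono[of "-2" "-1"] that by auto
  define a where "a = v - conjv v + conjv w"
  have "conjv (v - e) \<in> W (-1)" using assms(2) by (simp add: conjv_W)
  then have "(v - e) - conjv (v - e) \<in> W (-1)" by (rule vec.subspace_diff[OF subspace_W assms(2)])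
  then have d: "v - conjv v \<in> W (-1)" by (simp add: conjv_diff conjv_e)
  have "a = v - conjv (v - w)" by (simp add: a_def conjv_diff)
  then have aF: "a \<in> F 0" using assms(1) w(2) J_00 vec.subspace_diff[OF subspace_F] by metis
  have aW: "a \<in> W (-1)" unfolding a_def by (rule vec.subspace_add[OF subspace_W d W12[OF w']])
  have "a \<in> W (-2)"
  proof (rule gr_m1_inter(1)[OF aF aW])
    show "conjv (- conjv a) \<in> F (- 0)" using vec.subspace_neg[OF subspace_F aF] by (simp add: conjv_minus)
    show "- conjv a \<in> W (-1)" using vec.subspace_neg[OF subspace_W] aW by (simp add: conjv_W)
    have "a - - conjv a = w + conjv w" by (simp add: a_def conjv_diff conjv_add)
    then show "a - - conjv a \<in> W (-2)" using vec.subspace_add[OF subspace_W w(1) w'] by simp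
  qed
  then have "a - conjv w \<in> W (-2)" using w' by (rule vec.subspace_diff[OF subspace_W])
  then show ?thesis by (simp add: a_def)
qed

text \<open>The image is \<open>F 0 \<inter> W (-1)\<close>. Since \<open>a \<ge> 0\<close> means
  \<open>b \<le> -1\<close> on the line \<open>a + b = -1\<close>, conjugation exchanges this image
  with that of \<open>proj_K'\<close>.\<close>

definition proj_K :: "complex ^ 'n ^ 'n" where "proj_K = piece_proj J {(a, b). a \<ge> 0 \<and> a + b = -1}"
definition proj_K' :: "complex ^ 'n ^ 'n" where "proj_K' = piece_proj J {(a, b). a \<le> -1 \<and> a + b = -1}"
definition proj_f :: "complex ^ 'n ^ 'n" where "proj_f = piece_proj J {(-1, -1)}"
definition proj_v :: "complex ^ 'n ^ 'n" where "proj_v = piece_proj J {(0, 0)}"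

lemmas proj_J = piece_proj_J[of _ _ _ "{(a, b). a \<ge> 0 \<and> a + b = -1}", folded proj_K_def]
  piece_proj_J[of _ _ _ "{(a, b). a \<le> -1 \<and> a + b = -1}", folded proj_K'_def]
  piece_proj_J[of _ _ _ "{(-1, -1)}", folded proj_f_def]
  piece_proj_J[of _ _ _ "{(0, 0)}", folded proj_v_def]

lemma proj_sum: "proj_K + proj_K' + (proj_v + proj_f) = mat 1"
proof (rule matrix_eq_on_pieces[OF direct_sum_J])
  fix p q v assume v: "v \<in> J p q"
  consider "p + q = -1" | "p = 0" "q = 0" | "p = -1" "q = -1" | "v = 0" using J_trivial[of p q] v by force
  then show "(proj_K + proj_K' + (proj_v + proj_f)) *v v = mat 1 *v v"
  proof cases
    case 1
    then have "\<not> (p = 0 \<and> q = 0)" "\<not> (p = -1 \<and> q = -1)" "p \<ge> 0 \<longleftrightarrow> \<not> p \<le> -1" by auto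
    then show ?thesis using 1 by (auto simp: matrix_vector_mult_add_rdistrib proj_J[OF v])
  qed (auto simp: matrix_vector_mult_add_rdistrib proj_J[OF v])
qed

lemma proj_W_m2: assumes "w \<in> W (-2)" shows "proj_K *v w = 0" "proj_K' *v w = 0" "proj_f *v w = w" "proj_v *v w = 0"
  using assms J_m1m1 proj_J[of w "-1" "-1"] by simp_all

text \<open>Only the components of types \<open>(-1, 0)\<close> and \<open>(0, -1)\<close> of \<open>X v\<close> and its conjugate contribute.\<close>

lemma proj_f_commutator:
  assumes X: "X \<in> horizontal_part W Q F" and v: "v \<in> J 0 0" "v - e \<in> W (-1)"
  defines "Z \<equiv> hodge_component W Q F (-1) 0 X"
  shows "proj_f *v (X *v (proj_K *v (conjm X *v conjv v)) - conjm X *v (proj_K' *v (X *v v)))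
    = commutator Z (conjm Z) *v e"
    and "commutator Z (conjm Z) *v e \<in> W (-2)"
proof -
  note Z = horizontal_decomposition[OF X, folded Z_def]
  define R where "R = X - Z"
  have XR: "X *v y = Z *v y + R *v y" for y by (simp add: R_def matrix_vector_mult_diff_rdistrib)
  have R: "R *v y \<in> piece_span J {(a, b). a = p - 1 \<and> b \<noteq> q}" if "y \<in> J p q" for p q y
    using Z(3)[OF that] by (simp add: R_def)
  define z where "z = Z *v v"
  have z: "z \<in> J (-1) 0" using Z(1)[OF v(1)] by (simp add: z_def)
  then have cz: "conjv z \<in> J 0 (-1)" by (simp add: conjv_J_line)
  \<comment> \<open>Among the types \<open>(-1, b)\<close> only \<open>b = 0\<close> and
    \<open>b = -1\<close> carry nonzero pieces, so \<open>X *v v\<close> has no other component in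
    weight \<open>-1\<close>.\<close>
  have "piece_span J {(a, b). a = 0 - 1 \<and> b \<noteq> 0} \<subseteq> W (-2)"
  proof (rule piece_span_minimal[OF subspace_W], clarsimp)
    fix b x assume "b \<noteq> (0::int)" "x \<in> J (-1) b"
    then show "x \<in> W (-2)" using J_trivial[of "-1" b] J_m1m1 vec.subspace_0[OF subspace_W] by (cases "b = -1") auto
  qed
  then have Rv: "R *v v \<in> W (-2)" using R[OF v(1)] by auto
  have XK': "proj_K' *v (X *v v) = z"
    using proj_J(2)[OF z] proj_W_m2(2)[OF Rv] by (simp add: XR matrix_vector_right_distrib flip: z_def)
  have "conjm X *v conjv v = conjv z + conjv (R *v v)" by (simp add: conjm_mult_vec XR conjv_add z_def)
  then have XK: "proj_K *v (conjm X *v conjv v) = conjv z"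
    using proj_J(1)[OF cz] proj_W_m2(1)[of "conjv (R *v v)"] Rv by (simp add: matrix_vector_right_distrib conjv_W)
  have Zcz: "Z *v conjv z \<in> W (-2)" using Z(1)[OF cz] J_m1m1 by simp
  \<comment> \<open>The same two types occur here, and \<open>proj_f\<close> removes the remaining
    one.\<close>
  have "piece_span J {(a, b). a = 0 - 1 \<and> b \<noteq> - 1} \<subseteq> J (-1) 0"
  proof (rule piece_span_minimal[OF subspace_J], clarsimp)
    fix b x assume "b \<noteq> (-1::int)" "x \<in> J (-1) b"
    then show "x \<in> J (-1) 0" using J_trivial[of "-1" b] vec.subspace_0[OF subspace_J] by (cases "b = 0") auto
  qed
  then have Rcz: "R *v conjv z \<in> J (-1) 0" using R[OF cz] by auto
  then have cRcz: "conjv (R *v conjv z) \<in> J 0 (-1)" by (simp add: conjv_J_line)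
  have "proj_f *v (X *v conjv z) = Z *v conjv z"
    using proj_W_m2(3)[OF Zcz] proj_J(3)[OF Rcz] by (simp add: XR matrix_vector_right_distrib)
  moreover have "proj_f *v conjv (X *v conjv z) = conjv (Z *v conjv z)"
    using proj_W_m2(3)[of "conjv (Z *v conjv z)"] Zcz proj_J(3)[OF cRcz]
    by (simp add: XR conjv_add matrix_vector_right_distrib conjv_W)
  ultimately have L: "proj_f *v (X *v (proj_K *v (conjm X *v conjv v)) - conjm X *v (proj_K' *v (X *v v)))
      = Z *v conjv z - conjv (Z *v conjv z)"
    unfolding XK XK' by (simp add: conjm_mult_vec matrix_vector_mult_diff_distrib)
  \<comment> \<open>Type \<open>(-1, 0)\<close> lowers the weight by one. Hence \<open>Z\<close>
    takes \<open>v\<close> and \<open>e\<close> to vectors congruent modulo \<open>W (-2)\<close>,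
    where \<open>Z\<close> vanishes, and the commutator can be evaluated on \<open>e\<close> instead
    of \<open>v\<close>.\<close>
  have ZW: "Z *v y \<in> W (k - 1)" if "y \<in> W k" for y k
  proof -
    have "Z *v y \<in> piece_span J {(a, b). a + b \<le> k - 1}"
    proof (rule piece_span_map[OF _ that[unfolded W_eq[of k]]])
      fix a b x assume ab: "(a, b) \<in> {(a, b). a + b \<le> k}" "x \<in> J a b"
      show "Z *v x \<in> piece_span J {(a, b). a + b \<le> k - 1}"
        by (rule piece_in_piece_span[of _ J "a - 1" b, OF Z(1)[OF ab(2)]]) (use ab(1) in auto)
    qed
    then show ?thesis using W_eq[of "k - 1"] by simp
  qed
  have Z2: "Z *v w = 0" if "w \<in> W (-2)" for w using ZW[OF that] W_le[of "-3"] by simp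
  have Ze: "z - Z *v e \<in> W (-2)" using ZW[OF v(2)] by (simp add: z_def matrix_vector_mult_diff_distrib)
  have "conjv (z - Z *v e) \<in> W (-2)" using Ze by (simp add: conjv_W)
  then have "Z *v conjv (Z *v e) = Z *v conjv z"
    using Z2[of "conjv (z - Z *v e)"] by (simp add: conjv_diff matrix_vector_mult_diff_distrib)
  then have comm: "commutator Z (conjm Z) *v e = Z *v conjv z - conjv (Z *v conjv z)"
    by (simp add: commutator_def matrix_vector_mult_diff_rdistrib conjm_mult_vec conjv_e flip: matrix_vector_mul_assoc)
  then show "proj_f *v (X *v (proj_K *v (conjm X *v conjv v)) - conjm X *v (proj_K' *v (X *v v)))
    = commutator Z (conjm Z) *v e" using L by simp
  show "commutator Z (conjm Z) *v e \<in> W (-2)"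
    unfolding comm using Zcz by (intro vec.subspace_diff[OF subspace_W]) (simp_all add: conjv_W)
qed

text \<open>Every term of the series after the first is a power of \<open>X\<close> applied to
  \<open>X *v x\<close>, so it is enough that \<open>X *v x\<close> lies in
  \<open>S\<close>.\<close>

lemma exp_minus_id_in_subspace:
  fixes X :: "complex ^ 'n ^ 'n"
  assumes N: "matpow X N = 0" "N \<ge> 2" and S: "vec.subspace S" "\<And>y. y \<in> S \<Longrightarrow> X *v y \<in> S" "X *v x \<in> S"
  shows "matrix_exp X *v x - x \<in> S"
proof -
  obtain M where M: "N = Suc M" using N(2) by (cases N) auto
  have "matpow X k *v y \<in> S" if "y \<in> S" for k y
    using that by (induction k) (auto simp: matpow_Suc S(2) simp flip: matrix_vector_mul_assoc)
  moreover have "matpow X (Suc k) *v x = matpow X k *v (X *v x)" for k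
    using matpow_add[of X k 1] by (simp add: matpow_Suc[of X 0, simplified] matrix_vector_mul_assoc)
  ultimately have *: "matpow X (Suc k) *v x \<in> S" for k using S(3) by simp
  have "matrix_exp X *v x = (\<Sum>k<N. (1 / fact k) *\<^sub>R (matpow X k *v x))"
    using matrix_exp_vector[OF N(1), of 1 x] by simp
  also have "\<dots> = x + (\<Sum>k<M. (1 / fact (Suc k)) *\<^sub>R (matpow X (Suc k) *v x))"
    unfolding M by (subst sum.lessThan_Suc_shift) simp
  finally have "matrix_exp X *v x - x = (\<Sum>k<M. (1 / fact (Suc k)) *\<^sub>R (matpow X (Suc k) *v x))" by simp
  also have "\<dots> \<in> S"
    unfolding scaleR_eq_scale by (intro vec.subspace_sum[OF S(1)] vec.subspace_scale[OF S(1)] *)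
  finally show ?thesis .
qed

lemma exp_lowering:
  assumes X: "X \<in> lowering \<inter> weight_preserving"
  shows "matrix_exp X *v f = f" "\<And>x k. x \<in> W k \<Longrightarrow> matrix_exp X *v x \<in> W k"
    "\<And>v. v \<in> J 0 0 \<Longrightarrow> matrix_exp X *v v - v \<in> W (-1)"
proof -
  obtain N where N: "N \<ge> 2" "\<And>X. X \<in> lowering \<Longrightarrow> matpow X N = 0" by (rule lowering_nilpotent) blast
  have N0: "matpow X N = 0" using X N(2) by blast
  note * = exp_minus_id_in_subspace[OF N0 N(1)]
  have "matrix_exp X *v f - f \<in> {0}" by (rule *) (simp_all add: lowering_f[OF X] vec.subspace_single_0)
  then show "matrix_exp X *v f = f" by simp
  show "matrix_exp X *v x \<in> W k" if "x \<in> W k" for x k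
  proof -
    have "matrix_exp X *v x - x \<in> W k" by (rule *[OF subspace_W lowering_W[OF X] lowering_W[OF X that]])
    then have "(matrix_exp X *v x - x) + x \<in> W k" using that by (rule vec.subspace_add[OF subspace_W])
    then show ?thesis by simp
  qed
  show "matrix_exp X *v v - v \<in> W (-1)" if "v \<in> J 0 0" for v
    by (rule *[OF subspace_W lowering_W[OF X] lowering_J_00]) (use X that in auto)
qed

text \<open>The solution \<open>x\<close> of the linear system splits as \<open>k - conjv k + c f\<close> with \<open>k\<close> in \<open>F\<^sup>0 \<inter> W (-1)\<close>. Subtracting
  \<open>E k\<close> moves \<open>E v\<close> to the generator of \<open>I\<^sup>0\<^sup>,\<^sup>0\<close> of the filtration \<open>E F\<close>.\<close>

lemma transported_generator:
  assumes G: "G \<in> lowering \<inter> weight_preserving" and v: "v \<in> J 0 0" "v - e \<in> W (-1)"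
  defines "E \<equiv> matrix_exp G"
  defines "M \<equiv> E ** proj_K + conjm E ** proj_K' + (proj_v + proj_f)"
  assumes x: "det M \<noteq> 0" "M *v x = E *v v - conjm E *v conjv v"
  obtains y where "y \<in> F 0" "E *v y - e \<in> W (-1)" "E *v y - conjv (E *v y) = proj_f *v x"
proof -
  note exp = exp_lowering[OF G, folded E_def]
  have cE: "conjm E *v y = conjv (E *v conjv y)" for y by (rule conjm_mult_vec)
  have M: "M *v y = E *v (proj_K *v y) + conjv (E *v conjv (proj_K' *v y)) + proj_v *v y + proj_f *v y" for y
    by (simp add: M_def matrix_vector_mult_add_rdistrib cE add.assoc flip: matrix_vector_mul_assoc)
  have W12: "w \<in> W (-1)" if "w \<in> W (-2)" for w using W_mono[of "-2" "-1"] that by auto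
  define k k' w u where "k = proj_K *v x" and "k' = proj_K' *v x" and "w = proj_f *v x" and "u = proj_v *v x"
  let ?TK = "{(a, b). a \<ge> 0 \<and> a + b = (-1::int)}" and ?TK' = "{(a, b). a \<le> -1 \<and> a + b = (-1::int)}"
  have k: "k \<in> piece_span J ?TK" unfolding k_def proj_K_def by (rule piece_proj_in[OF direct_sum_J])
  have k': "k' \<in> piece_span J ?TK'" unfolding k'_def proj_K'_def by (rule piece_proj_in[OF direct_sum_J])
  have w: "w \<in> W (-2)" using piece_proj_in[OF direct_sum_J, of "{(-1, -1)}" x] J_m1m1 piece_span_single
    by (simp add: w_def proj_f_def)
  have u: "u \<in> J 0 0" using piece_proj_in[OF direct_sum_J, of "{(0, 0)}" x] piece_span_single
    by (simp add: u_def proj_v_def)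
  have spW: "piece_span J T \<subseteq> W (-1)" if "T \<subseteq> {(a, b). a + b = (-1::int)}" for T
  proof (rule piece_span_minimal[OF subspace_W])
    fix a b assume "(a, b) \<in> T"
    then have "(a, b) \<noteq> (0, 0)" using that by auto
    then show "J a b \<subseteq> W (-1)" by (rule J_sub_W_m1)
  qed
  have kW: "k \<in> W (-1)" "k' \<in> W (-1)" using k k' spW[of ?TK] spW[of ?TK'] by auto
  have conj_span: "conjv y \<in> piece_span J {(a, b). (b, a) \<in> T}" if "y \<in> piece_span J T" "T \<subseteq> {(a, b). a + b = -1}" for y T
  proof -
    have "piece_span J T \<subseteq> conjv ` piece_span J {(a, b). (b, a) \<in> T}"
    proof (rule piece_span_minimal[OF subspace_conjv_image[OF subspace_piece_span]], rule subsetI)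
      fix a b z assume ab: "(a, b) \<in> T" "z \<in> J a b"
      then have "conjv z \<in> J b a" using that(2) by (auto simp: conjv_J_line)
      then have "conjv z \<in> piece_span J {(a, b). (b, a) \<in> T}" by (rule piece_in_piece_span) (use ab in simp)
      then show "z \<in> conjv ` piece_span J {(a, b). (b, a) \<in> T}" by (simp add: in_conjv_image)
    qed
    then show ?thesis using that(1) by (auto simp: in_conjv_image)
  qed
  have "conjv k \<in> piece_span J {(a, b). (b, a) \<in> ?TK}" by (rule conj_span[OF k]) auto
  then have ck: "conjv k \<in> piece_span J ?TK'" by (rule piece_span_weaken[rotated]) auto
  have "conjv k' \<in> piece_span J {(a, b). (b, a) \<in> ?TK'}" by (rule conj_span[OF k']) auto
  then have ck': "conjv k' \<in> piece_span J ?TK" by (rule piece_span_weaken[rotated]) auto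
  have cw: "conjv w \<in> W (-2)" using w by (simp add: conjv_W)
  have Eve: "E *v v - e \<in> W (-1)"
    using vec.subspace_add[OF subspace_W exp(3)[OF v(1)] v(2)] by simp
  define b where "b = E *v v - conjv (E *v v)"
  have b: "M *v x = b" using x(2) by (simp add: b_def cE)
  have bW: "b \<in> W (-1)"
  proof -
    have "conjv (E *v v - e) \<in> W (-1)" using Eve by (simp add: conjv_W)
    then have "(E *v v - e) - conjv (E *v v - e) \<in> W (-1)" by (rule vec.subspace_diff[OF subspace_W Eve])
    then show ?thesis by (simp add: b_def conjv_diff conjv_e)
  qed
  have Mx: "b = E *v k + conjv (E *v conjv k') + u + w" using M[of x] b by (simp add: k_def k'_def w_def u_def)
  \<comment> \<open>All other terms of the equation lie in \<open>W (-1)\<close>, while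
    \<open>u\<close> has type \<open>(0, 0)\<close>.\<close>
  have "u = b - E *v k - conjv (E *v conjv k') - w" using Mx by simp
  also have "\<dots> \<in> W (-1)"
  proof (intro vec.subspace_diff[OF subspace_W] bW W12[OF w])
    show "E *v k \<in> W (-1)" by (rule exp(2)[OF kW(1)])
    show "conjv (E *v conjv k') \<in> W (-1)" using kW(2) exp(2)[of "conjv k'" "-1"] by (simp add: conjv_W)
  qed
  finally have u0: "u = 0" using J_00_W_m1[OF u] by simp
  \<comment> \<open>Since \<open>u = 0\<close>, this is \<open>- conjv x\<close> in components. As
    \<open>b\<close> is the negative of its conjugate, \<open>y\<close> solves the same system;
    invertibility gives \<open>y = x\<close>, and the \<open>proj_K\<close> components yield
    \<open>k' = - conjv k\<close>.\<close>
  define y where "y = - (conjv k' + conjv k + conjv w)"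
  have neg: "A *v (- a) = - (A *v a)" for A :: "complex ^ 'n ^ 'n" and a
    by (simp add: matrix_vector_mult_def vec_eq_iff sum_negf)
  note P = piece_proj_id[OF direct_sum_J] and P0 = piece_proj_0[OF direct_sum_J]
  have "proj_K *v conjv k' = conjv k'" "proj_K *v conjv k = 0" "proj_K' *v conjv k' = 0" "proj_K' *v conjv k = conjv k"
    "proj_v *v conjv k' = 0" "proj_v *v conjv k = 0" "proj_f *v conjv k' = 0" "proj_f *v conjv k = 0"
    unfolding proj_K_def proj_K'_def proj_v_def proj_f_def
    by (rule P[OF ck'] P[OF ck] P0[OF ck] P0[OF ck']; auto)+
  moreover have "A *v y = - (A *v conjv k' + A *v conjv k + A *v conjv w)" for A :: "complex ^ 'n ^ 'n"
    by (simp only: y_def neg matrix_vector_right_distrib)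
  ultimately have Py: "proj_K *v y = - conjv k'" "proj_K' *v y = - conjv k" "proj_v *v y = 0" "proj_f *v y = - conjv w"
    by (simp_all add: proj_W_m2[OF cw])
  have "M *v y = - conjv b"
    unfolding M Py Mx by (simp add: u0 neg conjv_add conjv_minus)
  also have "\<dots> = b" by (simp add: b_def conjv_diff)
  finally have "M *v y = M *v x" using b by simp
  then have "y = x" using cramer[OF x(1), of y "M *v x"] cramer[OF x(1), of x "M *v x"] by metis
  then have kk: "k' = - conjv k" using Py(1) by (simp add: k_def conjv_minus)
  show ?thesis
  proof (rule that[of "v - k"])
    have "k \<in> F 0" unfolding F_eq[of 0] using k by (rule piece_span_weaken[rotated]) auto
    then show "v - k \<in> F 0" using v(1) J_sub_F by (intro vec.subspace_diff[OF subspace_F]) auto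
    have Evk: "E *v (v - k) = E *v v - E *v k" by (rule matrix_vector_mult_diff_distrib)
    have "(E *v v - e) - E *v k \<in> W (-1)" by (rule vec.subspace_diff[OF subspace_W Eve exp(2)[OF kW(1)]])
    then show "E *v (v - k) - e \<in> W (-1)" by (simp add: Evk algebra_simps)
    have "conjv (E *v conjv k') = - conjv (E *v k)" by (simp add: kk conjv_minus neg)
    then have "w = b - E *v k + conjv (E *v k)" using Mx u0 by simp
    then show "E *v (v - k) - conjv (E *v (v - k)) = proj_f *v x"
      by (simp add: Evk b_def conjv_diff algebra_simps flip: w_def)
  qed
qed

end

section \<open>The Chern form\<close>

lemma holomorphic_matpow:
  assumes "holomorphic_mat_on \<Gamma> U" shows "holomorphic_mat_on (\<lambda>z. matpow (\<Gamma> z) k) U"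
proof (induction k)
  case (Suc k)
  then show ?case using assms
    by (auto simp: holomorphic_mat_on_def matpow_Suc matrix_matrix_mult_def intro!: holomorphic_intros)
qed (auto simp: holomorphic_mat_on_def)

lemma holomorphic_matrix_exp:
  assumes \<Gamma>: "holomorphic_mat_on \<Gamma> U" and N: "\<And>z. z \<in> U \<Longrightarrow> matpow (\<Gamma> z) N = 0"
  shows "holomorphic_mat_on (\<lambda>z. matrix_exp (\<Gamma> z)) U"
  unfolding holomorphic_mat_on_def
proof (intro allI)
  fix i j
  have *: "(\<lambda>z. matpow (\<Gamma> z) k $ i $ j) holomorphic_on U" for k
    using holomorphic_matpow[OF \<Gamma>] by (simp add: holomorphic_mat_on_def)
  have "(\<lambda>z. \<Sum>k<N. complex_of_real (1 / fact k) * matpow (\<Gamma> z) k $ i $ j) holomorphic_on U"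
    by (intro holomorphic_intros *)
  then show "(\<lambda>z. matrix_exp (\<Gamma> z) $ i $ j) holomorphic_on U"
    by (rule holomorphic_transform) (simp add: matrix_exp_nilpotent[OF N] scaleR_conv_of_real[where 'a = complex])
qed

lemma deriv_mat_nth:
  assumes "holomorphic_mat_on A U" "open U" "z \<in> U"
  shows "((\<lambda>w. A w $ i $ j) has_field_derivative deriv_mat A z $ i $ j) (at z)"
  using assms by (auto simp: holomorphic_mat_on_def deriv_mat_def intro: holomorphic_derivI)

text \<open>As \<open>\<Gamma> 0 = 0\<close>, the exponential agrees with
  \<open>1 + \<Gamma>\<close> to first order at the origin, although the values of
  \<open>\<Gamma>\<close> need not commute.\<close>

lemma deriv_matrix_exp:
  assumes \<Gamma>: "holomorphic_mat_on \<Gamma> U" "open U" "0 \<in> U" "\<Gamma> 0 = 0"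
    and N: "\<And>z. z \<in> U \<Longrightarrow> matpow (\<Gamma> z) N = 0" "N \<ge> 2"
  shows "matrix_exp (\<Gamma> 0) = mat 1" "deriv_mat (\<lambda>z. matrix_exp (\<Gamma> z)) 0 = deriv_mat \<Gamma> 0"
proof -
  have p0: "matpow (0 :: complex ^ 'a ^ 'a) k = (if k = 0 then mat 1 else 0)" for k
    by (cases k) (simp_all add: matpow_Suc matrix_matrix_mult_def vec_eq_iff)
  show "matrix_exp (\<Gamma> 0) = mat 1"
    using matrix_exp_nilpotent[of "0 :: complex ^ 'a ^ 'a" 1] by (simp add: \<Gamma>(4) p0)
  \<comment> \<open>For \<open>k \<ge> 2\<close> every term of the product rule retains a factor
    \<open>\<Gamma> 0\<close>.\<close>
  have d: "((\<lambda>z. matpow (\<Gamma> z) k $ i $ j) has_field_derivative (if k = 1 then deriv_mat \<Gamma> 0 $ i $ j else 0)) (at 0)" for k i j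
  proof (induction k arbitrary: i j)
    case (Suc k)
    have "((\<lambda>z. \<Sum>l\<in>UNIV. \<Gamma> z $ i $ l * matpow (\<Gamma> z) k $ l $ j) has_field_derivative
      (\<Sum>l\<in>UNIV. deriv_mat \<Gamma> 0 $ i $ l * matpow (\<Gamma> 0) k $ l $ j + (if k = 1 then deriv_mat \<Gamma> 0 $ l $ j else 0) * \<Gamma> 0 $ i $ l)) (at 0)"
      by (intro DERIV_sum DERIV_mult deriv_mat_nth[OF \<Gamma>(1-3)] Suc)
    moreover have "(\<Sum>l\<in>UNIV. deriv_mat \<Gamma> 0 $ i $ l * matpow (\<Gamma> 0) k $ l $ j) = (deriv_mat \<Gamma> 0 ** matpow (\<Gamma> 0) k) $ i $ j"
      by (simp add: matrix_matrix_mult_def)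
    ultimately show ?case
      by (simp add: matpow_Suc matrix_matrix_mult_def[of "\<Gamma> _"] \<Gamma>(4) p0 split: if_splits)
  qed simp
  have "deriv (\<lambda>z. matrix_exp (\<Gamma> z) $ i $ j) 0 = deriv_mat \<Gamma> 0 $ i $ j" for i j
  proof -
    have "((\<lambda>z. \<Sum>k<N. complex_of_real (1 / fact k) * matpow (\<Gamma> z) k $ i $ j) has_field_derivative
      (\<Sum>k<N. complex_of_real (1 / fact k) * (if k = 1 then deriv_mat \<Gamma> 0 $ i $ j else 0))) (at 0)"
      by (intro DERIV_sum DERIV_cmult d)
    moreover have "(\<Sum>k<N. complex_of_real (1 / fact k) * (if k = 1 then deriv_mat \<Gamma> 0 $ i $ j else 0))
        = (\<Sum>k<N. if k = 1 then deriv_mat \<Gamma> 0 $ i $ j else 0)"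
      by (rule sum.cong) auto
    moreover have "\<dots> = deriv_mat \<Gamma> 0 $ i $ j" using N(2) by simp
    ultimately have "((\<lambda>z. \<Sum>k<N. complex_of_real (1 / fact k) * matpow (\<Gamma> z) k $ i $ j) has_field_derivative
      deriv_mat \<Gamma> 0 $ i $ j) (at 0)" by simp
    then have "((\<lambda>z. matrix_exp (\<Gamma> z) $ i $ j) has_field_derivative deriv_mat \<Gamma> 0 $ i $ j) (at 0)"
      by (rule has_field_derivative_transform_within_open[OF _ \<Gamma>(2,3)])
         (simp add: matrix_exp_nilpotent[OF N(1)] scaleR_conv_of_real[where 'a = complex])
    then show ?thesis by (rule DERIV_imp_deriv)
  qed
  then show "deriv_mat (\<lambda>z. matrix_exp (\<Gamma> z)) 0 = deriv_mat \<Gamma> 0" by (simp add: deriv_mat_def vec_eq_iff)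
qed

context biext
begin

text \<open>Being lowering means that the projection \<open>P\<close> onto the forbidden pieces
  kills \<open>\<Gamma> w *v v\<close> for all \<open>w\<close>; differentiating this linear
  identity gives the same for the derivative.\<close>

lemma deriv_lowering:
  assumes \<Gamma>: "holomorphic_mat_on \<Gamma> U" "open U" "z \<in> U" "\<And>w. w \<in> U \<Longrightarrow> \<Gamma> w \<in> lowering"
  shows "deriv_mat \<Gamma> z \<in> lowering"
  unfolding lowering_def
proof (clarify)
  fix p q v assume v: "v \<in> J p q"
  let ?T = "{(a, b). a < p}"
  define P where "P = piece_proj J (- ?T)"
  have zero: "P *v (\<Gamma> w *v v) = 0" if "w \<in> U" for w
    unfolding P_def by (rule piece_proj_0[OF direct_sum_J, of _ ?T]) (use \<Gamma>(4)[OF that] v in \<open>auto simp: lowering_def\<close>)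
  have "(P *v (deriv_mat \<Gamma> z *v v)) $ i = 0" for i
  proof -
    have "((\<lambda>w. \<Sum>j\<in>UNIV. P $ i $ j * (\<Sum>k\<in>UNIV. \<Gamma> w $ j $ k * v $ k)) has_field_derivative
      (\<Sum>j\<in>UNIV. P $ i $ j * (\<Sum>k\<in>UNIV. deriv_mat \<Gamma> z $ j $ k * v $ k))) (at z)"
      by (intro DERIV_sum DERIV_cmult DERIV_cmult_right deriv_mat_nth[OF \<Gamma>(1-3)])
    then have "((\<lambda>w. (P *v (\<Gamma> w *v v)) $ i) has_field_derivative (P *v (deriv_mat \<Gamma> z *v v)) $ i) (at z)"
      by (simp add: matrix_vector_mult_def)
    then have "((\<lambda>w. 0) has_field_derivative (P *v (deriv_mat \<Gamma> z *v v)) $ i) (at z)"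
      by (rule has_field_derivative_transform_within_open[OF _ \<Gamma>(2,3)]) (simp add: zero)
    then show ?thesis using DERIV_unique DERIV_const by blast
  qed
  then have P0: "P *v (deriv_mat \<Gamma> z *v v) = 0" by (simp add: vec_eq_iff)
  obtain a b where ab: "a \<in> piece_span J ?T" "b \<in> piece_span J (- ?T)" "deriv_mat \<Gamma> z *v v = a + b"
    using piece_span_split[OF direct_sum_J] by blast
  have "P *v a = 0" unfolding P_def by (rule piece_proj_0[OF direct_sum_J ab(1)]) auto
  moreover have "P *v b = b" unfolding P_def by (rule piece_proj_id[OF direct_sum_J ab(2)])
  ultimately have "b = 0" using P0 by (simp add: ab(3) matrix_vector_right_distrib)
  then show "deriv_mat \<Gamma> z *v v \<in> piece_span J ?T" using ab by simp
qed

end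

text \<open>For \<open>x\<close> in \<open>F 0 p\<close> the curve
  \<open>exp (\<Gamma> z) *v x\<close> is a holomorphic section of \<open>F z p\<close> with
  derivative \<open>\<Gamma>'(0) *v x\<close> at the origin. So \<open>\<Gamma>'(0)\<close> and the
  horizontal representative \<open>\<xi>\<close> differ by a lowering endomorphism that preserves
  the filtration, which is zero.\<close>

lemma deriv_normal_form_horizontal:
  fixes F :: "complex \<Rightarrow> 'n::finite filtration"
  assumes B: "biext W (F 0) Q e f" and r: "r > 0"
    and hor: "\<exists>\<xi>\<in>horizontal_part W Q (F 0). represents_period_tangent (ball 0 r) F 0 \<xi>"
    and nf: "local_normal_form (ball 0 r) W Q F \<Gamma>"
  shows "deriv_mat \<Gamma> 0 \<in> horizontal_part W Q (F 0)"
proof -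
  interpret biext W "F 0" Q e f by (rule B)
  let ?D = "ball (0::complex) r" and ?E = "\<lambda>z. matrix_exp (\<Gamma> z)"
  have D: "open ?D" "0 \<in> ?D" using r by auto
  have \<Gamma>: "holomorphic_mat_on \<Gamma> ?D" "\<Gamma> 0 = 0" and Fz: "\<And>z p. z \<in> ?D \<Longrightarrow> F z p = ((*v) (?E z)) ` F 0 p"
    and \<Gamma>q: "\<And>z. z \<in> ?D \<Longrightarrow> \<Gamma> z \<in> lowering \<inter> weight_preserving"
    using nf q_alg_sub by (auto simp: local_normal_form_def)
  obtain N where N: "N \<ge> 2" "\<And>X. X \<in> lowering \<Longrightarrow> matpow X N = 0" by (rule lowering_nilpotent) blast
  have N': "\<And>z. z \<in> ?D \<Longrightarrow> matpow (\<Gamma> z) N = 0" using N(2) \<Gamma>q by blast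
  have E: "holomorphic_mat_on ?E ?D" "?E 0 = mat 1" "deriv_mat ?E 0 = deriv_mat \<Gamma> 0"
    using holomorphic_matrix_exp[OF \<Gamma>(1)] deriv_matrix_exp[OF \<Gamma>(1) D \<Gamma>(2)] N' N(1) by blast+
  obtain \<xi> where \<xi>: "\<xi> \<in> horizontal_part W Q (F 0)" "represents_period_tangent ?D F 0 \<xi>" using hor by blast
  have "\<xi> \<in> lowering" using \<xi>(1) horizontal_sub_q q_alg_sub by blast
  moreover have "deriv_mat \<Gamma> 0 \<in> lowering" by (rule deriv_lowering[OF \<Gamma>(1) D]) (use \<Gamma>q in blast)
  moreover have "subspace lowering" unfolding lowering_def by (rule subspace_maps)
  ultimately have low: "deriv_mat \<Gamma> 0 - \<xi> \<in> lowering" by (intro subspace_diff)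
  have "deriv_mat \<Gamma> 0 - \<xi> = 0"
  proof (rule lowering_preserving_F[OF low])
    fix p x assume x: "x \<in> F 0 p"
    let ?v = "\<lambda>z. ?E z *v x"
    have "holomorphic_vec_on ?v ?D"
      using E(1) by (auto simp: holomorphic_vec_on_def holomorphic_mat_on_def matrix_vector_mult_def intro!: holomorphic_intros)
    moreover have "\<forall>w\<in>?D. ?v w \<in> F w p" using Fz x by blast
    ultimately have "deriv_vec ?v 0 - \<xi> *v ?v 0 \<in> F 0 p"
      using \<xi>(2) D unfolding represents_period_tangent_def by blast
    moreover have "deriv_vec ?v 0 = deriv_mat \<Gamma> 0 *v x"
    proof -
      have "((\<lambda>w. \<Sum>k\<in>UNIV. ?E w $ i $ k * x $ k) has_field_derivative (\<Sum>k\<in>UNIV. deriv_mat ?E 0 $ i $ k * x $ k)) (at 0)" for i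
        by (intro DERIV_sum DERIV_cmult_right deriv_mat_nth[OF E(1) D])
      then show ?thesis by (simp add: deriv_vec_def matrix_vector_mult_def vec_eq_iff DERIV_imp_deriv E(3))
    qed
    ultimately show "(deriv_mat \<Gamma> 0 - \<xi>) *v x \<in> F 0 p" by (simp add: E(2) matrix_vector_mult_diff_rdistrib)
  qed
  then show ?thesis using \<xi>(1) by simp
qed

section \<open>From the real function \<open>delta\<close> to the Chern form\<close>

lemma twice_differentiable_Re:
  assumes "wirtinger2 g z" "\<forall>\<^sub>F w in nhds z. h w = Re (g w)"
  shows "twice_differentiable_at h z"
proof -
  have hd: "\<forall>\<^sub>F w in nhds z. (h has_derivative (\<lambda>v. Re (wirtinger g w * v + wirtinger_bar g w * cnj v))) (at w)"
  proof -
    have "\<forall>\<^sub>F w in nhds z. \<forall>\<^sub>F y in nhds w. Re (g y) = h y"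
      using assms(2) by (auto simp: eventually_eventually eq_commute)
    then show ?thesis using wirtinger2_imp(1)[OF assms(1)]
    proof eventually_elim
      case (elim w)
      have "((\<lambda>y. Re (g y)) has_derivative (\<lambda>v. Re (wirtinger g w * v + wirtinger_bar g w * cnj v))) (at w)"
        by (rule has_derivative_Re[OF elim(2)[unfolded has_wirtinger_def]])
      then show ?case by (rule has_derivative_nhds_cong[OF elim(1)])
    qed
  qed
  have "(\<lambda>w. frechet_derivative h (at w) v) differentiable (at z)" for v
  proof -
    have eq: "\<forall>\<^sub>F w in nhds z. Re (wirtinger g w * v + wirtinger_bar g w * cnj v) = frechet_derivative h (at w) v"
      using hd by eventually_elim (drule frechet_derivative_at, metis)
    obtain D1 D2 where "(wirtinger g has_derivative D1) (at z)" "(wirtinger_bar g has_derivative D2) (at z)"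
      using wirtinger2_imp(2,3)[OF assms(1)] unfolding differentiable_def by blast
    then have "((\<lambda>w. Re (wirtinger g w * v + wirtinger_bar g w * cnj v)) has_derivative (\<lambda>h. Re (D1 h * v + D2 h * cnj v))) (at z)"
      by (intro has_derivative_Re has_derivative_add has_derivative_mult_left)
    then show ?thesis unfolding differentiable_def using has_derivative_nhds_cong[OF eq] by blast
  qed
  moreover have "\<forall>\<^sub>F w in nhds z. h differentiable (at w)"
    using hd by eventually_elim (auto simp: differentiable_def)
  ultimately show ?thesis by (simp add: twice_differentiable_at_def)
qed

text \<open>The logarithm of the metric is \<open>- 2 * pi * d\<close>, and \<open>- 2 * pi\<close>
  divided by \<open>2 * pi * \<i>\<close> is \<open>\<i>\<close>.\<close>

lemma chern_form_exp:
  assumes "wirtinger2 (\<lambda>w. complex_of_real (d w)) z"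
  shows "chern_form (\<lambda>w. exp (- 2 * pi * d w)) z u v
    = \<i> * wirtinger (wirtinger_bar (\<lambda>w. complex_of_real (d w))) z * ds_dsbar u v"
proof -
  let ?d = "\<lambda>w. complex_of_real (d w)" and ?k = "complex_of_real (- 2 * pi)"
  have "mixed (\<lambda>w. ?k * ?d w) z = ?k * mixed ?d z"
    using wirtinger2_mult(2)[OF wirtinger2_const assms, of ?k] by (simp add: wirtinger_const)
  moreover have "(\<lambda>w. complex_of_real (ln (exp (- 2 * pi * d w)))) = (\<lambda>w. ?k * ?d w)" by simp
  \<comment> \<open>The recovery of the coefficient of a \<open>(0, 1)\<close>-form from its values
    on \<open>1\<close> and \<open>\<i>\<close>, as in \<open>del_form\<close>.\<close>
  moreover have "(b + \<i> * (b * cnj \<i>)) / 2 = b" for b by (simp add: complex_eq_iff)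
  ultimately show ?thesis
    by (simp add: chern_form_def del_form_def delbar_def mixed_def field_simps)
qed

theorem theorem8p1:
  fixes W :: "'n::finite filtration"
    and Q :: "int \<Rightarrow> complex ^ 'n \<Rightarrow> complex ^ 'n \<Rightarrow> complex"
    and F :: "complex \<Rightarrow> 'n filtration"
    and \<Gamma> :: "complex \<Rightarrow> complex ^ 'n ^ 'n"
    and e f :: "complex ^ 'n"
    and r l :: real
  assumes "r > 0"
    and "biextension_variation (ball 0 r) W Q F"
    and "local_normal_form (ball 0 r) W Q F \<Gamma>"
    and "extreme_gr_bases W e f"
    and "l \<noteq> 0"
  shows "let \<delta> = (\<lambda>s. biext_delta W l e f (F s));
             h = (\<lambda>s. h_biext W l e f (F s));
             \<gamma> = hodge_component W Q (F 0) (-1) 0 (deriv_mat \<Gamma> 0)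
         in twice_differentiable_at \<delta> 0 \<and>
            (\<forall>u v. chern_form h 0 u v
                = \<i> * wirtinger (wirtinger_bar (\<lambda>s. complex_of_real (\<delta> s))) 0 * ds_dsbar u v) \<and>
            (\<forall>u v. \<i> * wirtinger (wirtinger_bar (\<lambda>s. complex_of_real (\<delta> s))) 0 * ds_dsbar u v
                = 1 / 2 * hom_coord l e f (commutator \<gamma> (conjm \<gamma>)) * ds_dsbar u v)"
proof -
  let ?D = "ball (0::complex) r" and ?E = "\<lambda>z. matrix_exp (\<Gamma> z)"
  have D: "open ?D" "0 \<in> ?D" using assms(1) by auto
  have bx: "biext W (F z) Q e f" if "z \<in> ?D" for z
  proof -
    have "biextension_type W (F z) Q" using assms(2) that by (simp add: biextension_variation_def)
    then show ?thesis
      by unfold_locales (use assms(4) in \<open>auto simp: biextension_type_def\<close>)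
  qed
  interpret biext W "F 0" Q e f by (rule bx[OF D(2)])
  define G where "G = deriv_mat \<Gamma> 0"
  define Z where "Z = hodge_component W Q (F 0) (-1) 0 G"
  have hor: "G \<in> horizontal_part W Q (F 0)" unfolding G_def
    by (rule deriv_normal_form_horizontal[OF bx[OF D(2)] assms(1) _ assms(3)])
       (use assms(2) D(2) in \<open>simp add: biextension_variation_def\<close>)
  have \<Gamma>: "holomorphic_mat_on \<Gamma> ?D" "\<Gamma> 0 = 0" and Fz: "\<And>z p. z \<in> ?D \<Longrightarrow> F z p = ((*v) (?E z)) ` F 0 p"
    and \<Gamma>q: "\<And>z. z \<in> ?D \<Longrightarrow> \<Gamma> z \<in> lowering \<inter> weight_preserving"
    using assms(3) q_alg_sub by (auto simp: local_normal_form_def)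
  obtain N where N: "N \<ge> 2" "\<And>X. X \<in> lowering \<Longrightarrow> matpow X N = 0" by (rule lowering_nilpotent) blast
  have N': "\<And>z. z \<in> ?D \<Longrightarrow> matpow (\<Gamma> z) N = 0" using N(2) \<Gamma>q by blast
  have E: "holomorphic_mat_on ?E ?D" "?E 0 = mat 1" "deriv_mat ?E 0 = deriv_mat \<Gamma> 0"
    using holomorphic_matrix_exp[OF \<Gamma>(1)] deriv_matrix_exp[OF \<Gamma>(1) D \<Gamma>(2)] N' N(1) by blast+
  have EG: "deriv_mat ?E 0 = G" by (simp add: E(3) G_def)
  obtain v where v: "v \<in> J 0 0" "v - e \<in> W (-1)" by (rule generator_exists)
  have vv: "v - conjv v \<in> W (-2)" by (rule J_00_conj[OF v])
  obtain x where x: "\<forall>\<^sub>F s in nhds 0. det (?E s ** proj_K + conjm (?E s) ** proj_K' + (proj_v + proj_f)) \<noteq> 0 \<and>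
      (?E s ** proj_K + conjm (?E s) ** proj_K' + (proj_v + proj_f)) *v x s = ?E s *v v - conjm (?E s) *v conjv v"
    and w2x: "\<And>i. wirtinger2 (\<lambda>s. x s $ i) 0"
    and mx: "(\<chi> i. mixed (\<lambda>s. x s $ i) 0) = G *v (proj_K *v (conjm G *v conjv v)) - conjm G *v (proj_K' *v (G *v v))"
    by (rule harmonic_linear_system[OF E(1) D E(2) proj_sum proj_W_m2(1,2)[OF vv], unfolded EG]) (rule that)
  \<comment> \<open>A nonzero entry of \<open>f\<close> reads off the coefficient along
    \<open>f\<close>, so that \<open>c\<close> is a fixed linear functional of \<open>x\<close> and
    commutes with derivatives.\<close>
  obtain j where j: "f $ j \<noteq> 0" using f_nz by (auto simp: vec_eq_iff)
  define \<phi> where "\<phi> k = proj_f $ j $ k / f $ j" for k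
  define c where "c s = (\<Sum>k\<in>UNIV. \<phi> k * x s $ k)" for s
  \<comment> \<open>The factor that converts the defect \<open>c\<close> into the normalized
    coordinate of \<open>delta\<close>.\<close>
  define \<kappa> where "\<kappa> = - (\<i> / 2) / complex_of_real l"
  have coord: "w = (w $ j / f $ j) *s f" if "w \<in> W (-2)" for w
    using that W_m2 j by auto
  have c: "c s = (proj_f *v x s) $ j / f $ j" for s
    by (simp add: c_def \<phi>_def matrix_vector_mult_def sum_divide_distrib)
  have "\<forall>\<^sub>F s in nhds 0. s \<in> ?D" using D by (rule eventually_nhds_in_open)
  then have delta: "\<forall>\<^sub>F s in nhds 0. \<kappa> * c s = complex_of_real (biext_delta W l e f (F s))"
    using x
  proof eventually_elim
    case (elim s)
    \<comment> \<open>Weights and bases are constant, so the formula for \<open>delta\<close>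
      applies to the fibre at \<open>s\<close>, whereas the linear system uses the bigrading at
      \<open>0\<close>.\<close>
    interpret s: biext W "F s" Q e f by (rule bx[OF elim(1)])
    obtain y where y: "y \<in> F 0 0" "?E s *v y - e \<in> W (-1)" "?E s *v y - conjv (?E s *v y) = proj_f *v x s"
      by (rule transported_generator[OF \<Gamma>q[OF elim(1)] v conjunct1[OF elim(2)] conjunct2[OF elim(2)]])
    have yF: "?E s *v y \<in> F s 0" using y(1) Fz[OF elim(1)] by blast
    have pW: "proj_f *v x s \<in> W (-2)"
      using piece_proj_in[OF direct_sum_J, of "{(-1, -1)}" "x s"] J_m1m1 piece_span_single by (simp add: proj_f_def)
    have pf: "?E s *v y - conjv (?E s *v y) = c s *s f" unfolding y(3) c by (rule coord[OF pW])
    have "hom_coord l e f (deligne_delta W (F s)) = \<kappa> * c s"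
      using s.hom_coord_deligne_delta[OF yF y(2) pf] by (simp add: \<kappa>_def)
    \<comment> \<open>The defect is imaginary, so the product is real and equals the real part taken
      in \<open>biext_delta\<close>.\<close>
    moreover have "cnj (\<kappa> * c s) = \<kappa> * c s" using s.defect_imaginary[OF pf] by (simp add: \<kappa>_def)
    then have "complex_of_real (Re (\<kappa> * c s)) = \<kappa> * c s" by (simp add: complex_eq_iff)
    ultimately show ?case by (simp add: biext_delta_def)
  qed
  have w2c: "wirtinger2 c 0" and mc: "mixed c 0 = (\<Sum>k\<in>UNIV. \<phi> k * mixed (\<lambda>s. x s $ k) 0)"
  proof -
    have w: "wirtinger2 (\<lambda>s. \<phi> k * x s $ k) 0" for k
      by (intro wirtinger2_mult wirtinger2_const w2x)
    show "wirtinger2 c 0" unfolding c_def by (intro wirtinger2_sum w)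
    show "mixed c 0 = (\<Sum>k\<in>UNIV. \<phi> k * mixed (\<lambda>s. x s $ k) 0)"
      unfolding c_def by (simp add: wirtinger2_sum[OF w] wirtinger2_mult[OF wirtinger2_const w2x] wirtinger_const)
  qed
  have w2\<kappa>: "wirtinger2 (\<lambda>s. \<kappa> * c s) 0" by (intro wirtinger2_mult wirtinger2_const w2c)
  have m\<kappa>: "mixed (\<lambda>s. \<kappa> * c s) 0 = \<kappa> * mixed c 0"
    using wirtinger2_mult(2)[OF wirtinger2_const w2c, of \<kappa>] by (simp add: wirtinger_const)
  note \<delta> = wirtinger2_cong[OF delta w2\<kappa>]
  have "mixed c 0 = (proj_f *v (\<chi> i. mixed (\<lambda>s. x s $ i) 0)) $ j / f $ j"
    by (simp add: mc \<phi>_def matrix_vector_mult_def sum_divide_distrib)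
  also have "\<dots> = (commutator Z (conjm Z) *v e) $ j / f $ j"
    unfolding mx proj_f_commutator(1)[OF hor v] Z_def ..
  finally have mixed_c: "mixed c 0 = (commutator Z (conjm Z) *v e) $ j / f $ j" .
  have "commutator Z (conjm Z) *v e \<in> W (-2)" unfolding Z_def by (rule proj_f_commutator(2)[OF hor v])
  then have comm: "commutator Z (conjm Z) *v e = mixed c 0 *s f" unfolding mixed_c by (rule coord)
  have "(THE d. commutator Z (conjm Z) *v e = d *s f) = mixed c 0"
    unfolding comm using f_nz by (intro the_equality) (auto simp only: vector_mul_rcancel)
  then have hc: "hom_coord l e f (commutator Z (conjm Z)) = mixed c 0 / complex_of_real l"
    by (simp add: hom_coord_def)
  \<comment> \<open>Here \<open>\<i> * \<kappa>\<close> is \<open>1 / (2 * l)\<close>, and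
    \<open>hom_coord\<close> already contains the division by \<open>l\<close>.\<close>
  have main: "\<i> * wirtinger (wirtinger_bar (\<lambda>s. complex_of_real (biext_delta W l e f (F s)))) 0
      = 1 / 2 * hom_coord l e f (commutator Z (conjm Z))"
    using \<delta>(2) m\<kappa> by (simp add: hc mixed_def \<kappa>_def)
  have "twice_differentiable_at (\<lambda>s. biext_delta W l e f (F s)) 0"
    by (rule twice_differentiable_Re[OF \<delta>(1)]) simp
  moreover have "chern_form (\<lambda>s. h_biext W l e f (F s)) 0 u v
      = \<i> * wirtinger (wirtinger_bar (\<lambda>s. complex_of_real (biext_delta W l e f (F s)))) 0 * ds_dsbar u v" for u v
    unfolding h_biext_def by (rule chern_form_exp[OF \<delta>(1)])
  ultimately show ?thesis
    unfolding Let_def G_def[symmetric] Z_def[symmetric] main by blast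
qed

end
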